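(* Let $r\ge 2$ and $s>1$ be integers, and let $F$ be a graph whose connected components consist of $s$ components of chromatic number $r+1$, each having a color-critical edge, together with any number of components of chromatic number at most $r$. Let $H$ be a weakly $F$-Turán-stable graph. Then for $n$ sufficiently large, $\mathrm{ex}(n,H,F)=\mathcal{N}(H,T)$ for some $n$-vertex complete $(s+r-1)$-partite graph $T$ having $s-1$ parts of order $1$.
   Context: All graphs are finite and simple. $\mathcal{N}(H,G)$ is the number of subgraphs of $G$ isomorphic to $H$, and $\mathrm{ex}(n,H,F)$ is the maximum of $\mathcal{N}(H,G)$ over $n$-vertex $F$-free graphs $G$. An edge $e$ of a graph $F_0$ is color-critical if $\chi(F_0-e)<\chi(F_0)$. The edit distance between two graphs on the same vertex set is the least number of edges one must add and delete to turn one into the other. $H$ is weakly $F$-Turán-stable if every $n$-vertex $F$-free graph $G$ with $\mathcal{N}(H,G)\ge \mathrm{ex}(n,H,F)-o(n^{|V(H)|})$ has edit distance $o(n^2)$ from some complete $(\chi(F)-1)$-partite graph on $V(G)$ (asymptotics as $n\to\infty$ with $F,H$ fixed). *)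

theory Defs
  imports Complex_Main
begin

type_synonym 'a ugraph = "'a set \<times> 'a set set"

definition wf_graph :: "'a ugraph \<Rightarrow> bool" where
  "wf_graph G \<longleftrightarrow> finite (fst G) \<and>
     (\<forall>e\<in>snd G. \<exists>u v. u \<noteq> v \<and> e = {u, v} \<and> u \<in> fst G \<and> v \<in> fst G)"

definition subgraph :: "'a ugraph \<Rightarrow> 'a ugraph \<Rightarrow> bool" where
  "subgraph S G \<longleftrightarrow> fst S \<subseteq> fst G \<and> snd S \<subseteq> snd G \<and> (\<forall>e\<in>snd S. e \<subseteq> fst S)"

definition graph_iso :: "'a ugraph \<Rightarrow> 'b ugraph \<Rightarrow> bool" where
  "graph_iso G1 G2 \<longleftrightarrow> (\<exists>f. bij_betw f (fst G1) (fst G2) \<and>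
     (\<forall>u\<in>fst G1. \<forall>v\<in>fst G1. {u, v} \<in> snd G1 \<longleftrightarrow> {f u, f v} \<in> snd G2))"

definition count_sub :: "'b ugraph \<Rightarrow> 'a ugraph \<Rightarrow> nat" where
  "count_sub H G = card {S. subgraph S G \<and> graph_iso S H}"

definition F_free :: "'b ugraph \<Rightarrow> 'a ugraph \<Rightarrow> bool" where
  "F_free F G \<longleftrightarrow> \<not> (\<exists>S. subgraph S G \<and> graph_iso S F)"

text \<open>ex(n,H,F), taken over graphs with vertex set {0..<n} (every n-vertex graph is
  isomorphic to one of these).\<close>
definition ex_gen :: "nat \<Rightarrow> 'b ugraph \<Rightarrow> 'c ugraph \<Rightarrow> nat" where
  "ex_gen n H F = Max {count_sub H G | G :: nat ugraph.
      wf_graph G \<and> fst G = {0..<n} \<and> F_free F G}"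

definition colorable :: "'a ugraph \<Rightarrow> nat \<Rightarrow> bool" where
  "colorable G k \<longleftrightarrow> (\<exists>c :: 'a \<Rightarrow> nat. (\<forall>v\<in>fst G. c v < k) \<and>
      (\<forall>u v. {u, v} \<in> snd G \<longrightarrow> c u \<noteq> c v))"

definition chi :: "'a ugraph \<Rightarrow> nat" where
  "chi G = (LEAST k. colorable G k)"

definition color_critical_edge :: "'a ugraph \<Rightarrow> 'a set \<Rightarrow> bool" where
  "color_critical_edge G e \<longleftrightarrow> e \<in> snd G \<and> chi (fst G, snd G - {e}) < chi G"

definition adj :: "'a ugraph \<Rightarrow> 'a \<Rightarrow> 'a \<Rightarrow> bool" where
  "adj G u v \<longleftrightarrow> u \<in> fst G \<and> v \<in> fst G \<and> {u, v} \<in> snd G"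

definition comps :: "'a ugraph \<Rightarrow> 'a set set" where
  "comps G = {C. \<exists>v\<in>fst G. C = {w \<in> fst G. (adj G)\<^sup>*\<^sup>* v w}}"

definition induced :: "'a ugraph \<Rightarrow> 'a set \<Rightarrow> 'a ugraph" where
  "induced G C = (C, {e \<in> snd G. e \<subseteq> C})"

definition complete_multipartite_parts :: "nat \<Rightarrow> (nat \<Rightarrow> 'a set) \<Rightarrow> 'a ugraph \<Rightarrow> bool" where
  "complete_multipartite_parts k P G \<longleftrightarrow>
     (\<forall>i<k. P i \<noteq> {}) \<and>
     (\<forall>i<k. \<forall>j<k. i \<noteq> j \<longrightarrow> P i \<inter> P j = {}) \<and>
     (\<Union>i<k. P i) = fst G \<and>
     snd G = {{u, v} | u v. \<exists>i<k. \<exists>j<k. i \<noteq> j \<and> u \<in> P i \<and> v \<in> P j}"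

definition complete_multipartite :: "nat \<Rightarrow> 'a ugraph \<Rightarrow> bool" where
  "complete_multipartite k G \<longleftrightarrow> (\<exists>P. complete_multipartite_parts k P G)"

definition edit_dist :: "'a ugraph \<Rightarrow> 'a ugraph \<Rightarrow> nat" where
  "edit_dist G1 G2 = card ((snd G1 - snd G2) \<union> (snd G2 - snd G1))"

text \<open>Weak F-Turan-stability, with the o(.) asymptotics written in epsilon-delta form.\<close>
definition weakly_turan_stable :: "'b ugraph \<Rightarrow> 'c ugraph \<Rightarrow> bool" where
  "weakly_turan_stable H F \<longleftrightarrow>
     (\<forall>\<epsilon>>0. \<exists>\<delta>>0. \<exists>n0. \<forall>n\<ge>n0. \<forall>G :: nat ugraph.
        wf_graph G \<and> fst G = {0..<n} \<and> F_free F G \<and>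
        real (count_sub H G) \<ge> real (ex_gen n H F) - \<delta> * real n ^ card (fst H) \<longrightarrow>
        (\<exists>T. wf_graph T \<and> fst T = fst G \<and> complete_multipartite (chi F - 1) T \<and>
             real (edit_dist G T) \<le> \<epsilon> * real n ^ 2))"

end

theory Submission
  imports Defs "HOL-Library.FuncSet" "HOL-Combinatorics.Transposition"
begin

text \<open>
  Copies of \<open>H\<close> are counted through injective homomorphisms. By stability an extremal graph \<open>G\<close> is
  close to a complete \<open>r\<close>-partite graph. Stability also shows that in every near-extremal complete
  \<open>r\<close>-partite graph all parts have linear size, and that a positive proportion of the copies of \<open>H\<close>
  through a vertex use its edges to any linear-sized set of vertices in the other parts: otherwise
  deleting edges would give an \<open>r\<close>-partite graph with almost as many copies which is far from complete
  multipartite. Comparing each vertex with a typical one, every vertex of \<open>G\<close> either has linearly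
  many neighbours in all parts (big) or is adjacent to almost all vertices outside one part.

  An edge inside a part, or a big vertex with a suitable neighbour, hosts a color-critical edge, so
  that \<open>s\<close> disjoint ones would give a copy of \<open>F\<close>. Hence there are fewer than \<open>s\<close> big vertices and
  few edges inside the parts. With fewer than \<open>s - 1\<close> big vertices, joining one more vertex to
  everything gains more copies of \<open>H\<close> than all inside edges contribute; with exactly \<open>s - 1\<close> there
  are no inside edges, and \<open>G\<close> lies in the required complete multipartite graph.
\<close>

text \<open>Nothing is known about how the copies of \<open>H\<close> are distributed in a complete
  multipartite graph, and weak stability speaks only of \<open>F\<close>-free graphs with many
  copies. It yields such information when applied to artificial \<open>r\<close>-partite graphs,
  which are \<open>F\<close>-free because \<open>F\<close> has chromatic number r + 1. Instead a
  vertex is joined to typical vertices only, any few of which have many common neighbours, so that a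
  copy of \<open>F\<close> through it could be rerouted through an old vertex. The decisive
  comparison takes place at order n^(|V(H)|-1): a new universal vertex gains a constant \<gamma>
  times this, whereas the inside edges number only O(\<theta> n), being covered by boundedly many
  vertices with few inside neighbours. Hence \<gamma> has to be fixed before \<theta>, and \<theta>
  before the closeness \<eta> demanded of stability.\<close>

definition all_pairs :: "nat \<Rightarrow> nat set set" where
  "all_pairs n = {{u, v} | u v. u < n \<and> v < n \<and> u \<noteq> v}"

text \<open>Each vertex of \<open>B\<close> is a part of order 1, and the classes of
  \<open>p\<close> outside \<open>B\<close> are the other parts. With parts given by labels, moving
  a vertex to another part is a function update; classes may be empty.\<close>

definition join_mp :: "nat \<Rightarrow> nat set \<Rightarrow> (nat \<Rightarrow> nat) \<Rightarrow> nat set set" where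
  "join_mp n B p = {{u, v} | u v. u < n \<and> v < n \<and> u \<noteq> v \<and> (u \<in> B \<or> v \<in> B \<or> p u \<noteq> p v)}"

abbreviation mp :: "nat \<Rightarrow> (nat \<Rightarrow> nat) \<Rightarrow> nat set set" where
  "mp n p \<equiv> join_mp n {} p"

lemma in_all_pairs [simp]: "{u, v} \<in> all_pairs n \<longleftrightarrow> u < n \<and> v < n \<and> u \<noteq> v"
  unfolding all_pairs_def by (auto simp: doubleton_eq_iff)

lemma in_join_mp [simp]:
  "{u, v} \<in> join_mp n B p \<longleftrightarrow> u < n \<and> v < n \<and> u \<noteq> v \<and> (u \<in> B \<or> v \<in> B \<or> p u \<noteq> p v)"
  unfolding join_mp_def by (auto simp: doubleton_eq_iff)

lemma singleton_notin_all_pairs [simp]: "{u} \<notin> all_pairs n"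
  using in_all_pairs[of u u n] by simp

lemma all_pairsE:
  assumes "e \<in> all_pairs n"
  obtains u v where "e = {u, v}" "u < n" "v < n" "u \<noteq> v"
  using assms unfolding all_pairs_def by blast

lemma finite_all_pairs [simp]: "finite (all_pairs n)"
  by (rule finite_subset[of _ "Pow {..<n}"]) (auto elim!: all_pairsE)

lemma join_mp_subset: "join_mp n B p \<subseteq> all_pairs n"
  unfolding join_mp_def all_pairs_def by blast

lemma subset_pairsI:
  assumes "X \<subseteq> all_pairs n" "\<And>u v. u < n \<Longrightarrow> v < n \<Longrightarrow> u \<noteq> v \<Longrightarrow> {u, v} \<in> X \<Longrightarrow> {u, v} \<in> Y"
  shows "X \<subseteq> Y"
  proof
  fix e assume e: "e \<in> X"
  then have "e \<in> all_pairs n" using assms(1) by blast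
  then obtain u v where "e = {u, v}" "u < n" "v < n" "u \<noteq> v" by (rule all_pairsE)
  then show "e \<in> Y" using assms(2) e by blast
qed

lemma card_ordered_pairs:
  assumes "X \<subseteq> all_pairs n"
  shows "finite {(u, w). {u, w} \<in> X}" "card {(u, w). {u, w} \<in> X} \<le> 2 * card X"
proof -
  have fX: "finite X" using assms finite_subset finite_all_pairs by blast
  have eq: "{(u, w). {u, w} \<in> X} = (\<Union>e\<in>X. {(u, w). {u, w} = e})" by auto
  have fib: "finite {(u, w). {u, w} = e} \<and> card {(u, w). {u, w} = e} \<le> 2" if "e \<in> X" for e
  proof -
    have "e \<in> all_pairs n" using that assms by blast
    then obtain a b where e: "e = {a, b}" by (rule all_pairsE)
    have sub: "{(u, w). {u, w} = e} \<subseteq> {(a, b), (b, a)}"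
      by (auto simp: e doubleton_eq_iff)
    have "card {(a, b), (b, a)} \<le> 2" by (cases "a = b") auto
    moreover have "card {(u, w). {u, w} = e} \<le> card {(a, b), (b, a)}"
      by (rule card_mono[OF _ sub]) simp
    ultimately show ?thesis using finite_subset[OF sub] by simp
  qed
  show "finite {(u, w). {u, w} \<in> X}" unfolding eq using fX fib by blast
  have "card {(u, w). {u, w} \<in> X} \<le> (\<Sum>e\<in>X. card {(u, w). {u, w} = e})"
    unfolding eq by (rule card_UN_le[OF fX])
  also have "\<dots> \<le> (\<Sum>e\<in>X. 2)" by (rule sum_mono) (use fib in auto)
  finally show "card {(u, w). {u, w} \<in> X} \<le> 2 * card X" by simp
qed

lemma card_star_edges:
  assumes "finite A" "finite W"
  shows "finite {{a, w} | a w. a \<in> A \<and> w \<in> W}"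
    "card {{a, w} | a w. a \<in> A \<and> w \<in> W} \<le> card A * card W"
proof -
  have eq: "{{a, w} | a w. a \<in> A \<and> w \<in> W} = (\<lambda>(a, w). {a, w}) ` (A \<times> W)" by auto
  show "finite {{a, w} | a w. a \<in> A \<and> w \<in> W}" unfolding eq using assms by simp
  show "card {{a, w} | a w. a \<in> A \<and> w \<in> W} \<le> card A * card W"
    unfolding eq using card_image_le[of "A \<times> W"] assms by (simp add: card_cartesian_product)
qed

text \<open>Multiplying by powers of \<open>n\<close> on the left, instead of lowering the exponent on the right,
  avoids truncated subtraction.\<close>

lemma card_determined_maps:
  fixes Q :: "('a \<Rightarrow> nat) set"
  assumes "finite V" "A \<subseteq> V" "Q \<subseteq> V \<rightarrow>\<^sub>E {..<n}" "finite R" "k ` Q \<subseteq> R"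
    and det: "\<And>f g x. f \<in> Q \<Longrightarrow> g \<in> Q \<Longrightarrow> k f = k g \<Longrightarrow> x \<in> A \<Longrightarrow> f x = g x"
  shows "card Q * n ^ card A \<le> card R * n ^ card V"
proof -
  let ?m = "\<lambda>f. (k f, restrict f (V - A))"
  have "inj_on ?m Q"
  proof (rule inj_onI)
    fix f g assume fg: "f \<in> Q" "g \<in> Q" "?m f = ?m g"
    have "f x = g x" if "x \<in> V" for x
    proof (cases "x \<in> A")
      case True then show ?thesis using det fg by auto
    next
      case False then show ?thesis using that fg by (metis DiffI Pair_inject restrict_apply')
    qed
    then show "f = g" using fg assms(3) by (meson PiE_ext subsetD)
  qed
  moreover have "?m ` Q \<subseteq> R \<times> ((V - A) \<rightarrow>\<^sub>E {..<n})"
    using assms(3,5) by (fastforce simp: PiE_iff)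
  moreover have "finite (R \<times> ((V - A) \<rightarrow>\<^sub>E {..<n}))"
    using assms by (simp add: finite_PiE)
  ultimately have "card Q \<le> card (R \<times> ((V - A) \<rightarrow>\<^sub>E {..<n}))"
    by (rule card_inj_on_le)
  also have "\<dots> = card R * n ^ card (V - A)"
    using assms by (simp add: card_cartesian_product card_PiE)
  finally have "card Q * n ^ card A \<le> card R * (n ^ card (V - A) * n ^ card A)"
    by (simp add: mult.assoc[symmetric])
  also have "n ^ card (V - A) * n ^ card A = n ^ card V"
    using assms(1,2) by (metis card_Diff_subset card_mono finite_subset le_add_diff_inverse2 power_add)
  finally show ?thesis .
qed

section \<open>Counting injective maps by the edges they use\<close>

text \<open>Copies need not be induced, so edges are preserved in one direction only. For fixed
  \<open>H\<close> the number of these maps is a fixed multiple of the number of copies, and it can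
  be bounded by choosing images vertex by vertex.\<close>

definition emb :: "'c set \<Rightarrow> 'c set set \<Rightarrow> nat \<Rightarrow> nat set set \<Rightarrow> ('c \<Rightarrow> nat) set" where
  "emb V H n E = {f \<in> V \<rightarrow>\<^sub>E {..<n}. inj_on f V \<and>
     (\<forall>x\<in>V. \<forall>y\<in>V. {x, y} \<in> H \<longrightarrow> {f x, f y} \<in> E)}"

text \<open>No ambient graph is fixed, so the same set bounds the copies destroyed by deleting
  \<open>X\<close> from any graph.\<close>

definition inj_using :: "'c set \<Rightarrow> 'c set set \<Rightarrow> nat \<Rightarrow> nat set set \<Rightarrow> ('c \<Rightarrow> nat) set" where
  "inj_using V H n X = {f \<in> V \<rightarrow>\<^sub>E {..<n}. inj_on f V \<and>
     (\<exists>x\<in>V. \<exists>y\<in>V. {x, y} \<in> H \<and> {f x, f y} \<in> X)}"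

text \<open>The used edge avoids \<open>v\<close>, so three vertices of \<open>V\<close> have
  restricted images. Even \<kappa> n^2 edges then account for only O(\<kappa> n^(|V|-1)) maps,
  little compared with the possible number of copies through one vertex.\<close>

definition inj_hit_using :: "'c set \<Rightarrow> 'c set set \<Rightarrow> nat \<Rightarrow> nat \<Rightarrow> nat set set \<Rightarrow> ('c \<Rightarrow> nat) set" where
  "inj_hit_using V H n v X = {f \<in> V \<rightarrow>\<^sub>E {..<n}. inj_on f V \<and> v \<in> f ` V \<and>
     (\<exists>x\<in>V. \<exists>y\<in>V. {x, y} \<in> H \<and> {f x, f y} \<in> X \<and> f x \<noteq> v \<and> f y \<noteq> v)}"

text \<open>Covers the factors 2|V|^2 and 2|V|^3 of the two counting bounds below: the choice of two
  or three vertices of \<open>V\<close>, and the two orientations of an edge. The added 1 keeps it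
  positive for empty \<open>V\<close>.\<close>

definition K_const :: "'c set \<Rightarrow> real" where
  "K_const V = 2 * (real (card V) + 1) ^ 3"

lemma K_const_pos: "0 < K_const V"
  unfolding K_const_def by simp

lemma finite_maps [simp]: "finite V \<Longrightarrow> finite (V \<rightarrow>\<^sub>E {..<n::nat})"
  by (simp add: finite_PiE)

lemma finite_emb [simp]: "finite V \<Longrightarrow> finite (emb V H n E)"
  unfolding emb_def by (rule finite_subset[of _ "V \<rightarrow>\<^sub>E {..<n}"]) auto

lemma finite_inj_using [simp]: "finite V \<Longrightarrow> finite (inj_using V H n X)"
  unfolding inj_using_def by (rule finite_subset[of _ "V \<rightarrow>\<^sub>E {..<n}"]) auto

lemma finite_inj_hit_using [simp]: "finite V \<Longrightarrow> finite (inj_hit_using V H n v X)"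
  unfolding inj_hit_using_def by (rule finite_subset[of _ "V \<rightarrow>\<^sub>E {..<n}"]) auto

text \<open>Some pair of \<open>V\<close> is sent to an edge of \<open>X\<close>: |V|^2 choices of
  the pair, at most 2|X| images, and n choices for each of the other |V|-2 vertices.\<close>

lemma card_inj_using:
  assumes V: "finite V" and X: "X \<subseteq> all_pairs n"
  shows "real (card (inj_using V H n X)) * real n ^ 2 \<le> K_const V * real (card X) * real n ^ card V"
proof -
  define Q where "Q = (\<lambda>(x, y). {f \<in> V \<rightarrow>\<^sub>E {..<n}. x \<noteq> y \<and> {f x, f y} \<in> X})"
  have fQ: "finite (Q z)" for z
    unfolding Q_def using V by (auto split: prod.split intro: finite_subset[OF _ finite_maps])
  have Q: "card (Q z) * n ^ 2 \<le> 2 * card X * n ^ card V" if z: "z \<in> V \<times> V" for z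
  proof -
    obtain x y where xy: "z = (x, y)" "x \<in> V" "y \<in> V" using z by blast
    show ?thesis
    proof (cases "x = y")
      case True then show ?thesis by (simp add: Q_def xy)
    next
      case False
      have "card (Q z) * n ^ card {x, y} \<le> card {(u, w). {u, w} \<in> X} * n ^ card V"
        by (rule card_determined_maps[where k = "\<lambda>f. (f x, f y)"])
          (use V xy card_ordered_pairs[OF X] in \<open>auto simp: Q_def\<close>)
      also have "\<dots> \<le> 2 * card X * n ^ card V"
        using card_ordered_pairs[OF X] by (intro mult_right_mono) auto
      finally show ?thesis using False by (simp add: numeral_2_eq_2)
    qed
  qed
  have "inj_using V H n X \<subseteq> (\<Union>z\<in>V \<times> V. Q z)"
  proof
    fix f assume f: "f \<in> inj_using V H n X"
    then obtain x y where xy: "x \<in> V" "y \<in> V" "{f x, f y} \<in> X"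
      unfolding inj_using_def by blast
    then have "x \<noteq> y" using X by (metis in_all_pairs subsetD)
    then have "f \<in> Q (x, y)" using f xy unfolding Q_def inj_using_def by simp
    then show "f \<in> (\<Union>z\<in>V \<times> V. Q z)" using xy by blast
  qed
  then have "card (inj_using V H n X) \<le> card (\<Union>z\<in>V \<times> V. Q z)"
    using V fQ by (intro card_mono) auto
  also have "\<dots> \<le> (\<Sum>z\<in>V \<times> V. card (Q z))" by (rule card_UN_le) (use V in simp)
  finally have "card (inj_using V H n X) * n ^ 2 \<le> (\<Sum>z\<in>V \<times> V. card (Q z) * n ^ 2)"
    by (simp add: sum_distrib_right[symmetric])
  also have "\<dots> \<le> (\<Sum>z\<in>V \<times> V. 2 * card X * n ^ card V)" by (rule sum_mono) (use Q in blast)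
  also have "\<dots> = card V ^ 2 * (2 * card X * n ^ card V)"
    by (simp add: card_cartesian_product power2_eq_square)
  finally have "real (card (inj_using V H n X) * n ^ 2) \<le> real (card V ^ 2 * (2 * card X * n ^ card V))"
    by (simp only: of_nat_le_iff)
  then have 1: "real (card (inj_using V H n X)) * real n ^ 2
      \<le> 2 * real (card V) ^ 2 * (real (card X) * real n ^ card V)" by (simp add: mult_ac)
  have "real (card V) ^ 2 \<le> (real (card V) + 1) ^ 2" by (rule power_mono) auto
  also have "\<dots> \<le> (real (card V) + 1) ^ 3" by (rule power_increasing) auto
  finally have "2 * real (card V) ^ 2 * (real (card X) * real n ^ card V)
      \<le> K_const V * (real (card X) * real n ^ card V)"
    unfolding K_const_def by (intro mult_right_mono) auto
  with 1 show ?thesis by (simp add: mult.assoc)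
qed

lemma card_inj_hit_using:
  assumes V: "finite V" and X: "X \<subseteq> all_pairs n"
  shows "real (card (inj_hit_using V H n v X)) * real n ^ 3 \<le> K_const V * real (card X) * real n ^ card V"
proof -
  define Q where "Q = (\<lambda>(x, y, z). {f \<in> V \<rightarrow>\<^sub>E {..<n}. x \<noteq> y \<and> x \<noteq> z \<and> y \<noteq> z \<and> f x = v \<and> {f y, f z} \<in> X})"
  have fQ: "finite (Q z)" for z
    unfolding Q_def using V by (auto split: prod.split intro: finite_subset[OF _ finite_maps])
  have Q: "card (Q w) * n ^ 3 \<le> 2 * card X * n ^ card V" if w: "w \<in> V \<times> V \<times> V" for w
  proof -
    obtain x y z where xy: "w = (x, y, z)" "x \<in> V" "y \<in> V" "z \<in> V" using w by blast
    show ?thesis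
    proof (cases "x \<noteq> y \<and> x \<noteq> z \<and> y \<noteq> z")
      case False then show ?thesis by (auto simp add: Q_def xy)
    next
      case True
      \<comment> \<open>Three values are determined by the pair \<open>(f y, f z)\<close>, because
        \<open>f x = v\<close> is prescribed.\<close>
      have "card (Q w) * n ^ card {x, y, z} \<le> card {(u, w). {u, w} \<in> X} * n ^ card V"
        by (rule card_determined_maps[where k = "\<lambda>f. (f y, f z)"])
          (use V xy card_ordered_pairs[OF X] in \<open>auto simp: Q_def\<close>)
      also have "\<dots> \<le> 2 * card X * n ^ card V"
        using card_ordered_pairs[OF X] by (intro mult_right_mono) auto
      finally show ?thesis using True by (simp add: numeral_3_eq_3)
    qed
  qed
  have "inj_hit_using V H n v X \<subseteq> (\<Union>w\<in>V \<times> V \<times> V. Q w)"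
  proof
    fix f assume f: "f \<in> inj_hit_using V H n v X"
    then obtain x y z where "x \<in> V" "y \<in> V" "z \<in> V" "f x = v" "{f y, f z} \<in> X" "f y \<noteq> v" "f z \<noteq> v"
      unfolding inj_hit_using_def by blast
    moreover have "f y \<noteq> f z"
      using X \<open>{f y, f z} \<in> X\<close> by (metis in_all_pairs subsetD)
    ultimately have "f \<in> Q (x, y, z)" using f unfolding Q_def inj_hit_using_def by auto
    then show "f \<in> (\<Union>w\<in>V \<times> V \<times> V. Q w)" using \<open>x \<in> V\<close> \<open>y \<in> V\<close> \<open>z \<in> V\<close> by blast
  qed
  then have "card (inj_hit_using V H n v X) \<le> card (\<Union>z\<in>V \<times> V \<times> V. Q z)"
    using V fQ by (intro card_mono) auto
  also have "\<dots> \<le> (\<Sum>z\<in>V \<times> V \<times> V. card (Q z))" by (rule card_UN_le) (use V in simp)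
  finally have "card (inj_hit_using V H n v X) * n ^ 3 \<le> (\<Sum>z\<in>V \<times> V \<times> V. card (Q z) * n ^ 3)"
    by (simp add: sum_distrib_right[symmetric])
  also have "\<dots> \<le> (\<Sum>z\<in>V \<times> V \<times> V. 2 * card X * n ^ card V)" by (rule sum_mono) (use Q in blast)
  also have "\<dots> = card V ^ 3 * (2 * card X * n ^ card V)"
    by (simp add: card_cartesian_product power3_eq_cube)
  finally have "real (card (inj_hit_using V H n v X) * n ^ 3) \<le> real (card V ^ 3 * (2 * card X * n ^ card V))"
    by (simp only: of_nat_le_iff)
  then have 1: "real (card (inj_hit_using V H n v X)) * real n ^ 3
      \<le> 2 * real (card V) ^ 3 * (real (card X) * real n ^ card V)" by (simp add: mult_ac)
  have "real (card V) ^ 3 \<le> (real (card V) + 1) ^ 3" by (rule power_mono) auto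
  then have "2 * real (card V) ^ 3 * (real (card X) * real n ^ card V)
      \<le> K_const V * (real (card X) * real n ^ card V)"
    unfolding K_const_def by (intro mult_right_mono) auto
  with 1 show ?thesis by (simp add: mult.assoc)
qed

abbreviation star :: "nat \<Rightarrow> nat set \<Rightarrow> nat set set" where
  "star v W \<equiv> {{v, w} | w. w \<in> W}"

lemma card_star_le: "finite W \<Longrightarrow> finite (star v W)" "finite W \<Longrightarrow> card (star v W) \<le> card W"
  using card_star_edges[of "{v}" W] by simp_all

lemma normalise_bound:
  fixes a x K n N \<kappa> :: real
  assumes "a * n ^ Suc i \<le> K * x * N" "x \<le> \<kappa> * n ^ j" "0 \<le> K" "0 \<le> N" "0 < n" "j \<le> i"
  shows "a * n ^ (Suc i - j) \<le> K * \<kappa> * N"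
proof -
  have "a * n ^ (Suc i - j) * n ^ j = a * n ^ Suc i"
    using assms(6) by (simp add: mult.assoc power_add[symmetric] del: power_Suc)
  also have "\<dots> \<le> K * (\<kappa> * n ^ j) * N"
    by (rule order_trans[OF assms(1)]) (intro mult_right_mono mult_left_mono assms)
  finally have "a * n ^ (Suc i - j) * n ^ j \<le> (K * \<kappa> * N) * n ^ j" by (simp add: mult_ac)
  then show ?thesis using assms(5) by simp
qed

text \<open>A copy in \<open>E\<close> that is not in \<open>E'\<close> uses an edge of
  \<open>E - E'\<close>; further edges of \<open>E'\<close> can only help.\<close>

lemma emb_diff_bound:
  assumes V: "finite V" and E: "E \<subseteq> all_pairs n" and n: "0 < n"
    and d: "real (card (E - E')) \<le> \<kappa> * real n ^ 2"
  shows "real (card (emb V H n E)) \<le> real (card (emb V H n E')) + K_const V * \<kappa> * real n ^ card V"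
proof -
  let ?U = "inj_using V H n (E - E')"
  have "emb V H n E \<subseteq> emb V H n E' \<union> ?U"
    unfolding emb_def inj_using_def by blast
  then have "card (emb V H n E) \<le> card (emb V H n E' \<union> ?U)"
    using V by (intro card_mono) auto
  also have "\<dots> \<le> card (emb V H n E') + card ?U" by (rule card_Un_le)
  finally have 1: "real (card (emb V H n E)) \<le> real (card (emb V H n E')) + real (card ?U)" by linarith
  have "real (card ?U) * real n ^ 2 \<le> K_const V * real (card (E - E')) * real n ^ card V"
    by (rule card_inj_using) (use V E in auto)
  then have "real (card ?U) * real n ^ 2 \<le> K_const V * (\<kappa> * real n ^ 2) * real n ^ card V"
    by (rule order_trans) (intro mult_right_mono mult_left_mono d less_imp_le[OF K_const_pos] zero_le_power of_nat_0_le_iff)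
  then have "real (card ?U) \<le> K_const V * \<kappa> * real n ^ card V"
    using n by (simp add: mult.assoc mult.left_commute mult.commute)
  with 1 show ?thesis by linarith
qed

lemma star_bound:
  assumes V: "finite V" and W: "W \<subseteq> {..<n} - {v}" and v: "v < n" and d: "real (card W) \<le> \<kappa> * real n"
  shows "real (card (inj_using V H n (star v W))) * real n \<le> K_const V * \<kappa> * real n ^ card V"
proof -
  have fW: "finite W" using W finite_subset by blast
  have sub: "star v W \<subseteq> all_pairs n" using W v unfolding all_pairs_def by blast
  have "real (card (star v W)) \<le> \<kappa> * real n ^ 1"
    using card_star_le(2)[OF fW, of v] d by simp
  moreover have "real (card (inj_using V H n (star v W))) * real n ^ Suc 1
      \<le> K_const V * real (card (star v W)) * real n ^ card V"
    using card_inj_using[OF V sub, of H] by (simp only: Suc_1)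
  ultimately have "real (card (inj_using V H n (star v W))) * real n ^ (Suc 1 - 1)
      \<le> K_const V * \<kappa> * real n ^ card V"
    using v K_const_pos[of V] by (intro normalise_bound) auto
  then show ?thesis by simp
qed

lemma hit_bound:
  assumes V: "finite V" and X: "X \<subseteq> all_pairs n" and n: "0 < n"
    and d: "real (card X) \<le> \<kappa> * real n ^ 2"
  shows "real (card (inj_hit_using V H n v X)) * real n \<le> K_const V * \<kappa> * real n ^ card V"
proof -
  have "real (card (inj_hit_using V H n v X)) * real n ^ Suc 2 \<le> K_const V * real (card X) * real n ^ card V"
    using card_inj_hit_using[OF V X, of H v] by (simp add: numeral_3_eq_3 numeral_2_eq_2)
  then have "real (card (inj_hit_using V H n v X)) * real n ^ (Suc 2 - 2) \<le> K_const V * \<kappa> * real n ^ card V"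
    using d n K_const_pos[of V] by (intro normalise_bound) auto
  then show ?thesis by simp
qed

text \<open>In a complete multipartite graph non-adjacency is transitive, so each triple of
  \<open>A \<times> B \<times> C\<close> contains a pair on which \<open>E\<close> and \<open>mp n p\<close> disagree.\<close>

lemma multipartite_obstruction:
  assumes E: "E \<subseteq> all_pairs n" and sub: "A \<subseteq> {..<n}" "B \<subseteq> {..<n}" "C \<subseteq> {..<n}"
    and disj: "A \<inter> B = {}" "B \<inter> C = {}" "A \<inter> C = {}"
    and AB: "\<And>a b. a \<in> A \<Longrightarrow> b \<in> B \<Longrightarrow> {a, b} \<notin> E"
    and BC: "\<And>b c. b \<in> B \<Longrightarrow> c \<in> C \<Longrightarrow> {b, c} \<notin> E"
    and AC: "\<And>a c. a \<in> A \<Longrightarrow> c \<in> C \<Longrightarrow> {a, c} \<in> E"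
  shows "card A * card B * card C \<le> 6 * n * card ((E - mp n p) \<union> (mp n p - E))"
proof -
  let ?D = "(E - mp n p) \<union> (mp n p - E)"
  let ?O = "{(u, w). {u, w} \<in> ?D}"
  have D: "?D \<subseteq> all_pairs n" using E join_mp_subset by blast
  note O = card_ordered_pairs[OF D]
  have fin: "finite A" "finite B" "finite C" using sub finite_subset by blast+
  let ?S = "?O \<times> {..<n}"
  \<comment> \<open>A disagreeing ordered pair and the third vertex determine the triple once the
    position of the third vertex is known. Three positions and two orientations give the factor
    6.\<close>
  let ?T = "(\<lambda>((x, y), z). (x, y, z)) ` ?S \<union> (\<lambda>((x, y), z). (z, x, y)) ` ?S \<union> (\<lambda>((x, y), z). (x, z, y)) ` ?S"
  have "A \<times> B \<times> C \<subseteq> ?T"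
  proof
    fix t assume "t \<in> A \<times> B \<times> C"
    then obtain a b c where t: "t = (a, b, c)" and abc: "a \<in> A" "b \<in> B" "c \<in> C" by blast
    have "a < n" "b < n" "c < n" "a \<noteq> b" "b \<noteq> c" "a \<noteq> c" using abc sub disj by auto
    then have "{a, b} \<in> ?D \<or> {b, c} \<in> ?D \<or> {a, c} \<in> ?D"
      using AB[of a b] BC[of b c] AC[of a c] abc by auto
    then have "((a, b), c) \<in> ?S \<or> ((b, c), a) \<in> ?S \<or> ((a, c), b) \<in> ?S"
      using \<open>a < n\<close> \<open>b < n\<close> \<open>c < n\<close> by simp
    then show "t \<in> ?T"
    proof (elim disjE)
      assume "((a, b), c) \<in> ?S"
      then have "t \<in> (\<lambda>((x, y), z). (x, y, z)) ` ?S" by (rule rev_image_eqI) (simp add: t)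
      then show ?thesis by (intro UnI1)
    next
      assume "((b, c), a) \<in> ?S"
      then have "t \<in> (\<lambda>((x, y), z). (z, x, y)) ` ?S" by (rule rev_image_eqI) (simp add: t)
      then show ?thesis by (intro UnI1 UnI2)
    next
      assume "((a, c), b) \<in> ?S"
      then have "t \<in> (\<lambda>((x, y), z). (x, z, y)) ` ?S" by (rule rev_image_eqI) (simp add: t)
      then show ?thesis by (intro UnI2)
    qed
  qed
  then have "card (A \<times> B \<times> C) \<le> card ?T" using O(1) by (intro card_mono) auto
  also have "\<dots> \<le> card ?S + card ?S + card ?S"
    by (intro order_trans[OF card_Un_le] add_mono card_image_le) (use O(1) in auto)
  also have "\<dots> = 3 * (card ?O * n)" by (simp add: card_cartesian_product)
  also have "\<dots> \<le> 3 * (2 * card ?D * n)" using O(2) by (intro mult_left_mono mult_right_mono) auto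
  finally show ?thesis by (simp add: card_cartesian_product mult_ac)
qed

section \<open>Near-extremal complete multipartite graphs\<close>

definition ex_emb :: "'c set \<Rightarrow> 'c set set \<Rightarrow> (nat \<Rightarrow> nat set set \<Rightarrow> bool) \<Rightarrow> nat \<Rightarrow> nat" where
  "ex_emb V H Free n = Max ((\<lambda>E. card (emb V H n E)) ` {E. E \<subseteq> all_pairs n \<and> Free n E})"

abbreviation cls :: "nat \<Rightarrow> (nat \<Rightarrow> nat) \<Rightarrow> nat \<Rightarrow> nat set" where
  "cls n p i \<equiv> {w. w < n \<and> p w = i}"

text \<open>A rich edge can host a color-critical edge whose ends have color \<open>i\<close>.\<close>

definition rich :: "nat \<Rightarrow> (nat \<Rightarrow> nat) \<Rightarrow> nat \<Rightarrow> nat set set \<Rightarrow> nat \<Rightarrow> nat set \<Rightarrow> bool" where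
  "rich n p r E m e \<longleftrightarrow>
     (\<exists>i<r. \<forall>j<r. j \<noteq> i \<longrightarrow> m \<le> card {w \<in> cls n p j. \<forall>u\<in>e. {u, w} \<in> E})"

lemma eventually_linear:
  assumes "0 < (c::real)"
  shows "\<forall>\<^sub>F n in sequentially. a \<le> c * real n"
proof -
  have "a \<le> c * real n" if "n \<ge> nat \<lceil>a / c\<rceil>" for n
  proof -
    have "a / c \<le> real n" using that by linarith
    then show ?thesis using assms by (simp add: field_simps)
  qed
  then show ?thesis using eventually_sequentially by blast
qed

lemma ex_subset_of_card: "q \<le> card S \<Longrightarrow> \<exists>T. T \<subseteq> S \<and> card T = q \<and> finite T"
  by (rule obtain_subset_with_card_n) auto

lemma three_disjoint_subsets:
  assumes "finite S" "3 * q \<le> card S"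
  shows "\<exists>A B C. A \<subseteq> S \<and> B \<subseteq> S \<and> C \<subseteq> S \<and> card A = q \<and> card B = q \<and> card C = q \<and>
    A \<inter> B = {} \<and> B \<inter> C = {} \<and> A \<inter> C = {}"
proof -
  have "q \<le> card S" using assms by simp
  then obtain A where A: "A \<subseteq> S" "card A = q" "finite A" using ex_subset_of_card by blast
  have cA: "card (S - A) = card S - q" using A by (simp add: card_Diff_subset)
  then have "q \<le> card (S - A)" using assms by simp
  then obtain B where B: "B \<subseteq> S - A" "card B = q" "finite B" using ex_subset_of_card by blast
  have "card (S - A - B) = card S - q - q" using B cA by (simp add: card_Diff_subset)
  then have "q \<le> card (S - A - B)" using assms by simp
  then obtain C where "C \<subseteq> S - A - B" "card C = q" using ex_subset_of_card by blast
  then show ?thesis using A B by (intro exI[of _ A] exI[of _ B] exI[of _ C]) blast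
qed

text \<open>All that the counting argument uses of \<open>F\<close>, with \<open>k\<close> standing
  for its order: fewer than \<open>s\<close> universal vertices over \<open>r\<close> parts create
  no copy, a copy through \<open>v\<close> can be rerouted through a common neighbour of its
  neighbours, and \<open>s\<close> disjoint rich edges among mostly typical vertices yield a copy.
  Stability is stated directly for labellings and for numbers of injective maps.\<close>

locale stable_counting =
  fixes V :: "'c set" and H :: "'c set set" and r s k :: nat
    and Free :: "nat \<Rightarrow> nat set set \<Rightarrow> bool"
  assumes finite_V: "finite V" and r_ge_2: "2 \<le> r" and s_pos: "1 \<le> s"
    and free_join: "\<And>n B p E. E \<subseteq> join_mp n B p \<Longrightarrow> B \<subseteq> {..<n} \<Longrightarrow> card B < s \<Longrightarrow>
      (\<And>v. v < n \<Longrightarrow> p v < r) \<Longrightarrow> Free n E"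
    and free_replace: "\<And>n E v W. Free n E \<Longrightarrow> E \<subseteq> all_pairs n \<Longrightarrow> v < n \<Longrightarrow> W \<subseteq> {..<n} - {v} \<Longrightarrow>
      (\<And>Q. Q \<subseteq> W \<Longrightarrow> card Q \<le> k \<Longrightarrow> k < card {u. u < n \<and> (\<forall>w\<in>Q. {u, w} \<in> E)}) \<Longrightarrow>
      Free n ({e \<in> E. v \<notin> e} \<union> star v W)"
    and not_free_rich: "\<And>n E p X t L. E \<subseteq> all_pairs n \<Longrightarrow> (\<And>v. v < n \<Longrightarrow> p v < r) \<Longrightarrow>
      X \<subseteq> {..<n} \<Longrightarrow> card X \<le> t \<Longrightarrow>
      (\<And>v. v < n \<Longrightarrow> v \<notin> X \<Longrightarrow> card {w. w < n \<and> p w \<noteq> p v \<and> {v, w} \<notin> E} \<le> t) \<Longrightarrow>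
      (\<And>j. j < r \<Longrightarrow> (k + 1) * (t + 1) \<le> card (cls n p j)) \<Longrightarrow>
      L \<subseteq> E \<Longrightarrow> card L = s \<Longrightarrow> (\<And>e e'. e \<in> L \<Longrightarrow> e' \<in> L \<Longrightarrow> e \<noteq> e' \<Longrightarrow> e \<inter> e' = {}) \<Longrightarrow>
      (\<And>e. e \<in> L \<Longrightarrow> rich n p r E ((k + 1) * (t + 1)) e) \<Longrightarrow> \<not> Free n E"
    and stability: "\<And>\<epsilon>. 0 < \<epsilon> \<Longrightarrow> \<exists>\<delta>>0. \<forall>\<^sub>F n in sequentially. \<forall>E. E \<subseteq> all_pairs n \<longrightarrow> Free n E \<longrightarrow>
      real (ex_emb V H Free n) - \<delta> * real n ^ card V \<le> real (card (emb V H n E)) \<longrightarrow>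
      (\<exists>p. (\<forall>v<n. p v < r) \<and> real (card ((E - mp n p) \<union> (mp n p - E))) \<le> \<epsilon> * real n ^ 2)"
begin

abbreviation "K \<equiv> K_const V"

abbreviation count :: "nat \<Rightarrow> nat set set \<Rightarrow> real" where
  "count n E \<equiv> real (card (emb V H n E))"

abbreviation near :: "nat \<Rightarrow> real \<Rightarrow> nat set set \<Rightarrow> bool" where
  "near n \<delta> E \<equiv> real (ex_emb V H Free n) - \<delta> * real n ^ card V \<le> count n E"

lemma free_mp: "(\<And>v. v < n \<Longrightarrow> p v < r) \<Longrightarrow> E \<subseteq> mp n p \<Longrightarrow> Free n E"
  using free_join[of E n "{}" p] s_pos by simp

lemma finite_free: "finite {E. E \<subseteq> all_pairs n \<and> Free n E}"
  by (rule finite_subset[of _ "Pow (all_pairs n)"]) auto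

lemma count_le_ex: "E \<subseteq> all_pairs n \<Longrightarrow> Free n E \<Longrightarrow> count n E \<le> real (ex_emb V H Free n)"
  unfolding ex_emb_def using finite_free by (auto intro!: Max_ge)

lemma ex_attained:
  obtains E where "E \<subseteq> all_pairs n" "Free n E" "count n E = real (ex_emb V H Free n)"
proof -
  have "{} \<in> {E. E \<subseteq> all_pairs n \<and> Free n E}"
    using free_mp[of n "\<lambda>_. 0" "{}"] r_ge_2 by simp
  then have "ex_emb V H Free n \<in> (\<lambda>E. card (emb V H n E)) ` {E. E \<subseteq> all_pairs n \<and> Free n E}"
    unfolding ex_emb_def using finite_free by (intro Max_in) auto
  then show ?thesis using that by auto
qed

lemma large_class:
  assumes "\<And>v. v < n \<Longrightarrow> p v < r"
  obtains m where "m < r" "n \<le> r * card (cls n p m)"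
proof (cases "\<exists>m<r. n \<le> r * card (cls n p m)")
  case True then show ?thesis using that by blast
next
  case False
  then have small: "r * card (cls n p m) < n" if "m < r" for m using that by (meson not_le)
  have "{..<n} = (\<Union>m\<in>{..<r}. cls n p m)" using assms by auto
  then have "card {..<n} \<le> (\<Sum>m\<in>{..<r}. card (cls n p m))" by (simp only: card_UN_le[OF finite_lessThan])
  then have "r * n \<le> (\<Sum>m\<in>{..<r}. r * card (cls n p m))"
    by (simp add: sum_distrib_left[symmetric])
  also have "\<dots> < (\<Sum>m\<in>{..<r}. n)" by (rule sum_strict_mono) (use small r_ge_2 in \<open>auto simp: lessThan_empty_iff\<close>)
  finally show ?thesis by simp
qed

text \<open>If some class were small, its vertices could be isolated and a larger class replaced by a
  complete bipartite graph plus isolated vertices without losing many copies; the result is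
  \<open>r\<close>-partite but far from every complete \<open>r\<close>-partite graph.\<close>

lemma linear_classes:
  "\<exists>c>0. \<exists>\<delta>>0. \<forall>\<^sub>F n in sequentially. \<forall>p. (\<forall>v<n. p v < r) \<longrightarrow> near n \<delta> (mp n p) \<longrightarrow>
     (\<forall>i<r. c * real n \<le> real (card (cls n p i)))"
proof -
  define R where "R = real r"
  have R: "R \<ge> 2" using r_ge_2 by (simp add: R_def)
  \<comment> \<open>Three sets of at least n / (4R) vertices give n^3 / (64 R^3) triples, so the
    obstruction forces distance n^2 / (384 R^3); half of this is demanded.\<close>
  define \<epsilon> where "\<epsilon> = 1 / (768 * R ^ 3)"
  have "\<epsilon> > 0" using R by (simp add: \<epsilon>_def)
  from stability[OF this] obtain \<delta> where \<delta>: "\<delta> > 0" and ev: "\<forall>\<^sub>F n in sequentially. \<forall>E. E \<subseteq> all_pairs n \<longrightarrow> Free n E \<longrightarrow>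
      near n \<delta> E \<longrightarrow> (\<exists>p. (\<forall>v<n. p v < r) \<and> real (card ((E - mp n p) \<union> (mp n p - E))) \<le> \<epsilon> * real n ^ 2)"
    by blast
  \<comment> \<open>The first bound makes a class of at least average size differ from the small
    class \<open>i\<close>; the second limits the loss from isolating class \<open>i\<close> to half
    of \<delta>.\<close>
  define c where "c = min (1 / (2 * R)) (\<delta> / (2 * K))"
  have c: "c > 0" using R \<delta> K_const_pos[of V] by (simp add: c_def)
  have "\<forall>\<^sub>F n in sequentially. \<forall>p. (\<forall>v<n. p v < r) \<longrightarrow> near n (\<delta>/2) (mp n p) \<longrightarrow>
     (\<forall>i<r. c * real n \<le> real (card (cls n p i)))"
    \<comment> \<open>From \<open>12 * r\<close> on, the rounding in
      \<open>q = n div (3 * r)\<close> still leaves \<open>n \<le> 4 * (r * q)\<close>.\<close>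
    using ev eventually_ge_at_top[of "12 * r"]
  proof eventually_elim
    case (elim n)
    have n: "0 < n" using elim(2) r_ge_2 by linarith
    show ?case
    proof (intro allI impI, rule ccontr)
      fix p i assume p: "\<forall>v<n. p v < r" and nr: "near n (\<delta>/2) (mp n p)" and i: "i < r"
        and "\<not> c * real n \<le> real (card (cls n p i))"
      then have small: "real (card (cls n p i)) < c * real n" by simp
      obtain m where m: "m < r" "n \<le> r * card (cls n p m)" using large_class p by blast
      have "c * real n \<le> 1 / (2 * R) * real n"
        by (intro mult_right_mono) (auto simp: c_def)
      moreover have "real n \<le> R * real (card (cls n p m))"
        using m(2) unfolding R_def by (metis of_nat_le_iff of_nat_mult)
      then have "1 / (2 * R) * real n \<le> real (card (cls n p m))"
        using R by (simp add: field_simps)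
      ultimately have mi: "m \<noteq> i" using small by auto
      define q where "q = n div (3 * r)"
      have "r * (3 * q) \<le> n" unfolding q_def by (metis mult.assoc mult.commute div_times_less_eq_dividend)
      then have "r * (3 * q) \<le> r * card (cls n p m)" using m(2) by linarith
      then have q3: "3 * q \<le> card (cls n p m)" using r_ge_2 by simp
      have "n < 3 * r * q + 3 * r" unfolding q_def using r_ge_2
        by (metis add.commute dividend_less_times_div mult_pos_pos zero_less_numeral less_le_trans pos2)
      then have "n \<le> 4 * (r * q)" using elim(2) by (simp add: mult.assoc)
      then have "real n \<le> 4 * (R * real q)" unfolding R_def by (metis of_nat_le_iff of_nat_mult of_nat_numeral)
      then have q: "real n / (4 * R) \<le> real q" using R by (simp add: field_simps)
      have "finite (cls n p m)" by simp
      from three_disjoint_subsets[OF this q3] obtain A B C where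
        ABC: "A \<subseteq> cls n p m" "B \<subseteq> cls n p m" "C \<subseteq> cls n p m"
        and cards: "card A = q" "card B = q" "card C = q"
        and disj: "A \<inter> B = {}" "B \<inter> C = {}" "A \<inter> C = {}"
        by blast
      define E where "E = {e \<in> mp n p. e \<inter> cls n p i = {}} \<union> {{a, w} | a w. a \<in> A \<and> w \<in> C}"
      \<comment> \<open>Once class \<open>i\<close> is isolated, its color is free for
        \<open>C\<close>, so the edges between \<open>A\<close> and \<open>C\<close> fit into
        \<open>r\<close> colors. \<open>B\<close> stays nonadjacent to both sets and becomes the
        middle set of the obstruction.\<close>
      define p' where "p' = (\<lambda>v. if v \<in> C then i else if p v = i then m else p v)"
      have Esub: "E \<subseteq> all_pairs n"
      proof -
        have "{a, w} \<in> all_pairs n" if "a \<in> A" "w \<in> C" for a w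
          using that ABC disj by auto
        then show ?thesis unfolding E_def using join_mp_subset by blast
      qed
      have "E \<subseteq> mp n p'"
      proof (rule subset_pairsI[OF Esub])
        fix u v assume uv: "u < n" "v < n" "u \<noteq> v" "{u, v} \<in> E"
        then consider "p u \<noteq> p v" "p u \<noteq> i" "p v \<noteq> i" | "u \<in> A" "v \<in> C" | "v \<in> A" "u \<in> C"
          unfolding E_def by (auto simp: doubleton_eq_iff)
        then have "p' u \<noteq> p' v"
        proof cases
          case 1
          then have "\<not> (u \<in> C \<and> v \<in> C)" using ABC(3) by auto
          then show ?thesis using 1 by (auto simp: p'_def ABC(3)[THEN subsetD] dest: ABC(3)[THEN subsetD])
        next
          case 2
          then show ?thesis using ABC disj mi by (auto simp: p'_def)
        next
          case 3
          then show ?thesis using ABC disj mi by (auto simp: p'_def)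
        qed
        then show "{u, v} \<in> mp n p'" using uv by simp
      qed
      moreover have "p' v < r" if "v < n" for v using that p i m by (simp add: p'_def)
      ultimately have free: "Free n E" using free_mp by blast
      have "mp n p - E \<subseteq> {{a, w} | a w. a \<in> cls n p i \<and> w \<in> {..<n}}"
      proof (rule subset_pairsI)
        show "mp n p - E \<subseteq> all_pairs n" using join_mp_subset by blast
        fix u v assume uv: "u < n" "v < n" "{u, v} \<in> mp n p - E"
        then have "u \<in> cls n p i \<or> v \<in> cls n p i" unfolding E_def by auto
        then show "{u, v} \<in> {{a, w} | a w. a \<in> cls n p i \<and> w \<in> {..<n}}"
          using uv by (auto simp: insert_commute)
      qed
      then have "card (mp n p - E) \<le> card {{a, w} | a w. a \<in> cls n p i \<and> w \<in> {..<n}}"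
        by (intro card_mono card_star_edges) auto
      also have "\<dots> \<le> card (cls n p i) * n" using card_star_edges(2)[of "cls n p i" "{..<n}"] by simp
      finally have "real (card (mp n p - E)) \<le> real (card (cls n p i)) * real n"
        by (metis of_nat_le_iff of_nat_mult)
      also have "\<dots> \<le> c * real n ^ 2" using small by (simp add: power2_eq_square mult_right_mono flip: mult.assoc)
      finally have "count n (mp n p) \<le> count n E + K * c * real n ^ card V"
        using emb_diff_bound[OF finite_V join_mp_subset n] by blast
      moreover have "K * c \<le> \<delta> / 2" unfolding c_def using K_const_pos[of V]
        by (simp add: min_def field_simps)
      then have "K * c * real n ^ card V \<le> \<delta> / 2 * real n ^ card V" by (intro mult_right_mono) auto
      ultimately have "near n \<delta> E" using nr by linarith
      then obtain p2 where p2: "real (card ((E - mp n p2) \<union> (mp n p2 - E))) \<le> \<epsilon> * real n ^ 2"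
        using elim(1) Esub free by blast
      have sub: "A \<subseteq> {..<n}" "B \<subseteq> {..<n}" "C \<subseteq> {..<n}" using ABC by auto
      have cl: "p a = m" if "a \<in> A \<union> B \<union> C" for a using that ABC by auto
      have notE: "{a, b} \<notin> E" if "a \<in> A \<union> C" "b \<in> B" for a b
      proof -
        have "p a = p b" "b \<notin> A" "b \<notin> C" using that cl disj by auto
        then show ?thesis unfolding E_def by (auto simp: doubleton_eq_iff)
      qed
      have "card A * card B * card C \<le> 6 * n * card ((E - mp n p2) \<union> (mp n p2 - E))"
      proof (rule multipartite_obstruction[OF Esub sub])
        show "A \<inter> B = {}" "B \<inter> C = {}" "A \<inter> C = {}" using disj by auto
        show "{a, b} \<notin> E" if "a \<in> A" "b \<in> B" for a b using notE that by simp
        show "{b, c} \<notin> E" if "b \<in> B" "c \<in> C" for b c using notE[of c b] that by (simp add: insert_commute)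
        show "{a, c} \<in> E" if "a \<in> A" "c \<in> C" for a c using that unfolding E_def by blast
      qed
      then have "real (card A * card B * card C) \<le> real (6 * n * card ((E - mp n p2) \<union> (mp n p2 - E)))"
        by (simp only: of_nat_le_iff)
      then have "real q ^ 3 \<le> 6 * real n * real (card ((E - mp n p2) \<union> (mp n p2 - E)))"
        by (simp add: cards power3_eq_cube)
      also have "\<dots> \<le> 6 * real n * (\<epsilon> * real n ^ 2)" using p2 by (intro mult_left_mono) auto
      also have "\<dots> = real n ^ 3 / (128 * R ^ 3)"
        using R by (simp add: \<epsilon>_def field_simps power2_eq_square power3_eq_cube)
      finally have "real q ^ 3 \<le> real n ^ 3 / (128 * R ^ 3)" .
      moreover have "(real n / (4 * R)) ^ 3 \<le> real q ^ 3" using q R by (intro power_mono) auto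
      ultimately have "real n ^ 3 / (64 * R ^ 3) \<le> real n ^ 3 / (128 * R ^ 3)"
        by (simp add: power_divide power_mult_distrib)
      moreover have "0 < real n ^ 3 / (128 * R ^ 3)" using n R by simp
      moreover have "real n ^ 3 / (64 * R ^ 3) = 2 * (real n ^ 3 / (128 * R ^ 3))" by simp
      ultimately show False by linarith
    qed
  qed
  then show ?thesis using c \<delta> by (intro exI[of _ c] exI[of _ "\<delta> / 2"] conjI) simp_all
qed

section \<open>Copies using an edge from a vertex to a given set\<close>

abbreviation through :: "nat \<Rightarrow> (nat \<Rightarrow> nat) \<Rightarrow> nat \<Rightarrow> nat set \<Rightarrow> ('c \<Rightarrow> nat) set" where
  "through n p v W \<equiv> emb V H n (mp n p) \<inter> inj_using V H n (star v W)"

text \<open>\<open>a\<close> and \<open>v\<close> are twins in \<open>mp n p\<close>, and the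
  transposition swapping them fixes \<open>W\<close> pointwise because \<open>W\<close> avoids their
  class. Composition with it therefore carries the maps through \<open>a\<close> injectively to maps
  through \<open>v\<close>.\<close>

lemma card_through_twin:
  assumes a: "a < n" and v: "v < n" and pav: "p a = p v" and W: "\<And>w. w \<in> W \<Longrightarrow> p w \<noteq> p v"
  shows "card (through n p a W) \<le> card (through n p v W)"
proof (rule card_inj_on_le)
  let ?t = "transpose a v"
  let ?g = "\<lambda>f. restrict (?t \<circ> f) V"
  have pt: "p (?t x) = p x" for x using pav by (auto simp: transpose_def)
  have tn: "?t x < n \<longleftrightarrow> x < n" for x using a v by (auto simp: transpose_def)
  have ti: "?t x = ?t y \<longleftrightarrow> x = y" for x y by (simp add: bij_is_inj inj_eq)
  show "inj_on ?g (through n p a W)"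
  proof (rule inj_onI)
    fix f g assume fg: "f \<in> through n p a W" "g \<in> through n p a W" "?g f = ?g g"
    have "f x = g x" if "x \<in> V" for x
      using fun_cong[OF fg(3), of x] that ti by simp
    moreover have "f \<in> V \<rightarrow>\<^sub>E {..<n}" "g \<in> V \<rightarrow>\<^sub>E {..<n}" using fg by (auto simp: emb_def)
    ultimately show "f = g" by (meson PiE_ext)
  qed
  show "?g ` through n p a W \<subseteq> through n p v W"
  proof (rule image_subsetI)
    fix f assume f: "f \<in> through n p a W"
    have f1: "f \<in> V \<rightarrow>\<^sub>E {..<n}" "inj_on f V" and
      f2: "\<And>x y. x \<in> V \<Longrightarrow> y \<in> V \<Longrightarrow> {x, y} \<in> H \<Longrightarrow> {f x, f y} \<in> mp n p"
      using f by (auto simp: emb_def)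
    obtain x y where xy: "x \<in> V" "y \<in> V" "{x, y} \<in> H" "{f x, f y} \<in> star a W"
      using f unfolding inj_using_def by blast
    have tw: "?t w = w" if "w \<in> W" for w
      using W[OF that] pav by (intro transpose_apply_other) auto
    have "?g f \<in> V \<rightarrow>\<^sub>E {..<n}" using f1 tn by auto
    moreover have "inj_on (?g f) V" using f1(2) ti by (simp add: inj_on_def)
    moreover have "{?g f x, ?g f y} \<in> mp n p" if "x \<in> V" "y \<in> V" "{x, y} \<in> H" for x y
      using f2[OF that] that by (simp add: pt tn ti)
    moreover have "{?g f x, ?g f y} \<in> star v W"
    proof -
      from xy(4) consider "f x = a" "f y \<in> W" | "f y = a" "f x \<in> W" by (auto simp: doubleton_eq_iff)
      then show ?thesis
      proof cases
        case 1 then show ?thesis using xy tw by (auto simp: doubleton_eq_iff)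
      next
        case 2 then show ?thesis using xy tw by (auto simp: doubleton_eq_iff)
      qed
    qed
    ultimately show "?g f \<in> through n p v W"
      using xy unfolding emb_def inj_using_def by blast
  qed
  show "finite (through n p v W)" using finite_V by simp
qed

text \<open>Otherwise, by symmetry, the edges between \<open>W\<close> and half of the class of \<open>v\<close> could be deleted
  at little cost, and the remaining graph is far from complete \<open>r\<close>-partite.\<close>

lemma many_through:
  assumes \<theta>: "0 < \<theta>"
  shows "\<exists>\<gamma>>0. \<exists>\<delta>>0. \<forall>\<^sub>F n in sequentially. \<forall>p v W. (\<forall>v<n. p v < r) \<longrightarrow> near n \<delta> (mp n p) \<longrightarrow> v < n \<longrightarrow>
     W \<subseteq> {w. w < n \<and> p w \<noteq> p v} \<longrightarrow> \<theta> * real n \<le> real (card W) \<longrightarrow>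
     \<gamma> * real n ^ card V \<le> real (card (through n p v W)) * real n"
proof -
  obtain c \<delta>0 where c: "c > 0" and \<delta>0: "\<delta>0 > 0" and
    ev0: "\<forall>\<^sub>F n in sequentially. \<forall>p. (\<forall>v<n. p v < r) \<longrightarrow> near n \<delta>0 (mp n p) \<longrightarrow>
       (\<forall>i<r. c * real n \<le> real (card (cls n p i)))"
    using linear_classes by blast
  \<comment> \<open>\<open>W\<close> has at least \<theta> n vertices and each half of the class of
    \<open>v\<close> at least c n / 3. The obstruction then forces distance \<theta> c^2 n^2 / 54;
    half of this is demanded.\<close>
  define \<epsilon> where "\<epsilon> = \<theta> * c ^ 2 / 108"
  have "\<epsilon> > 0" using \<theta> c by (simp add: \<epsilon>_def)
  from stability[OF this] obtain \<delta> where \<delta>: "\<delta> > 0" and ev: "\<forall>\<^sub>F n in sequentially. \<forall>E. E \<subseteq> all_pairs n \<longrightarrow> Free n E \<longrightarrow>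
      near n \<delta> E \<longrightarrow> (\<exists>p. (\<forall>v<n. p v < r) \<and> real (card ((E - mp n p) \<union> (mp n p - E))) \<le> \<epsilon> * real n ^ 2)"
    by blast
  define \<gamma> where "\<gamma> = \<delta> / 2"
  define \<delta>' where "\<delta>' = min \<delta>0 (\<delta> / 2)"
  have pos: "\<gamma> > 0" "\<delta>' > 0" using \<delta> \<delta>0 by (auto simp: \<gamma>_def \<delta>'_def)
  have "\<forall>\<^sub>F n in sequentially. \<forall>p v W. (\<forall>v<n. p v < r) \<longrightarrow> near n \<delta>' (mp n p) \<longrightarrow> v < n \<longrightarrow>
     W \<subseteq> {w. w < n \<and> p w \<noteq> p v} \<longrightarrow> \<theta> * real n \<le> real (card W) \<longrightarrow>
     \<gamma> * real n ^ card V \<le> real (card (through n p v W)) * real n"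
    using ev ev0 eventually_linear[OF c, of 3]
  proof eventually_elim
    case (elim n)
    show ?case
    proof (intro allI impI, rule ccontr)
      fix p v W
      assume p: "\<forall>v<n. p v < r" and nr: "near n \<delta>' (mp n p)" and v: "v < n"
        and W: "W \<subseteq> {w. w < n \<and> p w \<noteq> p v}" "\<theta> * real n \<le> real (card W)"
        and "\<not> \<gamma> * real n ^ card V \<le> real (card (through n p v W)) * real n"
      then have few: "real (card (through n p v W)) * real n < \<gamma> * real n ^ card V" by simp
      have n: "0 < n" using v by simp
      have "\<delta>' * real n ^ card V \<le> \<delta>0 * real n ^ card V"
        by (intro mult_right_mono) (auto simp: \<delta>'_def)
      then have "near n \<delta>0 (mp n p)" using nr by linarith
      moreover have "p v < r" using p v by blast
      ultimately have big: "c * real n \<le> real (card (cls n p (p v)))" using elim(2) p by blast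
      let ?S = "cls n p (p v)"
      define q where "q = card ?S div 2"
      have q: "q \<le> card ?S" unfolding q_def by simp
      have "3 \<le> real (card ?S)" using big elim(3) by linarith
      then have "card ?S \<le> 3 * q" "card ?S \<le> 3 * (card ?S - q)" unfolding q_def by linarith+
      then have qq: "c * real n / 3 \<le> real q" "c * real n / 3 \<le> real (card ?S - q)" using big by linarith+
      obtain A where A: "A \<subseteq> ?S" "card A = q" "finite A" using ex_subset_of_card[OF q] by blast
      have cA: "card (?S - A) = card ?S - q" using A by (simp add: card_Diff_subset)
      define E where "E = mp n p - {{a, w} | a w. a \<in> A \<and> w \<in> W}"
      have Esub: "E \<subseteq> all_pairs n" unfolding E_def using join_mp_subset by blast
      have free: "Free n E" using free_mp[of n p E] p unfolding E_def by blast
      have "emb V H n (mp n p) \<subseteq> emb V H n E \<union> (\<Union>a\<in>A. through n p a W)"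
      proof
        fix f assume f: "f \<in> emb V H n (mp n p)"
        show "f \<in> emb V H n E \<union> (\<Union>a\<in>A. through n p a W)"
        proof (cases "f \<in> emb V H n E")
          case False
          then obtain x y where "x \<in> V" "y \<in> V" "{x, y} \<in> H" "{f x, f y} \<notin> E" "{f x, f y} \<in> mp n p"
            using f unfolding emb_def by blast
          then obtain a w where aw: "a \<in> A" "w \<in> W" "{f x, f y} = {a, w}" unfolding E_def by blast
          then have "{f x, f y} \<in> star a W" by blast
          then have "f \<in> through n p a W"
            using f \<open>x \<in> V\<close> \<open>y \<in> V\<close> \<open>{x, y} \<in> H\<close> unfolding inj_using_def emb_def by blast
          then show ?thesis using aw(1) by blast
        qed simp
      qed
      then have "card (emb V H n (mp n p)) \<le> card (emb V H n E \<union> (\<Union>a\<in>A. through n p a W))"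
        using finite_V A(3) by (intro card_mono) auto
      also have "\<dots> \<le> card (emb V H n E) + card (\<Union>a\<in>A. through n p a W)" by (rule card_Un_le)
      also have "card (\<Union>a\<in>A. through n p a W) \<le> (\<Sum>a\<in>A. card (through n p a W))"
        by (rule card_UN_le[OF A(3)])
      also have "\<dots> \<le> (\<Sum>a\<in>A. card (through n p v W))"
        using A(1) W(1) v by (intro sum_mono card_through_twin) auto
      also have "\<dots> = q * card (through n p v W)" by (simp add: A)
      also have "\<dots> \<le> n * card (through n p v W)"
      proof (rule mult_right_mono)
        have "card A \<le> card {..<n}" using A by (intro card_mono) auto
        then show "q \<le> n" using A by simp
      qed simp
      finally have "card (emb V H n (mp n p)) \<le> card (emb V H n E) + n * card (through n p v W)" by simp
      then have "count n (mp n p) \<le> count n E + real n * real (card (through n p v W))"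
        by (simp flip: of_nat_mult of_nat_add)
      then have "count n (mp n p) \<le> count n E + \<delta> / 2 * real n ^ card V"
        using few unfolding \<gamma>_def by (simp add: mult.commute)
      moreover have "\<delta>' * real n ^ card V \<le> \<delta> / 2 * real n ^ card V"
        by (intro mult_right_mono) (auto simp: \<delta>'_def)
      ultimately have "near n \<delta> E" using nr by linarith
      then obtain p2 where p2: "real (card ((E - mp n p2) \<union> (mp n p2 - E))) \<le> \<epsilon> * real n ^ 2"
        using elim(1) Esub free by blast
      \<comment> \<open>\<open>A\<close> is the middle set: its edges to \<open>W\<close> were
        deleted and it shares a class with the rest of \<open>?S\<close>, while \<open>W\<close> is
        still joined to that rest.\<close>
      have "card W * card A * card (?S - A) \<le> 6 * n * card ((E - mp n p2) \<union> (mp n p2 - E))"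
      proof (rule multipartite_obstruction[OF Esub])
        show "W \<subseteq> {..<n}" "A \<subseteq> {..<n}" "?S - A \<subseteq> {..<n}" using W A by auto
        show "W \<inter> A = {}" "A \<inter> (?S - A) = {}" "W \<inter> (?S - A) = {}" using W A by auto
        show "{a, b} \<notin> E" if "a \<in> W" "b \<in> A" for a b
          using that unfolding E_def by (auto simp: insert_commute)
        show "{b, d} \<notin> E" if "b \<in> A" "d \<in> ?S - A" for b d
          using that A unfolding E_def by auto
        show "{a, d} \<in> E" if "a \<in> W" "d \<in> ?S - A" for a d
        proof -
          have "p a \<noteq> p v" "a < n" "d < n" "p d = p v" "d \<notin> A" "a \<notin> A" using that W A by auto
          then show ?thesis unfolding E_def by (auto simp: doubleton_eq_iff)
        qed
      qed
      then have "real (card W * card A * card (?S - A)) \<le> real (6 * n * card ((E - mp n p2) \<union> (mp n p2 - E)))"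
        by (simp only: of_nat_le_iff)
      then have "real (card W) * real q * real (card ?S - q) \<le> 6 * real n * real (card ((E - mp n p2) \<union> (mp n p2 - E)))"
        by (simp add: A cA)
      also have "\<dots> \<le> 6 * real n * (\<epsilon> * real n ^ 2)" using p2 by (intro mult_left_mono) auto
      also have "\<dots> = (\<theta> * real n) * (c * real n / 3) * (c * real n / 3) / 2"
        by (simp add: \<epsilon>_def field_simps power2_eq_square)
      finally have "real (card W) * real q * real (card ?S - q)
          \<le> (\<theta> * real n) * (c * real n / 3) * (c * real n / 3) / 2" .
      moreover have "(\<theta> * real n) * (c * real n / 3) * (c * real n / 3) \<le> real (card W) * real q * real (card ?S - q)"
        using W(2) qq \<theta> c by (intro mult_mono) auto
      moreover have "0 < (\<theta> * real n) * (c * real n / 3) * (c * real n / 3)" using \<theta> c n by simp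
      ultimately show False by linarith
    qed
  qed
  then show ?thesis using pos by blast
qed

text \<open>Only edges meeting \<open>Y\<close> can be lost, at most y n^2 of them. This keeps a
  slightly relabelled partition near-extremal.\<close>

lemma count_recolour:
  assumes n: "0 < n" and Y: "Y \<subseteq> {..<n}" "real (card Y) \<le> y * real n"
    and pq: "\<And>v. v < n \<Longrightarrow> v \<notin> Y \<Longrightarrow> p v = q v"
  shows "count n (mp n p) \<le> count n (mp n q) + K * y * real n ^ card V"
proof (rule emb_diff_bound[OF finite_V join_mp_subset n])
  have fY: "finite Y" using Y(1) finite_subset by blast
  have "mp n p - mp n q \<subseteq> {{a, w} | a w. a \<in> Y \<and> w \<in> {..<n}}"
  proof (rule subset_pairsI)
    show "mp n p - mp n q \<subseteq> all_pairs n" using join_mp_subset by blast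
    fix u v assume uv: "u < n" "v < n" "{u, v} \<in> mp n p - mp n q"
    then have "u \<in> Y \<or> v \<in> Y" using pq by fastforce
    then show "{u, v} \<in> {{a, w} | a w. a \<in> Y \<and> w \<in> {..<n}}"
      using uv by (auto simp: doubleton_eq_iff)
  qed
  then have "card (mp n p - mp n q) \<le> card {{a, w} | a w. a \<in> Y \<and> w \<in> {..<n}}"
    using fY by (intro card_mono card_star_edges) auto
  also have "\<dots> \<le> card Y * n" using card_star_edges(2)[of Y "{..<n}"] fY by simp
  finally have "real (card (mp n p - mp n q)) \<le> real (card Y) * real n"
    by (metis of_nat_le_iff of_nat_mult)
  also have "\<dots> \<le> y * real n * real n" using Y(2) by (intro mult_right_mono) auto
  finally show "real (card (mp n p - mp n q)) \<le> y * real n ^ 2"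
    by (simp add: power2_eq_square mult.assoc)
qed

end

section \<open>The structure of an extremal graph\<close>

text \<open>One extremal graph, with constants chosen in the order \<open>c\<close>, then \<gamma>
  and \<delta>, then \<theta>, then \<eta>. The square in \<open>diff_small\<close> is what
  averaging needs to leave at most \<eta> n atypical vertices. \<open>dense\<close> is demanded for
  every near-extremal labelling, because it is applied after vertices have changed class.\<close>

locale extremal_graph = stable_counting V H r s k Free
  for V :: "'c set" and H :: "'c set set" and r s k :: nat and Free :: "nat \<Rightarrow> nat set set \<Rightarrow> bool" +
  fixes n :: nat and G :: "nat set set" and p :: "nat \<Rightarrow> nat" and c \<theta> \<eta> \<delta> \<gamma> :: real
  assumes n_pos: "0 < n" and G_sub: "G \<subseteq> all_pairs n" and G_free: "Free n G"
    and G_ext: "count n G = real (ex_emb V H Free n)"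
    and p_less: "\<And>v. v < n \<Longrightarrow> p v < r"
    and diff_small: "real (card ((G - mp n p) \<union> (mp n p - G))) \<le> \<eta> ^ 2 / 2 * real n ^ 2"
    and classes_large: "\<And>i. i < r \<Longrightarrow> c * real n \<le> real (card (cls n p i))"
    and \<eta>_pos: "0 < \<eta>" and \<theta>_le: "\<theta> \<le> 1" "\<theta> \<le> c / 8" and \<eta>_le: "8 * (real k + 1) * \<eta> \<le> \<theta>"
    and n_large: "real k + 1 + 2 * real s \<le> \<theta> / 8 * real n" "1 \<le> \<eta> * real n"
    and \<gamma>_pos: "0 < \<gamma>" and \<theta>_\<gamma>: "16 * real s * K * \<theta> \<le> \<gamma>" and \<eta>_\<delta>: "4 * K * \<eta> \<le> \<delta>"
    and dense: "\<And>q v W. (\<And>v. v < n \<Longrightarrow> q v < r) \<Longrightarrow> near n \<delta> (mp n q) \<Longrightarrow> v < n \<Longrightarrow>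
      W \<subseteq> {w. w < n \<and> q w \<noteq> q v} \<Longrightarrow> c / 4 * real n \<le> real (card W) \<Longrightarrow>
      \<gamma> * real n ^ card V \<le> real (card (through n q v W)) * real n"
begin

definition "D = (G - mp n p) \<union> (mp n p - G)"
abbreviation "N \<equiv> real n ^ card V"

definition "X = {v. v < n \<and> \<eta> * real n < real (card {w. {v, w} \<in> D})}"
definition "nb v i = {w \<in> cls n p i. {v, w} \<in> G}"

lemma D_sub: "D \<subseteq> all_pairs n"
  unfolding D_def using G_sub join_mp_subset by blast

lemma not_in_D: "{u, w} \<in> mp n p \<Longrightarrow> {u, w} \<notin> D \<Longrightarrow> {u, w} \<in> G"
  unfolding D_def by blast

lemma finite_D_nbs [simp]: "finite {w. {v, w} \<in> D}"
proof (rule finite_subset)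
  show "{w. {v, w} \<in> D} \<subseteq> {..<n}"
  proof
    fix w assume "w \<in> {w. {v, w} \<in> D}"
    then have "{v, w} \<in> all_pairs n" using D_sub by blast
    then show "w \<in> {..<n}" by simp
  qed
qed simp

lemma finite_nb [simp]: "finite (nb v i)"
  unfolding nb_def by simp

lemma X_sub: "X \<subseteq> {..<n}"
  unfolding X_def by auto

lemma finite_X [simp]: "finite X"
  using X_sub finite_subset by blast

lemma D_nbs_good: "v < n \<Longrightarrow> v \<notin> X \<Longrightarrow> real (card {w. {v, w} \<in> D}) \<le> \<eta> * real n"
  unfolding X_def by auto

lemma N_pos: "0 < N"
  using n_pos by simp

lemma \<theta>_pos: "0 < \<theta>"
  using \<eta>_pos \<eta>_le by (meson add_nonneg_pos less_le_trans mult_pos_pos of_nat_0_le_iff zero_less_numeral zero_less_one)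

lemma \<eta>_le_\<theta>: "8 * \<eta> \<le> \<theta>"
proof -
  have "8 * \<eta> \<le> 8 * (real k + 1) * \<eta>" using \<eta>_pos by (simp add: algebra_simps)
  then show ?thesis using \<eta>_le by linarith
qed

lemma scale: "a \<le> b \<Longrightarrow> a * real n \<le> b * real n" for a b :: real
  by (rule mult_right_mono) auto

lemma \<eta>_n: "8 * (\<eta> * real n) \<le> \<theta> * real n"
  using scale[OF \<eta>_le_\<theta>] by simp

lemma \<theta>_n: "8 * (\<theta> * real n) \<le> c * real n" "0 < \<theta> * real n"
  using scale[OF \<theta>_le(2)] \<theta>_pos n_pos by simp_all

text \<open>Double counting: each vertex of \<open>X\<close> lies on more than \<eta> n edges of
  \<open>D\<close>, and the degrees sum to at most 2|D| \<le> \<eta>^2 n^2.\<close>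

lemma card_X: "real (card X) \<le> \<eta> * real n"
proof -
  note O = card_ordered_pairs[OF D_sub]
  have "card (SIGMA v:X. {w. {v, w} \<in> D}) \<le> card {(u, w). {u, w} \<in> D}"
    by (rule card_mono[OF O(1)]) auto
  then have "(\<Sum>v\<in>X. card {w. {v, w} \<in> D}) \<le> 2 * card D"
    using O(2) by (simp add: card_SigmaI)
  then have "(\<Sum>v\<in>X. real (card {w. {v, w} \<in> D})) \<le> 2 * real (card D)"
    by (simp flip: of_nat_sum of_nat_le_iff)
  moreover have "(\<Sum>v\<in>X. \<eta> * real n) \<le> (\<Sum>v\<in>X. real (card {w. {v, w} \<in> D}))"
    by (rule sum_mono) (auto simp: X_def)
  ultimately have "real (card X) * (\<eta> * real n) \<le> (\<eta> * real n) * (\<eta> * real n)"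
    using diff_small unfolding D_def[symmetric] by (simp add: power2_eq_square mult_ac)
  then show ?thesis using \<eta>_pos n_pos by simp
qed

lemma D_le: "real (card D) \<le> \<eta> * real n ^ 2"
proof -
  have "\<eta> ^ 2 / 2 \<le> \<eta>" using \<eta>_le_\<theta> \<theta>_le(1) \<eta>_pos by (simp add: power2_eq_square)
  then have "\<eta> ^ 2 / 2 * real n ^ 2 \<le> \<eta> * real n ^ 2" by (rule mult_right_mono) simp
  then show ?thesis using diff_small unfolding D_def[symmetric] by linarith
qed

lemma count_mp: "count n G \<le> count n (mp n p) + K * \<eta> * N"
proof (rule emb_diff_bound[OF finite_V G_sub n_pos])
  have "card (G - mp n p) \<le> card D" using finite_subset[OF D_sub finite_all_pairs] by (intro card_mono) (auto simp: D_def)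
  then show "real (card (G - mp n p)) \<le> \<eta> * (real n)\<^sup>2" using D_le by linarith
qed

text \<open>The factor 2 leaves room for \<open>X\<close> and one further vertex. Passing from
  \<open>G\<close> to \<open>mp n p\<close> costs one K\<eta>, relabelling \<open>Y\<close> two
  more, and \<delta> covers all three.\<close>

lemma near_recolour:
  assumes "Y \<subseteq> {..<n}" "real (card Y) \<le> 2 * \<eta> * real n" "\<And>v. v < n \<Longrightarrow> v \<notin> Y \<Longrightarrow> p v = q v"
  shows "near n \<delta> (mp n q)"
proof -
  have "count n (mp n p) \<le> count n (mp n q) + K * (2 * \<eta>) * N"
    by (rule count_recolour[OF n_pos assms])
  then have "count n G \<le> count n (mp n q) + 3 * K * \<eta> * N" using count_mp by (simp add: algebra_simps)
  moreover have "3 * K * \<eta> \<le> \<delta>" 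
  proof -
    have "0 < K * \<eta>" using K_const_pos[of V] \<eta>_pos by simp
    then show ?thesis using \<eta>_\<delta> by linarith
  qed
  then have "3 * K * \<eta> * N \<le> \<delta> * N" by (intro mult_right_mono) auto
  ultimately show ?thesis using G_ext by linarith
qed

lemma good_nonadjacent:
  assumes "v < n" "v \<notin> X"
  shows "real (card {w. w < n \<and> p w \<noteq> p v \<and> {v, w} \<notin> G}) \<le> \<eta> * real n"
proof -
  have "{w. w < n \<and> p w \<noteq> p v \<and> {v, w} \<notin> G} \<subseteq> {w. {v, w} \<in> D}" using assms by (auto intro: ccontr dest!: not_in_D[rotated])
  then have "card {w. w < n \<and> p w \<noteq> p v \<and> {v, w} \<notin> G} \<le> card {w. {v, w} \<in> D}"
    by (intro card_mono) auto
  then show ?thesis using D_nbs_good[OF assms] by linarith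
qed

abbreviation "hits E v \<equiv> {f \<in> emb V H n E. v \<in> f ` V}"

text \<open>Redirecting the edges at \<open>v\<close> to the typical vertices outside class \<open>i\<close> keeps \<open>G\<close> free,
  so by extremality \<open>v\<close> lies in as many copies as a typical vertex of class \<open>i\<close>.\<close>

lemma hits_lower_bound:
  assumes v: "v < n" and i: "i < r"
  shows "real (card (hits (mp n (p(v := i))) v)) * real n \<le> real (card (hits G v)) * real n + 2 * K * \<eta> * N"
proof -
  \<comment> \<open>Without \<open>X\<close>, every member of \<open>U\<close> is joined to all but
    \<eta> n vertices of class \<open>i\<close>, so any \<open>k\<close> of them have more than
    \<open>k\<close> common neighbours there.\<close>
  define U where "U = {w. w < n \<and> w \<noteq> v \<and> w \<notin> X \<and> p w \<noteq> i}"
  define G' where "G' = {e \<in> G. v \<notin> e} \<union> star v U"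
  have Usub: "U \<subseteq> {..<n} - {v}" unfolding U_def by auto
  have "Free n G'" unfolding G'_def
  proof (rule free_replace[OF G_free G_sub v Usub])
    fix Q assume Q: "Q \<subseteq> U" "card Q \<le> k"
    have fQ: "finite Q" using Q(1) Usub by (meson finite_Diff finite_lessThan finite_subset)
    let ?N = "\<lambda>w. {u. {w, u} \<in> D}"
    have "cls n p i - (\<Union>w\<in>Q. ?N w) \<subseteq> {u. u < n \<and> (\<forall>w\<in>Q. {u, w} \<in> G)}"
    proof
      fix u assume u: "u \<in> cls n p i - (\<Union>w\<in>Q. ?N w)"
      have "{u, w} \<in> G" if w: "w \<in> Q" for w
      proof -
        have "w < n" "p w \<noteq> i" using w Q(1) unfolding U_def by auto
        then have "{w, u} \<in> mp n p" using u by auto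
        moreover have "{w, u} \<notin> D" using u w by blast
        ultimately show ?thesis using not_in_D by (simp add: insert_commute)
      qed
      then show "u \<in> {u. u < n \<and> (\<forall>w\<in>Q. {u, w} \<in> G)}" using u by blast
    qed
    then have "card (cls n p i - (\<Union>w\<in>Q. ?N w)) \<le> card {u. u < n \<and> (\<forall>w\<in>Q. {u, w} \<in> G)}"
      by (intro card_mono) auto
    moreover have "card (cls n p i) - card (\<Union>w\<in>Q. ?N w) \<le> card (cls n p i - (\<Union>w\<in>Q. ?N w))"
      by (rule diff_card_le_card_Diff) (use fQ in auto)
    moreover have "card (\<Union>w\<in>Q. ?N w) \<le> (\<Sum>w\<in>Q. card (?N w))" by (rule card_UN_le[OF fQ])
    ultimately have 1: "card (cls n p i) \<le> card {u. u < n \<and> (\<forall>w\<in>Q. {u, w} \<in> G)} + (\<Sum>w\<in>Q. card (?N w))"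
      by linarith
    have "(\<Sum>w\<in>Q. real (card (?N w))) \<le> (\<Sum>w\<in>Q. \<eta> * real n)"
      by (rule sum_mono) (use Q(1) D_nbs_good in \<open>auto simp: U_def\<close>)
    also have "\<dots> = real (card Q) * (\<eta> * real n)" by simp
    also have "\<dots> \<le> (real k + 1) * (\<eta> * real n)" using Q(2) \<eta>_pos by (intro mult_right_mono) auto
    also have "\<dots> \<le> \<theta> / 8 * real n"
    proof -
      have "8 * ((real k + 1) * (\<eta> * real n)) \<le> \<theta> * real n"
        using scale[OF \<eta>_le] by (simp only: mult.assoc)
      then show ?thesis by linarith
    qed
    finally have "real (card (cls n p i)) \<le> real (card {u. u < n \<and> (\<forall>w\<in>Q. {u, w} \<in> G)}) + \<theta> / 8 * real n"
      using 1 by (simp flip: of_nat_sum of_nat_add of_nat_le_iff)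
    then have "real k < real (card {u. u < n \<and> (\<forall>w\<in>Q. {u, w} \<in> G)})"
      using classes_large[OF i] \<theta>_n n_large by simp
    then show "k < card {u. u < n \<and> (\<forall>w\<in>Q. {u, w} \<in> G)}" by simp
  qed
  moreover have G'sub: "G' \<subseteq> all_pairs n" 
  proof -
    have "{v, w} \<in> all_pairs n" if "w \<in> U" for w using that Usub v by auto
    then show ?thesis unfolding G'_def using G_sub by blast
  qed
  ultimately have "count n G' \<le> count n G" using count_le_ex G_ext by simp
  then have le: "card (emb V H n G') \<le> card (emb V H n G)" by simp
  \<comment> \<open>Copies avoiding \<open>v\<close> are the same in \<open>G\<close> and
    \<open>G'\<close>, so comparing the totals compares the copies through \<open>v\<close>.\<close>
  have split: "card (emb V H n E) = card (hits E v) + card {f \<in> emb V H n E. v \<notin> f ` V}" for E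
  proof -
    have "emb V H n E = hits E v \<union> {f \<in> emb V H n E. v \<notin> f ` V}" by blast
    moreover have "card (hits E v \<union> {f \<in> emb V H n E. v \<notin> f ` V}) = card (hits E v) + card {f \<in> emb V H n E. v \<notin> f ` V}"
      using finite_V by (intro card_Un_disjoint) auto
    ultimately show ?thesis by simp
  qed
  have "{f \<in> emb V H n G'. v \<notin> f ` V} = {f \<in> emb V H n G. v \<notin> f ` V}"
  proof -
    have eq: "{f x, f y} \<in> G' \<longleftrightarrow> {f x, f y} \<in> G" if "v \<notin> f ` V" "x \<in> V" "y \<in> V" for f x y
    proof -
      have "v \<noteq> f x" "v \<noteq> f y" using that by auto
      then show ?thesis unfolding G'_def by (auto simp: doubleton_eq_iff)
    qed
    then show ?thesis unfolding emb_def by (intro Collect_cong) blast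
  qed
  then have hits_le: "card (hits G' v) \<le> card (hits G v)" using le split[of G] split[of G'] by simp
  let ?q = "p(v := i)"
  \<comment> \<open>A copy through \<open>v\<close> that \<open>G'\<close> lacks uses an edge from
    \<open>v\<close> to \<open>X\<close> or an edge off \<open>v\<close> on which \<open>G\<close>
    and \<open>mp n p\<close> disagree; both kinds are rare.\<close>
  have "hits (mp n ?q) v \<subseteq> hits G' v \<union> inj_using V H n (star v (X - {v})) \<union> inj_hit_using V H n v D"
  proof
    fix f assume f: "f \<in> hits (mp n ?q) v"
    then have f1: "f \<in> V \<rightarrow>\<^sub>E {..<n}" "inj_on f V" "v \<in> f ` V" by (auto simp: emb_def)
    show "f \<in> hits G' v \<union> inj_using V H n (star v (X - {v})) \<union> inj_hit_using V H n v D"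
    proof (cases "f \<in> emb V H n G'")
      case True then show ?thesis using f1 by blast
    next
      case False
      then obtain x y where xy: "x \<in> V" "y \<in> V" "{x, y} \<in> H" "{f x, f y} \<notin> G'" "{f x, f y} \<in> mp n ?q"
        using f unfolding emb_def by blast
      show ?thesis
      proof (cases "f x = v \<or> f y = v")
        case True
        then obtain w where w: "{f x, f y} = {v, w}" by (metis insert_commute)
        then have "{v, w} \<in> mp n ?q" "{v, w} \<notin> G'" using xy by auto
        then have "w \<in> X - {v}" unfolding G'_def U_def by (auto split: if_splits)
        then have "{f x, f y} \<in> star v (X - {v})" using w by blast
        then show ?thesis using xy f1 unfolding inj_using_def by blast
      next
        case False
        then have "{f x, f y} \<in> mp n p" "{f x, f y} \<notin> G" using xy unfolding G'_def by auto
        then have "{f x, f y} \<in> D" using not_in_D by blast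
        then show ?thesis using xy f1 False unfolding inj_hit_using_def by blast
      qed
    qed
  qed
  then have "card (hits (mp n ?q) v) \<le> card (hits G' v \<union> inj_using V H n (star v (X - {v})) \<union> inj_hit_using V H n v D)"
    using finite_V by (intro card_mono) auto
  also have "\<dots> \<le> card (hits G' v) + card (inj_using V H n (star v (X - {v}))) + card (inj_hit_using V H n v D)"
    by (intro order_trans[OF card_Un_le] add_mono card_Un_le) auto
  finally have "real (card (hits (mp n ?q) v)) \<le> real (card (hits G v))
      + real (card (inj_using V H n (star v (X - {v})))) + real (card (inj_hit_using V H n v D))"
    using hits_le by linarith
  from scale[OF this] have "real (card (hits (mp n ?q) v)) * real n \<le> real (card (hits G v)) * real n
      + real (card (inj_using V H n (star v (X - {v})))) * real n + real (card (inj_hit_using V H n v D)) * real n"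
    by (simp only: distrib_right)
  moreover have "real (card (inj_using V H n (star v (X - {v})))) * real n \<le> K * \<eta> * N"
  proof (rule star_bound[OF finite_V _ v])
    show "X - {v} \<subseteq> {..<n} - {v}" using X_sub by blast
    have "card (X - {v}) \<le> card X" by (intro card_mono) auto
    then show "real (card (X - {v})) \<le> \<eta> * real n" using card_X by linarith
  qed
  moreover have "real (card (inj_hit_using V H n v D)) * real n \<le> K * \<eta> * N"
    by (rule hit_bound[OF finite_V D_sub n_pos D_le])
  ultimately show ?thesis by linarith
qed

text \<open>With \<open>v\<close> moved to class \<open>i\<close>, the copies of \<open>G\<close>
  through \<open>v\<close> are copies in the multipartite graph, up to O(\<theta> n^(|V|-1))
  exceptions. If \<open>v\<close> missed c n / 4 vertices outside class \<open>i\<close>, all copies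
  joining \<open>v\<close> to them, at least \<gamma> n^(|V|-1) many, would be absent from
  \<open>G\<close>, and \<open>v\<close> would lie in fewer copies than
  \<open>hits_lower_bound\<close> guarantees.\<close>

lemma few_missing:
  assumes v: "v < n" and i: "i < r" and few: "real (card (nb v i)) \<le> \<theta> * real n"
  shows "real (card {w. w < n \<and> w \<noteq> v \<and> p w \<noteq> i \<and> {v, w} \<notin> G}) < c / 4 * real n"
proof (rule ccontr)
  define W where "W = {w. w < n \<and> w \<noteq> v \<and> p w \<noteq> i \<and> {v, w} \<notin> G}"
  let ?q = "p(v := i)"
  assume "\<not> ?thesis"
  then have W: "c / 4 * real n \<le> real (card W)" unfolding W_def by simp
  have "near n \<delta> (mp n ?q)"
    by (rule near_recolour[of "{v}"]) (use v n_large \<eta>_n in auto)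
  then have many: "\<gamma> * N \<le> real (card (through n ?q v W)) * real n"
    by (rule dense[OF _ _ v _ W, rotated]) (use p_less i in \<open>auto simp: W_def\<close>)
  let ?t = "through n ?q v W"
  have thr: "?t \<subseteq> hits (mp n ?q) v"
    unfolding inj_using_def by (auto simp: doubleton_eq_iff)
  \<comment> \<open>The exceptional copies use one of the few edges from \<open>v\<close> into class
    \<open>i\<close>, or an edge of \<open>D\<close> off \<open>v\<close>.\<close>
  have "hits G v \<subseteq> (hits (mp n ?q) v - ?t) \<union> inj_using V H n (star v (nb v i - {v})) \<union> inj_hit_using V H n v D"
  proof
    fix f assume f: "f \<in> hits G v"
    then have f1: "f \<in> V \<rightarrow>\<^sub>E {..<n}" "inj_on f V" "v \<in> f ` V" by (auto simp: emb_def)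
    have "f \<notin> ?t"
    proof
      assume "f \<in> ?t"
      then obtain x y w where "x \<in> V" "y \<in> V" "{x, y} \<in> H" "{f x, f y} = {v, w}" "w \<in> W"
        unfolding inj_using_def by blast
      moreover from this have "{f x, f y} \<in> G" using f unfolding emb_def by blast
      ultimately show False unfolding W_def by auto
    qed
    show "f \<in> (hits (mp n ?q) v - ?t) \<union> inj_using V H n (star v (nb v i - {v})) \<union> inj_hit_using V H n v D"
    proof (cases "f \<in> emb V H n (mp n ?q)")
      case True then show ?thesis using f1 \<open>f \<notin> ?t\<close> by blast
    next
      case False
      then obtain x y where xy: "x \<in> V" "y \<in> V" "{x, y} \<in> H" "{f x, f y} \<in> G" "{f x, f y} \<notin> mp n ?q"
        using f unfolding emb_def by blast
      show ?thesis
      proof (cases "f x = v \<or> f y = v")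
        case True
        then obtain w where w: "{f x, f y} = {v, w}" by (metis insert_commute)
        then have 1: "{v, w} \<in> G" "{v, w} \<notin> mp n ?q" using xy by auto
        then have "w < n" "w \<noteq> v" using G_sub by (metis in_all_pairs subsetD)+
        then have "w \<in> nb v i - {v}" using 1 v unfolding nb_def by (auto split: if_splits)
        then have "{f x, f y} \<in> star v (nb v i - {v})" using w by blast
        then show ?thesis using xy f1 unfolding inj_using_def by blast
      next
        case False
        then have "{f x, f y} \<notin> mp n p" using xy by auto
        then have "{f x, f y} \<in> D" using xy(4) unfolding D_def by blast
        then show ?thesis using xy f1 False unfolding inj_hit_using_def by blast
      qed
    qed
  qed
  then have "card (hits G v) \<le> card ((hits (mp n ?q) v - ?t) \<union> inj_using V H n (star v (nb v i - {v})) \<union> inj_hit_using V H n v D)"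
    using finite_V by (intro card_mono) auto
  also have "\<dots> \<le> card (hits (mp n ?q) v - ?t) + card (inj_using V H n (star v (nb v i - {v}))) + card (inj_hit_using V H n v D)"
    by (intro order_trans[OF card_Un_le] add_mono card_Un_le) auto
  also have "card (hits (mp n ?q) v - ?t) = card (hits (mp n ?q) v) - card ?t"
    using thr finite_V by (intro card_Diff_subset) auto
  finally have "card (hits G v) + card ?t \<le> card (hits (mp n ?q) v)
      + card (inj_using V H n (star v (nb v i - {v}))) + card (inj_hit_using V H n v D)"
    using card_mono[OF _ thr] finite_V by simp
  then have "real (card (hits G v)) + real (card ?t) \<le> real (card (hits (mp n ?q) v))
      + real (card (inj_using V H n (star v (nb v i - {v})))) + real (card (inj_hit_using V H n v D))"
    by linarith
  from scale[OF this] have "real (card (hits G v)) * real n + real (card ?t) * real n \<le> real (card (hits (mp n ?q) v)) * real n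
      + real (card (inj_using V H n (star v (nb v i - {v})))) * real n + real (card (inj_hit_using V H n v D)) * real n"
    by (simp only: distrib_right)
  moreover have "real (card (inj_using V H n (star v (nb v i - {v})))) * real n \<le> K * \<theta> * N"
  proof (rule star_bound[OF finite_V _ v])
    show "nb v i - {v} \<subseteq> {..<n} - {v}" unfolding nb_def by auto
    have "card (nb v i - {v}) \<le> card (nb v i)" by (intro card_mono) auto
    then show "real (card (nb v i - {v})) \<le> \<theta> * real n" using few by linarith
  qed
  moreover have "real (card (inj_hit_using V H n v D)) * real n \<le> K * \<eta> * N"
    by (rule hit_bound[OF finite_V D_sub n_pos D_le])
  moreover note hits_lower_bound[OF v i]
  \<comment> \<open>One K\<eta> comes from the copies using \<open>D\<close> here, two from
    \<open>hits_lower_bound\<close>.\<close>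
  ultimately have "real (card ?t) * real n \<le> K * \<theta> * N + 3 * K * \<eta> * N" by linarith
  also have "\<dots> \<le> 2 * K * \<theta> * N"
  proof -
    have "3 * K * \<eta> \<le> K * \<theta>" using \<eta>_le_\<theta> \<eta>_pos K_const_pos[of V] by simp
    then have "3 * K * \<eta> * N \<le> K * \<theta> * N" by (intro mult_right_mono) auto
    then show ?thesis by (simp add: algebra_simps)
  qed
  finally have "\<gamma> * N \<le> 2 * K * \<theta> * N" using many by linarith
  then have "\<gamma> \<le> 2 * K * \<theta>" using N_pos by simp
  moreover have "16 * 1 * (K * \<theta>) \<le> 16 * real s * (K * \<theta>)"
    using s_pos \<theta>_pos K_const_pos[of V] by (intro mult_right_mono mult_left_mono) auto
  ultimately show False using \<theta>_\<gamma> \<theta>_pos K_const_pos[of V] \<gamma>_pos by (simp add: mult.assoc)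
qed

end

lemma card_add_le:
  assumes "finite C" "A \<union> B \<subseteq> C" "A \<inter> B = {}"
  shows "card A + card B \<le> card C"
proof -
  have "finite A" "finite B" using assms finite_subset by blast+
  then have "card A + card B = card (A \<union> B)" using assms(3) by (simp add: card_Un_disjoint)
  then show ?thesis using card_mono[OF assms(1,2)] by simp
qed

context extremal_graph
begin

section \<open>Big vertices and edges inside the parts\<close>

definition "B = {v. v < n \<and> (\<forall>i<r. \<theta> * real n < real (card (nb v i)))}"

text \<open>A vertex outside \<open>B\<close> moves to a class in which it has few neighbours; \<open>p'\<close> agrees with \<open>p\<close>
  outside \<open>X\<close>.\<close>

definition "p' v = (if v \<in> B then p v else SOME i. i < r \<and> real (card (nb v i)) \<le> \<theta> * real n)"

text \<open>These are the edges by which \<open>G\<close> can exceed \<open>join_mp n B p'\<close>,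
  hence the labels \<open>p'\<close> and the exclusion of \<open>B\<close>.\<close>

definition "inside = {e \<in> G. \<exists>u v. e = {u, v} \<and> u \<notin> B \<and> v \<notin> B \<and> p' u = p' v}"

definition "t = nat \<lfloor>\<eta> * real n\<rfloor>"

text \<open>Candidate lists of this size allow \<open>k\<close> vertices to be placed greedily when
  up to \<open>t\<close> vertices are atypical and each typical vertex misses up to \<open>t\<close>
  vertices of the other classes.\<close>

abbreviation "m \<equiv> (k + 1) * (t + 1)"

definition "disjoint_edges L \<longleftrightarrow> (\<forall>e\<in>L. \<forall>e'\<in>L. e \<noteq> e' \<longrightarrow> e \<inter> e' = {})"

lemma G_less:
  assumes "{u, w} \<in> G"
  shows "u < n" "w < n" "u \<noteq> w"
proof -
  have "{u, w} \<in> all_pairs n" using assms G_sub by blast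
  then show "u < n" "w < n" "u \<noteq> w" by simp_all
qed

lemma adjacent_off_D: "u < n \<Longrightarrow> w < n \<Longrightarrow> p u \<noteq> p w \<Longrightarrow> {u, w} \<notin> D \<Longrightarrow> {u, w} \<in> G"
  using not_in_D[of u w] by auto

lemma B_sub: "B \<subseteq> {..<n}"
  unfolding B_def by auto

lemma finite_B [simp]: "finite B"
  using B_sub finite_subset by blast

lemma r_pos: "0 < r"
  using r_ge_2 by simp

lemma p'_few:
  assumes "v < n" "v \<notin> B"
  shows "p' v < r" "real (card (nb v (p' v))) \<le> \<theta> * real n"
proof -
  have "\<exists>i. i < r \<and> real (card (nb v i)) \<le> \<theta> * real n" using assms unfolding B_def by fastforce
  from someI_ex[OF this] assms(2) show "p' v < r" "real (card (nb v (p' v))) \<le> \<theta> * real n"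
    unfolding p'_def by auto
qed

lemma p'_less: "v < n \<Longrightarrow> p' v < r"
  using p'_few(1) p_less by (cases "v \<in> B") (auto simp: p'_def)

lemma good_nb_own:
  assumes "v < n" "v \<notin> X"
  shows "real (card (nb v (p v))) \<le> \<eta> * real n"
proof -
  have "nb v (p v) \<subseteq> {w. {v, w} \<in> D}" unfolding nb_def D_def by auto
  then have "card (nb v (p v)) \<le> card {w. {v, w} \<in> D}" by (intro card_mono) auto
  then show ?thesis using D_nbs_good[OF assms] by linarith
qed

lemma card_diff_real:
  fixes S S' :: "'x set" and a :: real
  assumes "finite S'" "real (card S') \<le> a"
  shows "real (card S) - a \<le> real (card (S - S'))"
  using diff_card_le_card_Diff[OF assms(1), of S] assms(2) by linarith

lemma good_nb_other:
  assumes v: "v < n" "v \<notin> X" and j: "j < r" "j \<noteq> p v"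
  shows "\<theta> * real n < real (card (nb v j))"
proof -
  have "cls n p j - {w. {v, w} \<in> D} \<subseteq> nb v j"
    using v j unfolding nb_def by (auto intro!: adjacent_off_D)
  then have "card (cls n p j - {w. {v, w} \<in> D}) \<le> card (nb v j)" by (intro card_mono) auto
  moreover have "real (card (cls n p j)) - \<eta> * real n \<le> real (card (cls n p j - {w. {v, w} \<in> D}))"
    by (rule card_diff_real) (use D_nbs_good[OF v] in auto)
  ultimately show ?thesis using classes_large[OF j(1)] \<theta>_n \<eta>_n by linarith
qed

lemma good_not_B: assumes "v < n" "v \<notin> X" shows "v \<notin> B"
proof
  assume "v \<in> B"
  then have "\<theta> * real n < real (card (nb v (p v)))" using p_less[OF assms(1)] unfolding B_def by blast
  then show False using good_nb_own[OF assms] \<eta>_n \<theta>_n by linarith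
qed

text \<open>A typical vertex has more than \<theta> n neighbours in every class but its own, so the
  choice in \<open>p'\<close> is forced.\<close>

lemma good_p': assumes "v < n" "v \<notin> X" shows "p' v = p v"
  using good_nb_other[OF assms p'_few(1)] p'_few(2) good_not_B assms by fastforce

lemma m_le: "real m \<le> \<theta> / 4 * real n"
proof -
  have "real t \<le> \<eta> * real n" unfolding t_def using n_large by linarith
  then have "(real k + 1) * (real t + 1) \<le> (real k + 1) * (\<eta> * real n + 1)" by (intro mult_left_mono) auto
  moreover have "8 * ((real k + 1) * (\<eta> * real n)) \<le> \<theta> * real n"
    using scale[OF \<eta>_le] by (simp only: mult.assoc)
  moreover have "(real k + 1) * (\<eta> * real n + 1) = (real k + 1) * (\<eta> * real n) + (real k + 1)"
    by (simp add: distrib_left)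
  ultimately have "(real k + 1) * (real t + 1) \<le> \<theta> / 8 * real n + (real k + 1)"
    by linarith
  moreover have "real m = (real k + 1) * (real t + 1)" by (simp add: algebra_simps)
  moreover have "0 \<le> 2 * real s" by simp
  ultimately show ?thesis using n_large(1) by linarith
qed

lemma le_t: "real a \<le> \<eta> * real n \<Longrightarrow> a \<le> t"
  unfolding t_def using le_nat_floor by blast

text \<open>By \<open>few_missing\<close> each end misses fewer than c n / 4 vertices outside class
  \<open>p' u\<close>, so every other class keeps about c n / 2 common neighbours. The color of the
  hosted edge is \<open>p' u\<close>.\<close>

lemma rich_inside:
  assumes "e \<in> inside"
  shows "rich n p r G m e"
proof -
  obtain u v where e: "e = {u, v}" "{u, v} \<in> G" "u \<notin> B" "v \<notin> B" "p' u = p' v"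
    using assms unfolding inside_def by blast
  have uv: "u < n" "v < n" using e(2) G_less by blast+
  let ?M = "\<lambda>v. {w. w < n \<and> w \<noteq> v \<and> p w \<noteq> p' v \<and> {v, w} \<notin> G}"
  have "m \<le> card {w \<in> cls n p j. \<forall>x\<in>e. {x, w} \<in> G}" if j: "j < r" "j \<noteq> p' u" for j
  proof -
    have "cls n p j - ?M u - ?M v - {u, v} \<subseteq> {w \<in> cls n p j. \<forall>x\<in>e. {x, w} \<in> G}"
      using j e by auto
    then have 1: "card (cls n p j - ?M u - ?M v - {u, v}) \<le> card {w \<in> cls n p j. \<forall>x\<in>e. {x, w} \<in> G}"
      by (intro card_mono) auto
    have "real (card (?M u)) \<le> c / 4 * real n"
      using few_missing[OF uv(1) p'_few[OF uv(1) e(3)]] by (rule less_imp_le)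
    moreover have "real (card (?M v)) \<le> c / 4 * real n"
      using few_missing[OF uv(2) p'_few[OF uv(2) e(4)]] by (rule less_imp_le)
    moreover have "real (card {u, v}) \<le> 2" by (cases "u = v") auto
    ultimately have "real (card (cls n p j)) - c / 4 * real n - c / 4 * real n - 2
        \<le> real (card (cls n p j - ?M u - ?M v - {u, v}))"
      using card_diff_real[of "?M u" "c / 4 * real n" "cls n p j"]
        card_diff_real[of "?M v" "c / 4 * real n" "cls n p j - ?M u"]
        card_diff_real[of "{u, v}" 2 "cls n p j - ?M u - ?M v"] by simp
    moreover have "1 \<le> real s" using s_pos by simp
    ultimately have "real m \<le> real (card {w \<in> cls n p j. \<forall>x\<in>e. {x, w} \<in> G})"
      using 1 classes_large[OF j(1)] m_le \<theta>_n n_large by linarith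
    then show ?thesis by (simp only: of_nat_le_iff)
  qed
  then show ?thesis unfolding rich_def using p'_less[OF uv(1)] by blast
qed

text \<open>\<open>v\<close> has more than \<theta> n neighbours in each class, and the typical
  vertex \<open>w\<close> misses at most \<eta> n vertices outside its own class 0; so 0 serves as
  the color of the hosted edge.\<close>

lemma rich_big:
  assumes v: "v \<in> B" and w: "w \<in> nb v 0" "w \<notin> X"
  shows "rich n p r G m {v, w}"
proof -
  have wn: "w < n" "p w = 0" using w unfolding nb_def by auto
  have "m \<le> card {x \<in> cls n p j. \<forall>y\<in>{v, w}. {y, x} \<in> G}" if j: "j < r" "j \<noteq> 0" for j
  proof -
    have "nb v j - {x. {w, x} \<in> D} \<subseteq> {x \<in> cls n p j. \<forall>y\<in>{v, w}. {y, x} \<in> G}"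
      using wn j unfolding nb_def by (auto intro!: adjacent_off_D)
    then have "card (nb v j - {x. {w, x} \<in> D}) \<le> card {x \<in> cls n p j. \<forall>y\<in>{v, w}. {y, x} \<in> G}"
      by (intro card_mono) auto
    moreover have "real (card (nb v j)) - \<eta> * real n \<le> real (card (nb v j - {x. {w, x} \<in> D}))"
      by (rule card_diff_real) (use D_nbs_good wn w in auto)
    moreover have "\<theta> * real n < real (card (nb v j))" using v j unfolding B_def by blast
    ultimately have "real m \<le> real (card {x \<in> cls n p j. \<forall>y\<in>{v, w}. {y, x} \<in> G})"
      using m_le \<eta>_n \<theta>_n by linarith
    then show ?thesis by (simp only: of_nat_le_iff)
  qed
  then show ?thesis unfolding rich_def using r_pos by blast
qed

lemma card_Union_le_two:
  assumes "finite L" "L \<subseteq> G"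
  shows "finite (\<Union>L)" "card (\<Union>L) \<le> 2 * card L"
proof -
  have e2: "finite e \<and> card e \<le> 2" if "e \<in> L" for e
  proof -
    have "e \<in> all_pairs n" using that assms G_sub by blast
    then obtain u v where "e = {u, v}" "u \<noteq> v" by (metis all_pairsE)
    then show ?thesis by simp
  qed
  then show "finite (\<Union>L)" using assms by blast
  have "card (\<Union>L) \<le> (\<Sum>e\<in>L. card e)" by (rule card_Union_le_sum_card)
  also have "\<dots> \<le> (\<Sum>e\<in>L. 2)" by (rule sum_mono) (use e2 in blast)
  finally show "card (\<Union>L) \<le> 2 * card L" by simp
qed

lemma no_rich_matching:
  assumes "L \<subseteq> G" "card L = s" "disjoint_edges L" "\<And>e. e \<in> L \<Longrightarrow> rich n p r G m e"
  shows False
proof -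
  have "\<not> Free n G"
  proof (rule not_free_rich[OF G_sub p_less X_sub, where t = t and L = L])
    show "card X \<le> t" using card_X le_t by blast
    show "card {w. w < n \<and> p w \<noteq> p v \<and> {v, w} \<notin> G} \<le> t" if "v < n" "v \<notin> X" for v
      using good_nonadjacent[OF that] le_t by blast
    show "(k + 1) * (t + 1) \<le> card (cls n p j)" if "j < r" for j
    proof -
      have "real m \<le> real (card (cls n p j))" using classes_large[OF that] m_le \<theta>_n by linarith
      then show ?thesis by (simp only: of_nat_le_iff)
    qed
    show "e \<inter> e' = {}" if "e \<in> L" "e' \<in> L" "e \<noteq> e'" for e e'
      using assms(3) that unfolding disjoint_edges_def by blast
  qed (use assms in auto)
  then show False using G_free by simp
qed

text \<open>Each big vertex gets an edge to a typical neighbour in class 0 outside the at most 2s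
  vertices already used. Typical vertices are not big, so the big vertices still to be treated stay
  free, which the last conjunct records.\<close>

lemma extend_matching:
  assumes L0: "L0 \<subseteq> inside" "disjoint_edges L0"
  shows "finite B1 \<Longrightarrow> B1 \<subseteq> B \<Longrightarrow> card L0 + card B1 \<le> s \<Longrightarrow>
    \<exists>L. L \<subseteq> G \<and> card L = card L0 + card B1 \<and> disjoint_edges L \<and>
      (\<forall>e\<in>L. rich n p r G m e) \<and> \<Union>L \<inter> (B - B1) = {}"
proof (induction B1 rule: finite_induct)
  case empty
  have "\<Union>L0 \<inter> B = {}" using L0(1) unfolding inside_def by fastforce
  moreover have "L0 \<subseteq> G" using L0(1) unfolding inside_def by blast
  ultimately show ?case using L0 rich_inside by (intro exI[of _ L0]) auto
next
  case (insert v B1)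
  then obtain L where L: "L \<subseteq> G" "card L = card L0 + card B1" "disjoint_edges L"
    "\<And>e. e \<in> L \<Longrightarrow> rich n p r G m e" "\<Union>L \<inter> (B - B1) = {}"
    by auto
  have fL: "finite L" using L(1) G_sub finite_all_pairs by (meson finite_subset)
  note UL = card_Union_le_two[OF fL L(1)]
  have v: "v \<in> B" using insert.prems by simp
  have "card L < s" using L(2) insert by simp
  then have "real (card (\<Union>L)) \<le> 2 * real s" using UL(2) by linarith
  then have "real (card (nb v 0)) - \<eta> * real n - 2 * real s \<le> real (card (nb v 0 - X - \<Union>L))"
    using card_diff_real[of X "\<eta> * real n" "nb v 0"] card_X
      card_diff_real[of "\<Union>L" "2 * real s" "nb v 0 - X"] UL(1) by simp
  moreover have "\<theta> * real n < real (card (nb v 0))" using v r_pos unfolding B_def by blast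
  ultimately have "0 < card (nb v 0 - X - \<Union>L)" using \<eta>_n n_large \<theta>_n by linarith
  then obtain w where w: "w \<in> nb v 0" "w \<notin> X" "w \<notin> \<Union>L" by (metis DiffE card_gt_0_iff ex_in_conv)
  have vL: "v \<notin> \<Union>L" using L(5) v insert.hyps by blast
  have wB: "w \<notin> B" using good_not_B w unfolding nb_def by blast
  have new: "{v, w} \<notin> L" using vL by blast
  have "disjoint_edges (insert {v, w} L)"
    using L(3) vL w(3) unfolding disjoint_edges_def by blast
  moreover have "{v, w} \<in> G" using w unfolding nb_def by blast
  moreover have "card (insert {v, w} L) = card L0 + card (insert v B1)"
    using new fL L(2) insert.hyps by simp
  moreover have "\<Union>(insert {v, w} L) \<inter> (B - insert v B1) = {}" using L(5) wB by blast
  ultimately show ?case using L rich_big[OF v w(1,2)] by (intro exI[of _ "insert {v, w} L"]) auto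
qed

text \<open>Otherwise there are \<open>s\<close> disjoint rich edges, contrary to the freeness of
  \<open>G\<close>. Exactly \<open>s\<close> edges are wanted, so at most \<open>s\<close> edges of
  \<open>L0\<close> are kept and only the missing number of big vertices is used.\<close>

lemma matching_bound:
  assumes "L0 \<subseteq> inside" "disjoint_edges L0"
  shows "card L0 + card B < s"
proof (rule ccontr)
  assume "\<not> ?thesis"
  then have ge: "s \<le> card L0 + card B" by simp
  define l where "l = min s (card L0)"
  obtain L1 where L1: "L1 \<subseteq> L0" "card L1 = l"
    using ex_subset_of_card[of l L0] unfolding l_def by auto
  have "s - l \<le> card B" using ge unfolding l_def by auto
  then obtain B1 where B1: "B1 \<subseteq> B" "card B1 = s - l" "finite B1"
    using ex_subset_of_card by blast
  have sum: "card L1 + card B1 = s" using L1 B1 unfolding l_def by simp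
  have "disjoint_edges L1" using assms(2) L1(1) unfolding disjoint_edges_def by blast
  moreover have "L1 \<subseteq> inside" using assms(1) L1(1) by blast
  ultimately obtain L where "L \<subseteq> G" "card L = s" "disjoint_edges L" "\<And>e. e \<in> L \<Longrightarrow> rich n p r G m e"
    using extend_matching[of L1 B1] B1 sum by auto
  then show False using no_rich_matching by blast
qed

lemma finite_inside: "finite inside"
  by (rule finite_subset[of _ "all_pairs n"]) (use G_sub in \<open>auto simp: inside_def\<close>)

lemma maximal_matching:
  "\<exists>L. L \<subseteq> inside \<and> disjoint_edges L \<and> (\<forall>e\<in>inside. e \<inter> \<Union>L \<noteq> {})"
proof -
  let ?P = "\<lambda>L. L \<subseteq> inside \<and> disjoint_edges L"
  have "?P {}" unfolding disjoint_edges_def by simp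
  moreover have "\<forall>L. ?P L \<longrightarrow> card L < Suc (card inside)"
    using finite_inside by (simp add: card_mono less_Suc_eq_le)
  ultimately obtain L where L: "?P L" "\<And>L'. ?P L' \<Longrightarrow> card L' \<le> card L"
    using ex_has_greatest_nat[of ?P "{}" card "Suc (card inside)"] by blast
  have fL: "finite L" using L(1) finite_inside finite_subset by blast
  have "e \<inter> \<Union>L \<noteq> {}" if e: "e \<in> inside" for e
  proof
    assume disj: "e \<inter> \<Union>L = {}"
    have "e \<noteq> {}" using e unfolding inside_def by blast
    then have "e \<notin> L" using disj by blast
    moreover have "?P (insert e L)" using L(1) e disj unfolding disjoint_edges_def by blast
    ultimately show False using L(2)[of "insert e L"] fL by simp
  qed
  then show ?thesis using L(1) by blast
qed

text \<open>\<open>inside\<close> refers to the labels \<open>p'\<close> but \<open>nb\<close> to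
  \<open>p\<close>. They can differ only on \<open>X\<close>, which is absorbed by the second
  \<theta> n.\<close>

lemma inside_nbs:
  assumes "u < n" "u \<notin> B"
  shows "real (card {w. {u, w} \<in> inside}) \<le> 2 * \<theta> * real n"
proof -
  have "{w. {u, w} \<in> inside} \<subseteq> nb u (p' u) \<union> X"
  proof
    fix w assume "w \<in> {w. {u, w} \<in> inside}"
    then have w: "{u, w} \<in> G" "p' w = p' u" unfolding inside_def by (auto simp: doubleton_eq_iff)
    then have "w < n" using G_less by blast
    then show "w \<in> nb u (p' u) \<union> X" using w good_p'[of w] unfolding nb_def by auto
  qed
  then have "card {w. {u, w} \<in> inside} \<le> card (nb u (p' u) \<union> X)" by (intro card_mono) auto
  also have "\<dots> \<le> card (nb u (p' u)) + card X" by (rule card_Un_le)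
  finally have "real (card {w. {u, w} \<in> inside}) \<le> real (card (nb u (p' u))) + real (card X)" by linarith
  then show ?thesis using p'_few[OF assms] card_X \<eta>_n \<theta>_n by linarith
qed

text \<open>A maximal matching has at most 2s vertices; they meet every inside edge, and each lies
  on at most 2\<theta> n of them.\<close>

lemma card_inside: "real (card inside) \<le> 4 * real s * \<theta> * real n"
proof -
  obtain L where L: "L \<subseteq> inside" "disjoint_edges L" "\<forall>e\<in>inside. e \<inter> \<Union>L \<noteq> {}"
    using maximal_matching by blast
  have LG: "L \<subseteq> G" using L(1) unfolding inside_def by blast
  have fL: "finite L" using L(1) finite_inside finite_subset by blast
  note UL = card_Union_le_two[OF fL LG]
  have un: "u < n \<and> u \<notin> B" if "u \<in> \<Union>L" for u
  proof -
    from that obtain e where e: "e \<in> L" "u \<in> e" by (rule UnionE)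
    then have "e \<in> inside" using L(1) by (rule_tac subsetD)
    then obtain a b where ab: "e = {a, b}" "a \<notin> B" "b \<notin> B" "{a, b} \<in> G"
      unfolding inside_def by blast
    then show ?thesis using G_less[OF ab(4)] e(2) by auto
  qed
  have fin: "finite {w. {u, w} \<in> inside}" for u
  proof (rule finite_subset)
    show "{w. {u, w} \<in> inside} \<subseteq> {..<n}" using G_less unfolding inside_def by blast
  qed simp
  have "inside \<subseteq> (\<Union>u\<in>\<Union>L. star u {w. {u, w} \<in> inside})"
  proof
    fix e assume e: "e \<in> inside"
    then obtain u where u: "u \<in> e" "u \<in> \<Union>L" using L(3) by blast
    obtain w where "e = {u, w}" using e u(1) unfolding inside_def by blast
    then show "e \<in> (\<Union>u\<in>\<Union>L. star u {w. {u, w} \<in> inside})" using e u by blast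
  qed
  then have "card inside \<le> card (\<Union>u\<in>\<Union>L. star u {w. {u, w} \<in> inside})"
    by (intro card_mono finite_UN_I[OF UL(1)] card_star_le(1)[OF fin])
  also have "\<dots> \<le> (\<Sum>u\<in>\<Union>L. card (star u {w. {u, w} \<in> inside}))" by (rule card_UN_le[OF UL(1)])
  also have "\<dots> \<le> (\<Sum>u\<in>\<Union>L. card {w. {u, w} \<in> inside})" by (rule sum_mono) (rule card_star_le(2)[OF fin])
  finally have "real (card inside) \<le> (\<Sum>u\<in>\<Union>L. real (card {w. {u, w} \<in> inside}))"
    by (simp flip: of_nat_sum)
  also have "\<dots> \<le> (\<Sum>u\<in>\<Union>L. 2 * \<theta> * real n)" by (rule sum_mono) (use inside_nbs un in blast)
  also have "\<dots> = real (card (\<Union>L)) * (2 * \<theta> * real n)" by simp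
  also have "\<dots> \<le> 2 * real s * (2 * \<theta> * real n)"
  proof (rule mult_right_mono)
    have "card L \<le> s" using matching_bound[OF L(1,2)] by simp
    then show "real (card (\<Union>L)) \<le> 2 * real s" using UL(2) by linarith
  qed (use \<theta>_n in simp)
  finally show ?thesis by simp
qed

abbreviation "J \<equiv> join_mp n B p'"

lemma G_minus_J: "G - J \<subseteq> inside"
proof (rule subset_pairsI)
  show "G - J \<subseteq> all_pairs n" using G_sub by blast
qed (auto simp: inside_def)

text \<open>With fewer big vertices, a typical vertex \<open>v\<close> could be made universal while
  keeping the graph free. The copies joining it to its own class are new, at least \<gamma>
  n^(|V|-1) many, more than the 4sK\<theta> n^(|V|-1) by which \<open>G\<close> can exceed
  \<open>J\<close>.\<close>

lemma card_B: "card B = s - 1"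
proof (rule ccontr)
  assume "card B \<noteq> s - 1"
  moreover have "card B < s" using matching_bound[of "{}"] by (simp add: disjoint_edges_def)
  ultimately have small: "card B < s - 1" by simp
  have fewX: "real (card X) < real n" using card_X \<eta>_n \<theta>_n scale[OF \<theta>_le(1)] by linarith
  have "\<not> {..<n} \<subseteq> X" using card_mono[of X "{..<n}"] fewX by auto
  then obtain v where v: "v < n" "v \<notin> X" by auto
  have vB: "v \<notin> B" using good_not_B v by blast
  obtain j where j: "j < r" "j \<noteq> p v" using r_ge_2 that[of 0] that[of 1] by (cases "p v = 0") auto
  \<comment> \<open>In \<open>mp n ?q\<close> the vertex \<open>v\<close> is joined to its old
    class, and this graph lies inside \<open>?J\<close>, where \<open>v\<close> is universal; so
    \<open>dense\<close> supplies the new copies.\<close>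
  let ?q = "p'(v := j)"
  \<comment> \<open>Removing \<open>X\<close> makes \<open>?W\<close> avoid \<open>B\<close> and
    carry the same labels under \<open>p\<close> and \<open>p'\<close>.\<close>
  let ?W = "cls n p (p v) - X - {v}"
  let ?J = "join_mp n (insert v B) p'"
  have W: "w < n \<and> w \<noteq> v \<and> w \<notin> B \<and> p' w = p v" if "w \<in> ?W" for w
    using that good_not_B good_p' by auto
  have "near n \<delta> (mp n ?q)"
  proof (rule near_recolour)
    show "insert v X \<subseteq> {..<n}" using v X_sub by auto
    show "real (card (insert v X)) \<le> 2 * \<eta> * real n" using card_X n_large v(2) by simp
    show "p u = ?q u" if "u < n" "u \<notin> insert v X" for u using that good_p' by auto
  qed
  then have nq: "near n \<delta> (mp n ?q)" .
  have bigW: "c / 4 * real n \<le> real (card ?W)"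
    using card_diff_real[of X "\<eta> * real n" "cls n p (p v)"] card_X
      card_diff_real[of "{v}" 1 "cls n p (p v) - X"] classes_large[OF p_less[OF v(1)]] \<eta>_n \<theta>_n n_large
    by simp
  have many: "\<gamma> * N \<le> real (card (through n ?q v ?W)) * real n"
  proof (rule dense[OF _ nq v(1) _ bigW])
    show "?q u < r" if "u < n" for u using p'_less[OF that] j(1) by simp
    show "?W \<subseteq> {w. w < n \<and> ?q w \<noteq> ?q v}" using W j(2) by auto
  qed
  have "emb V H n J \<union> through n ?q v ?W \<subseteq> emb V H n ?J"
  proof (rule Un_least)
    have "J \<subseteq> ?J" "mp n ?q \<subseteq> ?J"
      by (rule subset_pairsI[OF join_mp_subset]; auto split: if_splits)+
    then show "emb V H n J \<subseteq> emb V H n ?J" "through n ?q v ?W \<subseteq> emb V H n ?J"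
      unfolding emb_def by blast+
  qed
  moreover have "emb V H n J \<inter> through n ?q v ?W = {}"
  proof -
    have "f \<notin> through n ?q v ?W" if f: "f \<in> emb V H n J" for f
    proof
      assume "f \<in> through n ?q v ?W"
      then obtain x y w where xy: "x \<in> V" "y \<in> V" "{x, y} \<in> H" "{f x, f y} = {v, w}" "w \<in> ?W"
        unfolding inj_using_def by blast
      have "{f x, f y} \<in> J" using f xy(1-3) unfolding emb_def by blast
      then have "{v, w} \<in> J" by (simp only: xy(4))
      then show False using W[OF xy(5)] vB good_p'[OF v] by simp
    qed
    then show ?thesis by blast
  qed
  ultimately have "card (emb V H n J) + card (through n ?q v ?W) \<le> card (emb V H n ?J)"
    by (intro card_add_le[OF finite_emb[OF finite_V]])
  moreover have "count n ?J \<le> count n G"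
  proof -
    have "Free n ?J"
    proof (rule free_join[OF subset_refl])
      show "insert v B \<subseteq> {..<n}" using v B_sub by auto
      show "card (insert v B) < s" using small vB by simp
    qed (rule p'_less)
    then show ?thesis using count_le_ex join_mp_subset G_ext by metis
  qed
  ultimately have "count n J + real (card (through n ?q v ?W)) \<le> count n G" by linarith
  \<comment> \<open>The linear bound on the inside edges is written as a quadratic one with factor
    4s\<theta>/n, to fit \<open>emb_diff_bound\<close>.\<close>
  moreover have "count n G \<le> count n J + K * (4 * real s * \<theta> / real n) * N"
  proof (rule emb_diff_bound[OF finite_V G_sub n_pos])
    have "card (G - J) \<le> card inside" by (rule card_mono[OF finite_inside G_minus_J])
    then have "real (card (G - J)) \<le> 4 * real s * \<theta> * real n" using card_inside by linarith
    then show "real (card (G - J)) \<le> 4 * real s * \<theta> / real n * (real n)\<^sup>2"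
      using n_pos by (simp add: power2_eq_square)
  qed
  ultimately have "real (card (through n ?q v ?W)) \<le> K * (4 * real s * \<theta> / real n) * N" by linarith
  from scale[OF this] many have "\<gamma> * N \<le> K * (4 * real s * \<theta> / real n) * N * real n" by linarith
  also have "\<dots> = K * (4 * real s * \<theta>) * N" using n_pos by simp
  finally have "\<gamma> * N \<le> K * (4 * real s * \<theta>) * N" .
  then have "\<gamma> \<le> K * (4 * real s * \<theta>)" using N_pos by simp
  then show False using \<theta>_\<gamma> \<gamma>_pos by (simp add: mult_ac)
qed

lemma class_nonempty:
  assumes "i < r"
  shows "\<exists>v<n. v \<notin> B \<and> p' v = i"
proof -
  have "real (card (cls n p i)) - \<eta> * real n \<le> real (card (cls n p i - X))"
    by (rule card_diff_real[OF _ card_X]) simp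
  then have "0 < card (cls n p i - X)" using classes_large[OF assms] \<eta>_n \<theta>_n by linarith
  then obtain v where "v \<in> cls n p i - X" by (metis card_gt_0_iff ex_in_conv)
  then show ?thesis using good_not_B good_p' by (intro exI[of _ v]) auto
qed

text \<open>With \<open>s - 1\<close> big vertices there is no room for even one inside edge, so
  \<open>G\<close> is contained in \<open>J\<close>, which is itself free.\<close>

lemma count_J: "count n J = real (ex_emb V H Free n)"
proof (rule antisym)
  have "Free n J"
    using free_join[OF subset_refl B_sub] card_B s_pos p'_less by simp
  then show "count n J \<le> real (ex_emb V H Free n)" using count_le_ex join_mp_subset by blast
  obtain L where L: "L \<subseteq> inside" "disjoint_edges L" "\<forall>e\<in>inside. e \<inter> \<Union>L \<noteq> {}"
    using maximal_matching by blast
  have "finite L" using L(1) finite_inside finite_subset by blast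
  moreover have "card L = 0" using matching_bound[OF L(1,2)] card_B by simp
  ultimately have "L = {}" by simp
  then have "inside = {}" using L(3) by auto
  then have "G \<subseteq> J" using G_minus_J by blast
  then have "emb V H n G \<subseteq> emb V H n J" unfolding emb_def by blast
  then have "card (emb V H n G) \<le> card (emb V H n J)" using finite_V by (intro card_mono) auto
  then show "real (ex_emb V H Free n) \<le> count n J" using G_ext by simp
qed

end

section \<open>Choice of constants\<close>

context stable_counting
begin

lemma extremal_structure:
  "\<forall>\<^sub>F n in sequentially. \<exists>B p. B \<subseteq> {..<n} \<and> card B = s - 1 \<and> (\<forall>v<n. p v < r) \<and>
     (\<forall>i<r. \<exists>v<n. v \<notin> B \<and> p v = i) \<and> card (emb V H n (join_mp n B p)) = ex_emb V H Free n"
proof -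
  obtain c \<delta>1 where c: "c > 0" and \<delta>1: "\<delta>1 > 0" and
    ev1: "\<forall>\<^sub>F n in sequentially. \<forall>p. (\<forall>v<n. p v < r) \<longrightarrow> near n \<delta>1 (mp n p) \<longrightarrow>
       (\<forall>i<r. c * real n \<le> real (card (cls n p i)))"
    using linear_classes by blast
  have "0 < c / 4" using c by simp
  from many_through[OF this] obtain \<gamma> \<delta>2 where \<gamma>: "\<gamma> > 0" and \<delta>2: "\<delta>2 > 0" and
    ev2: "\<forall>\<^sub>F n in sequentially. \<forall>p v W. (\<forall>v<n. p v < r) \<longrightarrow> near n \<delta>2 (mp n p) \<longrightarrow> v < n \<longrightarrow>
     W \<subseteq> {w. w < n \<and> p w \<noteq> p v} \<longrightarrow> c / 4 * real n \<le> real (card W) \<longrightarrow>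
     \<gamma> * real n ^ card V \<le> real (card (through n p v W)) * real n"
    by blast
  have K: "0 < K" by (rule K_const_pos)
  have S: "0 < real s" using s_pos by simp
  \<comment> \<open>The tolerances of the two preceding results fix \<delta>; \<theta> is small
    against \<open>c\<close> and \<gamma>, and \<eta> against \<theta> and \<delta>. Only then is
    stability invoked for the extremal graph.\<close>
  define \<delta> where "\<delta> = min \<delta>1 \<delta>2"
  define \<theta> where "\<theta> = min (min 1 (c / 8)) (\<gamma> / (16 * real s * K))"
  define \<eta> where "\<eta> = min (\<theta> / (8 * (real k + 1))) (\<delta> / (4 * K))"
  have \<delta>: "0 < \<delta>" "\<delta> \<le> \<delta>1" "\<delta> \<le> \<delta>2" using \<delta>1 \<delta>2 by (auto simp: \<delta>_def)
  have \<theta>: "0 < \<theta>" using c \<gamma> K S by (simp add: \<theta>_def)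
  have \<theta>_le: "\<theta> \<le> 1" "\<theta> \<le> c / 8" by (auto simp: \<theta>_def)
  have "\<theta> \<le> \<gamma> / (16 * real s * K)" by (simp add: \<theta>_def)
  then have \<theta>\<gamma>: "16 * real s * K * \<theta> \<le> \<gamma>" using K S by (simp add: field_simps)
  have \<eta>: "0 < \<eta>" using \<theta> \<delta> K by (simp add: \<eta>_def)
  have "\<eta> \<le> \<theta> / (8 * (real k + 1))" by (simp add: \<eta>_def)
  then have \<eta>\<theta>: "8 * (real k + 1) * \<eta> \<le> \<theta>" by (simp add: field_simps)
  have "\<eta> \<le> \<delta> / (4 * K)" by (simp add: \<eta>_def)
  then have \<eta>\<delta>: "4 * K * \<eta> \<le> \<delta>" using K by (simp add: field_simps)
  have "1 * \<eta> \<le> 8 * (real k + 1) * \<eta>" using \<eta> by (intro mult_right_mono) auto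
  then have \<eta>1: "\<eta> \<le> 1" using \<eta>\<theta> \<theta>_le(1) by linarith
  have "0 < \<eta> ^ 2 / 2" using \<eta> by simp
  from stability[OF this] obtain \<delta>3 where \<delta>3: "\<delta>3 > 0" and
    ev3: "\<forall>\<^sub>F n in sequentially. \<forall>E. E \<subseteq> all_pairs n \<longrightarrow> Free n E \<longrightarrow> near n \<delta>3 E \<longrightarrow>
      (\<exists>p. (\<forall>v<n. p v < r) \<and> real (card ((E - mp n p) \<union> (mp n p - E))) \<le> \<eta> ^ 2 / 2 * real n ^ 2)"
    by blast
  have \<theta>8: "0 < \<theta> / 8" using \<theta> by simp
  show ?thesis
    using ev1 ev2 ev3 eventually_gt_at_top[of 0] eventually_linear[OF \<eta>, of 1]
      eventually_linear[OF \<theta>8, of "real k + 1 + 2 * real s"]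
  proof eventually_elim
    case (elim n)
    obtain G where G: "G \<subseteq> all_pairs n" "Free n G" "count n G = real (ex_emb V H Free n)"
      using ex_attained by blast
    have "0 \<le> \<delta>3 * real n ^ card V" using \<delta>3 by simp
    then have "near n \<delta>3 G" using G(3) by linarith
    then obtain p where p: "\<forall>v<n. p v < r"
      and D: "real (card ((G - mp n p) \<union> (mp n p - G))) \<le> \<eta> ^ 2 / 2 * real n ^ 2"
      using elim(3) G by blast
    have "finite ((G - mp n p) \<union> (mp n p - G))"
      by (rule finite_subset[OF _ finite_all_pairs]) (use G(1) join_mp_subset in blast)
    then have "card (G - mp n p) \<le> card ((G - mp n p) \<union> (mp n p - G))" by (intro card_mono) auto
    then have "real (card (G - mp n p)) \<le> \<eta> ^ 2 / 2 * real n ^ 2" using D by linarith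
    then have "count n G \<le> count n (mp n p) + K * (\<eta> ^ 2 / 2) * real n ^ card V"
      using emb_diff_bound[OF finite_V G(1) elim(4)] by blast
    \<comment> \<open>The classes of \<open>p\<close> are known to be large only once
      \<open>mp n p\<close> itself is near-extremal.\<close>
    moreover have "K * (\<eta> ^ 2 / 2) \<le> \<delta>1"
    proof -
      have "\<eta> ^ 2 / 2 \<le> \<eta>" using \<eta> \<eta>1 by (simp add: power2_eq_square)
      then have "K * (\<eta> ^ 2 / 2) \<le> K * \<eta>" using K by (intro mult_left_mono) auto
      moreover have "0 < K * \<eta>" using K \<eta> by simp
      ultimately show ?thesis using \<eta>\<delta> \<delta> by linarith
    qed
    then have "K * (\<eta> ^ 2 / 2) * real n ^ card V \<le> \<delta>1 * real n ^ card V" by (rule mult_right_mono) simp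
    ultimately have near: "near n \<delta>1 (mp n p)" using G(3) by linarith
    interpret extremal_graph V H r s k Free n G p c \<theta> \<eta> \<delta> \<gamma>
    proof unfold_locales
      show "0 < n" by fact
      show "G \<subseteq> all_pairs n" "Free n G" "count n G = real (ex_emb V H Free n)" by fact+
      show "p v < r" if "v < n" for v using p that by blast
      show "real (card ((G - mp n p) \<union> (mp n p - G))) \<le> \<eta> ^ 2 / 2 * real n ^ 2" by fact
      show "c * real n \<le> real (card (cls n p i))" if "i < r" for i using elim(1) p near that by blast
      show "0 < \<eta>" "\<theta> \<le> 1" "\<theta> \<le> c / 8" "8 * (real k + 1) * \<eta> \<le> \<theta>" by fact+
      show "real k + 1 + 2 * real s \<le> \<theta> / 8 * real n" "1 \<le> \<eta> * real n" by fact+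
      show "0 < \<gamma>" "16 * real s * K * \<theta> \<le> \<gamma>" "4 * K * \<eta> \<le> \<delta>" by fact+
      show "\<gamma> * real n ^ card V \<le> real (card (through n q v W)) * real n"
        if "\<And>v. v < n \<Longrightarrow> q v < r" "near n \<delta> (mp n q)" "v < n"
          "W \<subseteq> {w. w < n \<and> q w \<noteq> q v}" "c / 4 * real n \<le> real (card W)" for q v W
      proof -
        have "\<delta> * real n ^ card V \<le> \<delta>2 * real n ^ card V" using \<delta>(3) by (rule mult_right_mono) simp
        then have "near n \<delta>2 (mp n q)" using that(2) by linarith
        then show ?thesis using elim(2) that(1,3,4,5) by blast
      qed
    qed
    show ?case
      using B_sub card_B p'_less class_nonempty count_J
      by (intro exI[of _ B] exI[of _ p']) simp
  qed
qed

end

section \<open>Copies and injective homomorphisms\<close>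

lemma wf_graph_edge:
  assumes "wf_graph G" "{u, v} \<in> snd G"
  shows "u \<in> fst G" "v \<in> fst G" "u \<noteq> v"
proof -
  obtain a b where "a \<noteq> b" "{u, v} = {a, b}" "a \<in> fst G" "b \<in> fst G"
    using assms unfolding wf_graph_def by blast
  then show "u \<in> fst G" "v \<in> fst G" "u \<noteq> v" by (auto simp: doubleton_eq_iff)
qed

lemma wf_graph_edgeE:
  assumes "wf_graph G" "e \<in> snd G"
  obtains u v where "e = {u, v}" "u \<noteq> v" "u \<in> fst G" "v \<in> fst G"
  using assms unfolding wf_graph_def by blast

lemma wf_graph_finite: "wf_graph G \<Longrightarrow> finite (fst G)"
  unfolding wf_graph_def by simp

lemma wf_graph_interval: "wf_graph ({0..<n}, E) \<longleftrightarrow> E \<subseteq> all_pairs n"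
proof
  assume "wf_graph ({0..<n}, E)"
  then show "E \<subseteq> all_pairs n" unfolding wf_graph_def all_pairs_def by fastforce
next
  assume E: "E \<subseteq> all_pairs n"
  have "\<exists>u v. u \<noteq> v \<and> e = {u, v} \<and> u \<in> {0..<n} \<and> v \<in> {0..<n}" if "e \<in> E" for e
  proof -
    have "e \<in> all_pairs n" using E that by blast
    then obtain u v where "e = {u, v}" "u < n" "v < n" "u \<noteq> v" by (rule all_pairsE)
    then show ?thesis by (intro exI[of _ u] exI[of _ v]) simp
  qed
  then show "wf_graph ({0..<n}, E)" unfolding wf_graph_def by simp
qed

definition embeds :: "'b ugraph \<Rightarrow> 'a ugraph \<Rightarrow> bool" where
  "embeds F G \<longleftrightarrow> (\<exists>g. inj_on g (fst F) \<and> g ` fst F \<subseteq> fst G \<and>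
     (\<forall>u\<in>fst F. \<forall>v\<in>fst F. {u, v} \<in> snd F \<longrightarrow> {g u, g v} \<in> snd G))"

lemma embedsE:
  assumes "embeds F G"
  obtains g where "inj_on g (fst F)" "\<forall>v\<in>fst F. g v \<in> fst G"
    "\<forall>u\<in>fst F. \<forall>v\<in>fst F. {u, v} \<in> snd F \<longrightarrow> {g u, g v} \<in> snd G"
  using assms unfolding embeds_def image_subset_iff by (elim exE conjE)

lemma F_free_iff:
  assumes F: "wf_graph F"
  shows "F_free F G \<longleftrightarrow> \<not> embeds F G"
proof -
  have "embeds F G" if S: "subgraph S G" "graph_iso S F" for S
  proof -
    obtain f where f: "bij_betw f (fst S) (fst F)"
      "\<And>u v. u \<in> fst S \<Longrightarrow> v \<in> fst S \<Longrightarrow> {u, v} \<in> snd S \<longleftrightarrow> {f u, f v} \<in> snd F"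
      using S(2) unfolding graph_iso_def by blast
    let ?g = "inv_into (fst S) f"
    have g: "bij_betw ?g (fst F) (fst S)" using f(1) by (rule bij_betw_inv_into)
    have gS: "?g u \<in> fst S" "f (?g u) = u" if "u \<in> fst F" for u
      using that g f(1) by (auto simp: bij_betw_def f_inv_into_f inv_into_into)
    have "{?g u, ?g v} \<in> snd G" if "u \<in> fst F" "v \<in> fst F" "{u, v} \<in> snd F" for u v
    proof -
      have "{?g u, ?g v} \<in> snd S" using f(2)[of "?g u" "?g v"] gS that by simp
      then show ?thesis using \<open>subgraph S G\<close> unfolding subgraph_def by blast
    qed
    moreover have "?g ` fst F \<subseteq> fst G" using gS \<open>subgraph S G\<close> unfolding subgraph_def by blast
    ultimately show ?thesis using bij_betw_imp_inj_on[OF g] unfolding embeds_def by blast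
  qed
  moreover have "\<exists>S. subgraph S G \<and> graph_iso S F" if em: "embeds F G"
  proof -
    obtain g where g: "inj_on g (fst F)" "\<forall>v\<in>fst F. g v \<in> fst G"
      "\<forall>u\<in>fst F. \<forall>v\<in>fst F. {u, v} \<in> snd F \<longrightarrow> {g u, g v} \<in> snd G"
      using em by (rule embedsE)
    let ?S = "(g ` fst F, {{g u, g v} | u v. {u, v} \<in> snd F})"
    have "subgraph ?S G"
      unfolding subgraph_def using g wf_graph_edge[OF F] by fastforce
    moreover have "graph_iso ?S F"
      unfolding graph_iso_def
    proof (intro exI[of _ "inv_into (fst F) g"] conjI ballI)
      show "bij_betw (inv_into (fst F) g) (fst ?S) (fst F)"
        using g(1) by (simp add: bij_betw_inv_into inj_on_imp_bij_betw)
      fix a b assume "a \<in> fst ?S" "b \<in> fst ?S"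
      then obtain u v where uv: "a = g u" "b = g v" "u \<in> fst F" "v \<in> fst F" by auto
      have "{g u, g v} \<in> snd ?S \<longleftrightarrow> {u, v} \<in> snd F"
      proof
        assume "{g u, g v} \<in> snd ?S"
        then obtain u' v' where e: "{g u, g v} = {g u', g v'}" "{u', v'} \<in> snd F" by auto
        then have "u' \<in> fst F" "v' \<in> fst F" using wf_graph_edge[OF F] by blast+
        then have "{u, v} = {u', v'}" using e(1) uv g(1) by (auto simp: doubleton_eq_iff inj_on_eq_iff)
        then show "{u, v} \<in> snd F" using e(2) by simp
      qed auto
      then show "{a, b} \<in> snd ?S \<longleftrightarrow> {inv_into (fst F) g a, inv_into (fst F) g b} \<in> snd F"
        using uv g(1) by simp
    qed
    ultimately show ?thesis by blast
  qed
  ultimately show ?thesis unfolding F_free_def by blast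
qed

definition automorphisms :: "'c ugraph \<Rightarrow> ('c \<Rightarrow> 'c) set" where
  "automorphisms H = {\<sigma> \<in> fst H \<rightarrow>\<^sub>E fst H. bij_betw \<sigma> (fst H) (fst H) \<and>
     (\<forall>x\<in>fst H. \<forall>y\<in>fst H. {x, y} \<in> snd H \<longleftrightarrow> {\<sigma> x, \<sigma> y} \<in> snd H)}"

lemma card_automorphisms_pos:
  assumes "finite (fst H)"
  shows "0 < card (automorphisms H)"
proof -
  have "restrict id (fst H) \<in> automorphisms H"
    unfolding automorphisms_def by (auto simp: bij_betw_def inj_on_def)
  moreover have "finite (automorphisms H)"
    by (rule finite_subset[of _ "fst H \<rightarrow>\<^sub>E fst H"]) (use assms in \<open>auto simp: automorphisms_def intro: finite_PiE\<close>)
  ultimately show ?thesis by (auto simp: card_gt_0_iff)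
qed

text \<open>Embeddings are grouped by the copy that is their image. The isomorphisms from
  \<open>H\<close> onto one copy correspond to automorphisms of \<open>H\<close>, by composition
  with a fixed isomorphism back to \<open>H\<close>.\<close>

lemma card_emb_eq:
  fixes H :: "'c ugraph"
  assumes H: "wf_graph H" and E: "E \<subseteq> all_pairs n"
  shows "card (emb (fst H) (snd H) n E) = card (automorphisms H) * count_sub H ({0..<n}, E)"
proof -
  let ?V = "fst H"
  let ?G = "({0..<n}, E)"
  define copies where "copies = {S. subgraph S ?G \<and> graph_iso S H}"
  define isos where "isos = (\<lambda>S :: nat ugraph. {f \<in> ?V \<rightarrow>\<^sub>E {..<n}. bij_betw f ?V (fst S) \<and>
     (\<forall>x\<in>?V. \<forall>y\<in>?V. {x, y} \<in> snd H \<longleftrightarrow> {f x, f y} \<in> snd S)})"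
  have V: "finite ?V" using H by (rule wf_graph_finite)
  have fin_isos: "finite (isos S)" for S
    by (rule finite_subset[of _ "?V \<rightarrow>\<^sub>E {..<n}"]) (use V in \<open>auto simp: isos_def\<close>)
  have fin_copies: "finite copies"
  proof (rule finite_subset)
    show "copies \<subseteq> Pow {0..<n} \<times> Pow (all_pairs n)"
      using E unfolding copies_def subgraph_def by auto
  qed simp
  \<comment> \<open>A map determines its image copy, so the groups are disjoint.\<close>
  have det: "S = (f ` ?V, {{f x, f y} | x y. {x, y} \<in> snd H})" if S: "S \<in> copies" and f: "f \<in> isos S" for S f
  proof -
    have bij: "bij_betw f ?V (fst S)" and
      iff: "\<And>x y. x \<in> ?V \<Longrightarrow> y \<in> ?V \<Longrightarrow> {x, y} \<in> snd H \<longleftrightarrow> {f x, f y} \<in> snd S"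
      using f unfolding isos_def by auto
    have 1: "fst S = f ` ?V" using bij by (simp add: bij_betw_def)
    have "snd S \<subseteq> {{f x, f y} | x y. {x, y} \<in> snd H}"
    proof
      fix e assume e: "e \<in> snd S"
      then have "e \<in> all_pairs n" "e \<subseteq> fst S" using S E unfolding copies_def subgraph_def by auto
      then obtain a b where ab: "e = {a, b}" "a \<in> fst S" "b \<in> fst S" by (elim all_pairsE) auto
      then obtain x y where "a = f x" "b = f y" "x \<in> ?V" "y \<in> ?V" using 1 by blast
      then show "e \<in> {{f x, f y} | x y. {x, y} \<in> snd H}" using iff e ab(1) by blast
    qed
    moreover have "{{f x, f y} | x y. {x, y} \<in> snd H} \<subseteq> snd S"
      using iff wf_graph_edge[OF H] by blast
    ultimately show ?thesis using 1 by (simp add: prod_eq_iff)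
  qed
  have "emb ?V (snd H) n E = (\<Union>S\<in>copies. isos S)"
  proof
    show "emb ?V (snd H) n E \<subseteq> (\<Union>S\<in>copies. isos S)"
    proof
      fix f assume f: "f \<in> emb ?V (snd H) n E"
      let ?S = "(f ` ?V, {{f x, f y} | x y. {x, y} \<in> snd H})"
      have inj: "inj_on f ?V" and fn: "f \<in> ?V \<rightarrow>\<^sub>E {..<n}"
        and fe: "\<And>x y. x \<in> ?V \<Longrightarrow> y \<in> ?V \<Longrightarrow> {x, y} \<in> snd H \<Longrightarrow> {f x, f y} \<in> E"
        using f unfolding emb_def by auto
      have iff: "{x, y} \<in> snd H \<longleftrightarrow> {f x, f y} \<in> snd ?S" if xy: "x \<in> ?V" "y \<in> ?V" for x y
      proof
        assume "{f x, f y} \<in> snd ?S"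
        then obtain u v where e: "{f x, f y} = {f u, f v}" "{u, v} \<in> snd H" by auto
        then have "u \<in> ?V" "v \<in> ?V" using wf_graph_edge[OF H] by blast+
        then have "{x, y} = {u, v}" using e(1) xy inj by (auto simp: doubleton_eq_iff inj_on_eq_iff)
        then show "{x, y} \<in> snd H" using e(2) by simp
      qed auto
      have bij: "bij_betw f ?V (fst ?S)" using inj by (simp add: inj_on_imp_bij_betw)
      have "f \<in> isos ?S" using fn bij iff unfolding isos_def by blast
      moreover have "subgraph ?S ?G"
        using fn fe wf_graph_edge[OF H] unfolding subgraph_def by fastforce
      moreover have "graph_iso ?S H"
        unfolding graph_iso_def
      proof (intro exI[of _ "inv_into ?V f"] conjI ballI)
        show "bij_betw (inv_into ?V f) (fst ?S) ?V" using bij by (rule bij_betw_inv_into)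
        fix a b assume "a \<in> fst ?S" "b \<in> fst ?S"
        then obtain x y where "a = f x" "b = f y" "x \<in> ?V" "y \<in> ?V" by auto
        then show "{a, b} \<in> snd ?S \<longleftrightarrow> {inv_into ?V f a, inv_into ?V f b} \<in> snd H"
          using iff[of x y] inj by simp
      qed
      ultimately show "f \<in> (\<Union>S\<in>copies. isos S)" unfolding copies_def by blast
    qed
    show "(\<Union>S\<in>copies. isos S) \<subseteq> emb ?V (snd H) n E"
      unfolding copies_def isos_def emb_def subgraph_def by (auto simp: bij_betw_def)
  qed
  then have "card (emb ?V (snd H) n E) = (\<Sum>S\<in>copies. card (isos S))"
  proof -
    have "isos S \<inter> isos S' = {}" if "S \<in> copies" "S' \<in> copies" "S \<noteq> S'" for S S'
      using det that by blast
    then show ?thesis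
      using fin_copies fin_isos \<open>emb ?V (snd H) n E = (\<Union>S\<in>copies. isos S)\<close>
      by (simp add: card_UN_disjoint)
  qed
  also have "\<dots> = (\<Sum>S\<in>copies. card (automorphisms H))"
  proof (rule sum.cong[OF refl])
    fix S assume S: "S \<in> copies"
    obtain h where h: "bij_betw h (fst S) ?V"
      "\<And>u v. u \<in> fst S \<Longrightarrow> v \<in> fst S \<Longrightarrow> {u, v} \<in> snd S \<longleftrightarrow> {h u, h v} \<in> snd H"
      using S unfolding copies_def graph_iso_def by blast
    have Sn: "fst S \<subseteq> {..<n}" using S unfolding copies_def subgraph_def by auto
    have "bij_betw (\<lambda>f. restrict (h \<circ> f) ?V) (isos S) (automorphisms H)"
    proof (rule bij_betw_byWitness[where f' = "\<lambda>\<sigma>. restrict (inv_into (fst S) h \<circ> \<sigma>) ?V"])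
      let ?k = "inv_into (fst S) h"
      have k: "bij_betw ?k ?V (fst S)" using h(1) by (rule bij_betw_inv_into)
      have hk: "h (?k x) = x" if "x \<in> ?V" for x using h(1) that by (rule bij_betw_inv_into_right)
      have kh: "?k (h x) = x" if "x \<in> fst S" for x using h(1) that by (rule bij_betw_inv_into_left)
      have kS: "?k x \<in> fst S" if "x \<in> ?V" for x using k that by (auto simp: bij_betw_def)
      have fS: "f x \<in> fst S" if "f \<in> isos S" "x \<in> ?V" for f x
        using that unfolding isos_def bij_betw_def by auto
      have \<sigma>V: "\<sigma> x \<in> ?V" if "\<sigma> \<in> automorphisms H" "x \<in> ?V" for \<sigma> x
        using that unfolding automorphisms_def by auto
      show "\<forall>f\<in>isos S. restrict (?k \<circ> restrict (h \<circ> f) ?V) ?V = f"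
      proof
        fix f assume f: "f \<in> isos S"
        then have "f \<in> extensional ?V" unfolding isos_def PiE_def by blast
        then show "restrict (?k \<circ> restrict (h \<circ> f) ?V) ?V = f"
          using kh fS[OF f] by (auto intro!: extensionalityI[of _ ?V])
      qed
      show "\<forall>\<sigma>\<in>automorphisms H. restrict (h \<circ> restrict (?k \<circ> \<sigma>) ?V) ?V = \<sigma>"
      proof
        fix \<sigma> assume \<sigma>: "\<sigma> \<in> automorphisms H"
        then have "\<sigma> \<in> extensional ?V" unfolding automorphisms_def PiE_def by blast
        then show "restrict (h \<circ> restrict (?k \<circ> \<sigma>) ?V) ?V = \<sigma>"
          using hk \<sigma>V[OF \<sigma>] by (auto intro!: extensionalityI[of _ ?V])
      qed
      show "(\<lambda>f. restrict (h \<circ> f) ?V) ` isos S \<subseteq> automorphisms H"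
      proof (rule image_subsetI)
        fix f assume f: "f \<in> isos S"
        then have bij: "bij_betw f ?V (fst S)" and
          iff: "\<And>x y. x \<in> ?V \<Longrightarrow> y \<in> ?V \<Longrightarrow> {x, y} \<in> snd H \<longleftrightarrow> {f x, f y} \<in> snd S"
          unfolding isos_def by auto
        have b: "bij_betw (restrict (h \<circ> f) ?V) ?V ?V"
          using bij_betw_trans[OF bij h(1)] by (simp cong: bij_betw_cong)
        moreover have "restrict (h \<circ> f) ?V \<in> ?V \<rightarrow>\<^sub>E ?V"
          using bij_betw_imp_funcset[OF b] by (auto simp: PiE_def)
        moreover have "{x, y} \<in> snd H \<longleftrightarrow> {restrict (h \<circ> f) ?V x, restrict (h \<circ> f) ?V y} \<in> snd H"
          if "x \<in> ?V" "y \<in> ?V" for x y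
          using iff[OF that] h(2)[OF fS[OF f that(1)] fS[OF f that(2)]] that by simp
        ultimately show "restrict (h \<circ> f) ?V \<in> automorphisms H"
          unfolding automorphisms_def by blast
      qed
      show "(\<lambda>\<sigma>. restrict (?k \<circ> \<sigma>) ?V) ` automorphisms H \<subseteq> isos S"
      proof (rule image_subsetI)
        fix \<sigma> assume \<sigma>: "\<sigma> \<in> automorphisms H"
        then have bij: "bij_betw \<sigma> ?V ?V" and
          iff: "\<And>x y. x \<in> ?V \<Longrightarrow> y \<in> ?V \<Longrightarrow> {x, y} \<in> snd H \<longleftrightarrow> {\<sigma> x, \<sigma> y} \<in> snd H"
          unfolding automorphisms_def by auto
        have b: "bij_betw (restrict (?k \<circ> \<sigma>) ?V) ?V (fst S)"
          using bij_betw_trans[OF bij k] by (simp cong: bij_betw_cong)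
        moreover have "restrict (?k \<circ> \<sigma>) ?V \<in> ?V \<rightarrow>\<^sub>E {..<n}"
          using bij_betw_imp_funcset[OF b] Sn by (auto simp: PiE_def)
        moreover have "{x, y} \<in> snd H \<longleftrightarrow> {restrict (?k \<circ> \<sigma>) ?V x, restrict (?k \<circ> \<sigma>) ?V y} \<in> snd S"
          if "x \<in> ?V" "y \<in> ?V" for x y
          using iff[OF that] h(2)[OF kS[OF \<sigma>V[OF \<sigma> that(1)]] kS[OF \<sigma>V[OF \<sigma> that(2)]]]
            hk[OF \<sigma>V[OF \<sigma> that(1)]] hk[OF \<sigma>V[OF \<sigma> that(2)]] that by simp
        ultimately show "restrict (?k \<circ> \<sigma>) ?V \<in> isos S"
          unfolding isos_def by blast
      qed
    qed
    then show "card (isos S) = card (automorphisms H)" by (rule bij_betw_same_card)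
  qed
  also have "\<dots> = card (automorphisms H) * card copies" by simp
  finally show ?thesis unfolding count_sub_def copies_def .
qed

section \<open>Forbidden graphs with color-critical components\<close>

lemma colorable_mono: "colorable G a \<Longrightarrow> a \<le> b \<Longrightarrow> colorable G b"
  unfolding colorable_def by (meson less_le_trans)

lemma colorable_finite:
  assumes "wf_graph G"
  shows "\<exists>k. colorable G k"
proof -
  obtain c :: "'a \<Rightarrow> nat" and k where c: "c ` fst G = {i. i < k}" "inj_on c (fst G)"
    using finite_imp_inj_to_nat_seg[OF wf_graph_finite[OF assms]] by blast
  have "c v < k" if "v \<in> fst G" for v using c(1) that by blast
  moreover have "c u \<noteq> c v" if "{u, v} \<in> snd G" for u v
    using c(2) wf_graph_edge[OF assms that] by (simp add: inj_on_eq_iff)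
  ultimately show ?thesis unfolding colorable_def by blast
qed

lemma colorable_iff_chi:
  assumes "wf_graph G"
  shows "colorable G k \<longleftrightarrow> chi G \<le> k"
proof
  assume "colorable G k"
  then show "chi G \<le> k" unfolding chi_def by (rule Least_le)
next
  have "colorable G (chi G)"
    unfolding chi_def using colorable_finite[OF assms] by (metis LeastI)
  then show "chi G \<le> k \<Longrightarrow> colorable G k" using colorable_mono by blast
qed

text \<open>An \<open>r\<close>-coloring of the graph without \<open>e\<close> must give both ends
  of \<open>e\<close> the same color, or it would be proper for the whole graph. Swapping that color
  with \<open>i\<close> makes it the prescribed one.\<close>

lemma critical_coloring:
  assumes G: "wf_graph G" and chi: "chi G = r + 1" and crit: "color_critical_edge G e" and i: "i < r"
  obtains x y c where "x \<noteq> y" "x \<in> fst G" "y \<in> fst G" "{x, y} \<in> snd G"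
    "\<And>v. v \<in> fst G \<Longrightarrow> c v < r" "c x = i" "c y = i"
    "\<And>u v. {u, v} \<in> snd G \<Longrightarrow> {u, v} \<noteq> {x, y} \<Longrightarrow> c u \<noteq> (c v :: nat)"
proof -
  have e: "e \<in> snd G" "chi (fst G, snd G - {e}) < r + 1"
    using crit chi unfolding color_critical_edge_def by auto
  obtain x y where xy: "e = {x, y}" "x \<noteq> y" "x \<in> fst G" "y \<in> fst G"
    using e(1) by (rule wf_graph_edgeE[OF G])
  have "wf_graph (fst G, snd G - {e})" using G unfolding wf_graph_def by simp
  then have "colorable (fst G, snd G - {e}) r" using e(2) by (simp add: colorable_iff_chi)
  then obtain c where c: "\<And>v. v \<in> fst G \<Longrightarrow> c v < r"
    "\<And>u v. {u, v} \<in> snd G \<Longrightarrow> {u, v} \<noteq> e \<Longrightarrow> c u \<noteq> c v"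
    unfolding colorable_def by auto
  have same: "c x = c y"
  proof (rule ccontr)
    assume ne: "c x \<noteq> c y"
    have "c u \<noteq> c v" if "{u, v} \<in> snd G" for u v
    proof (cases "{u, v} = e")
      case True
      then show ?thesis using ne xy(1) by (auto simp: doubleton_eq_iff)
    next
      case False
      then show ?thesis using c(2) that by blast
    qed
    then have "colorable G r" unfolding colorable_def using c(1) by blast
    then show False using chi by (simp add: colorable_iff_chi[OF G])
  qed
  let ?t = "transpose i (c x)"
  have inj: "?t a = ?t b \<longleftrightarrow> a = b" for a b by (simp add: bij_is_inj inj_eq)
  have "?t (c v) < r" if "v \<in> fst G" for v
    using c(1)[OF that] c(1)[OF xy(3)] i by (auto simp: transpose_def)
  then show ?thesis
    using that[of x y "\<lambda>v. ?t (c v)"] xy e(1) same c(2) inj by auto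
qed

lemma adj_sym: "adj G u v \<longleftrightarrow> adj G v u"
  unfolding adj_def by (auto simp: insert_commute)

lemma adj_rtrancl_sym: "(adj G)\<^sup>*\<^sup>* u v \<Longrightarrow> (adj G)\<^sup>*\<^sup>* v u"
proof (induction rule: rtranclp_induct)
  case (step y z)
  then show ?case using adj_sym by (metis converse_rtranclp_into_rtranclp)
qed simp

definition comp_of :: "'a ugraph \<Rightarrow> 'a \<Rightarrow> 'a set" where
  "comp_of G v = {w \<in> fst G. (adj G)\<^sup>*\<^sup>* v w}"

lemma comp_of_in_comps: "v \<in> fst G \<Longrightarrow> comp_of G v \<in> comps G \<and> v \<in> comp_of G v"
  unfolding comps_def comp_of_def by auto

lemma comps_subset: "C \<in> comps G \<Longrightarrow> C \<subseteq> fst G"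
  unfolding comps_def by auto

lemma comp_of_eq:
  assumes "C \<in> comps G" "v \<in> C"
  shows "comp_of G v = C"
proof -
  obtain u where u: "u \<in> fst G" "C = {w \<in> fst G. (adj G)\<^sup>*\<^sup>* u w}"
    using assms(1) unfolding comps_def by blast
  have "(adj G)\<^sup>*\<^sup>* u v" using assms(2) u by simp
  then have "(adj G)\<^sup>*\<^sup>* u w \<longleftrightarrow> (adj G)\<^sup>*\<^sup>* v w" for w
    using adj_rtrancl_sym rtranclp_trans by metis
  then show ?thesis unfolding comp_of_def u(2) by simp
qed

lemma comp_of_edge:
  assumes "wf_graph G" "{u, v} \<in> snd G"
  shows "comp_of G u = comp_of G v"
proof -
  have uv: "u \<in> fst G" "v \<in> fst G" using wf_graph_edge[OF assms] by blast+
  then have "adj G u v" using assms(2) unfolding adj_def by blast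
  then have "v \<in> comp_of G u" using uv unfolding comp_of_def by blast
  then show ?thesis using comp_of_eq comp_of_in_comps uv by metis
qed

lemma wf_induced:
  assumes "wf_graph G" "C \<subseteq> fst G"
  shows "wf_graph (induced G C)"
proof -
  have "finite C" using assms wf_graph_finite finite_subset by blast
  moreover have "\<exists>u v. u \<noteq> v \<and> e = {u, v} \<and> u \<in> C \<and> v \<in> C" if e: "e \<in> snd G" "e \<subseteq> C" for e
  proof -
    obtain u v where "e = {u, v}" "u \<noteq> v" using wf_graph_edgeE[OF assms(1) e(1)] by metis
    then show ?thesis using e(2) by (intro exI[of _ u] exI[of _ v]) simp
  qed
  ultimately show ?thesis unfolding wf_graph_def induced_def by simp
qed

lemma colorable_induced:
  assumes "colorable G a" "C \<subseteq> fst G"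
  shows "colorable (induced G C) a"
proof -
  obtain c where "\<forall>v\<in>fst G. c v < a" "\<forall>u v. {u, v} \<in> snd G \<longrightarrow> c u \<noteq> (c v :: nat)"
    using assms(1) unfolding colorable_def by (elim exE conjE)
  then show ?thesis
    using assms(2) unfolding colorable_def induced_def by (intro exI[of _ c]) auto
qed

lemma induced_edge:
  assumes "wf_graph G" "{u, v} \<in> snd G"
  shows "{u, v} \<in> snd (induced G (comp_of G u))"
proof -
  have uv: "u \<in> fst G" "v \<in> fst G" using wf_graph_edge[OF assms] by blast+
  then have "u \<in> comp_of G u" "v \<in> comp_of G u"
    using comp_of_in_comps comp_of_edge[OF assms] by metis+
  then show ?thesis using assms(2) unfolding induced_def by simp
qed

section \<open>Greedy embedding\<close>

text \<open>\<open>S\<close> is embedded beforehand and its images need not be typical, so the lists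
  must consist of suitable neighbours of them. The vertices of \<open>Z\<close> are sent outside
  \<open>X\<close>, so each of them rules out at most \<open>t\<close> vertices of another class for
  the later ones.\<close>

lemma greedy_embedding:
  fixes f0 :: "'b \<Rightarrow> nat"
  assumes "finite Z" "finite S" "Z \<inter> S = {}" and loop: "\<And>u. {u} \<notin> EF"
    and base: "inj_on f0 S" "\<And>u v. u \<in> S \<Longrightarrow> v \<in> S \<Longrightarrow> {u, v} \<in> EF \<Longrightarrow> {f0 u, f0 v} \<in> E"
    and X: "finite X" "card X \<le> t"
    and typical: "\<And>v. v < n \<Longrightarrow> v \<notin> X \<Longrightarrow> card {w. w < n \<and> p w \<noteq> p v \<and> {v, w} \<notin> E} \<le> t"
    and Ls: "\<And>z. z \<in> Z \<Longrightarrow> Ls z \<subseteq> cls n p (col z)" "\<And>z. z \<in> Z \<Longrightarrow> (k + 1) * (t + 1) \<le> card (Ls z)"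
    and SZ: "\<And>z u w. z \<in> Z \<Longrightarrow> u \<in> S \<Longrightarrow> {u, z} \<in> EF \<Longrightarrow> w \<in> Ls z \<Longrightarrow> {f0 u, w} \<in> E"
    and ZZ: "\<And>z z'. z \<in> Z \<Longrightarrow> z' \<in> Z \<Longrightarrow> {z, z'} \<in> EF \<Longrightarrow> col z \<noteq> col z'"
    and k: "card S + card Z \<le> k"
  shows "\<exists>f. (\<forall>u\<in>S. f u = f0 u) \<and> inj_on f (S \<union> Z) \<and>
    (\<forall>u\<in>S \<union> Z. \<forall>v\<in>S \<union> Z. {u, v} \<in> EF \<longrightarrow> {f u, f v} \<in> E) \<and> (\<forall>z\<in>Z. f z \<in> Ls z - X)"
  using assms(1) assms(3) Ls SZ ZZ k
proof (induction Z rule: finite_induct)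
  case empty
  show ?case using base by (intro exI[of _ f0]) simp
next
  case (insert z Z)
  have "\<exists>f. (\<forall>u\<in>S. f u = f0 u) \<and> inj_on f (S \<union> Z) \<and>
    (\<forall>u\<in>S \<union> Z. \<forall>v\<in>S \<union> Z. {u, v} \<in> EF \<longrightarrow> {f u, f v} \<in> E) \<and> (\<forall>z\<in>Z. f z \<in> Ls z - X)"
  proof (rule insert.IH)
    show "Z \<inter> S = {}" using insert.prems(1) by blast
    show "card S + card Z \<le> k" using insert.prems(6) insert.hyps by simp
    show "Ls u \<subseteq> cls n p (col u)" if "u \<in> Z" for u using insert.prems(2)[of u] that by simp
    show "(k + 1) * (t + 1) \<le> card (Ls u)" if "u \<in> Z" for u using insert.prems(3)[of u] that by simp
    show "{f0 u, w} \<in> E" if "x \<in> Z" "u \<in> S" "{u, x} \<in> EF" "w \<in> Ls x" for x u w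
      using insert.prems(4)[of x u w] that by simp
    show "col x \<noteq> col y" if "x \<in> Z" "y \<in> Z" "{x, y} \<in> EF" for x y
      using insert.prems(5)[of x y] that by simp
  qed
  then obtain f where f': "\<forall>u\<in>S. f u = f0 u" "inj_on f (S \<union> Z)"
    "\<forall>u\<in>S \<union> Z. \<forall>v\<in>S \<union> Z. {u, v} \<in> EF \<longrightarrow> {f u, f v} \<in> E" "\<forall>z\<in>Z. f z \<in> Ls z - X"
    by (elim exE conjE)
  have f: "\<And>u. u \<in> S \<Longrightarrow> f u = f0 u" "inj_on f (S \<union> Z)"
    "\<And>u v. u \<in> S \<union> Z \<Longrightarrow> v \<in> S \<union> Z \<Longrightarrow> {u, v} \<in> EF \<Longrightarrow> {f u, f v} \<in> E"
    "\<And>u. u \<in> Z \<Longrightarrow> f u \<in> Ls u - X"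
    using f' by (simp, simp, blast, blast)
  have fn: "f u < n" "p (f u) = col u" if "u \<in> Z" for u
    using f(4)[OF that] insert.prems(2)[of u] that by auto
  let ?bad = "\<lambda>u. {w. w < n \<and> p w \<noteq> p (f u) \<and> {f u, w} \<notin> E}"
  \<comment> \<open>Excluded are at most \<open>t\<close> atypical vertices, at most
    \<open>k\<close> used ones, and up to \<open>t\<close> non-neighbours of each of at most
    \<open>k\<close> placed vertices. The list size is one more than the sum k t + k + t.\<close>
  let ?X = "X \<union> f ` (S \<union> Z) \<union> (\<Union>u\<in>Z. ?bad u)"
  have "card ?X \<le> card X + card (f ` (S \<union> Z)) + card (\<Union>u\<in>Z. ?bad u)"
    by (intro order_trans[OF card_Un_le] add_mono card_Un_le) auto
  moreover have "card (f ` (S \<union> Z)) \<le> card (S \<union> Z)"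
    using assms(2) insert.hyps(1) by (intro card_image_le) simp
  moreover have "card (S \<union> Z) \<le> card S + card Z" by (rule card_Un_le)
  moreover have "card (\<Union>u\<in>Z. ?bad u) \<le> card Z * t"
  proof -
    have "card (\<Union>u\<in>Z. ?bad u) \<le> (\<Sum>u\<in>Z. card (?bad u))" by (rule card_UN_le[OF insert.hyps(1)])
    also have "\<dots> \<le> (\<Sum>u\<in>Z. t)" by (rule sum_mono) (use typical fn f(4) in blast)
    finally show ?thesis by simp
  qed
  moreover have "card Z * t \<le> k * t" using insert.prems(6) insert.hyps by (intro mult_right_mono) auto
  moreover have "card S + card Z \<le> k" using insert.prems(6) insert.hyps by simp
  moreover have "(k + 1) * (t + 1) \<le> card (Ls z)" using insert.prems(3) by blast
  moreover have "(k + 1) * (t + 1) = k * t + k + t + 1" by simp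
  ultimately have lt: "card ?X < card (Ls z)" using X(2) by linarith
  have "finite ?X" using X(1) assms(2) insert.hyps(1) by auto
  then have "\<not> Ls z \<subseteq> ?X" using lt card_mono[of ?X "Ls z"] by linarith
  then obtain w where w: "w \<in> Ls z" "w \<notin> ?X" by blast
  have wn: "w < n" "p w = col z" using w(1) insert.prems(2)[of z] by auto
  let ?f = "f(z := w)"
  have zS: "z \<notin> S" using insert.prems(1) by blast
  have edge: "{w, ?f u} \<in> E" if u: "u \<in> S \<union> insert z Z" "{z, u} \<in> EF" for u
  proof -
    have "u \<noteq> z" using u(2) loop by auto
    then consider "u \<in> S" | "u \<in> Z" using u(1) by blast
    then show ?thesis
    proof cases
      case 1
      then have "{f0 u, w} \<in> E" using insert.prems(4)[of z u w] u(2) w(1) by (simp add: insert_commute)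
      then show ?thesis using 1 f(1) \<open>u \<noteq> z\<close> by (simp add: insert_commute)
    next
      case 2
      then have "col z \<noteq> col u" using insert.prems(5)[of z u] u(2) by simp
      then have "{f u, w} \<in> E" using w(2) wn fn[OF 2] 2 by auto
      then show ?thesis using \<open>u \<noteq> z\<close> by (simp add: insert_commute)
    qed
  qed
  show ?case
  proof (intro exI[of _ ?f] conjI ballI impI)
    show "?f u = f0 u" if "u \<in> S" for u using that zS f(1) by auto
    show "inj_on ?f (S \<union> insert z Z)"
    proof -
      have "inj_on ?f (S \<union> Z)" using f(2) zS insert.hyps(2) by (simp add: inj_on_def)
      moreover have "?f z \<notin> ?f ` ((S \<union> Z) - {z})" using w(2) by auto
      ultimately show ?thesis by simp
    qed
    show "{?f u, ?f v} \<in> E" if "u \<in> S \<union> insert z Z" "v \<in> S \<union> insert z Z" "{u, v} \<in> EF" for u v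
    proof (cases "u = z")
      case True
      then show ?thesis using edge[of v] that by simp
    next
      case False
      show ?thesis
      proof (cases "v = z")
        case True
        then show ?thesis using edge[of u] that False by (simp add: insert_commute)
      next
        case False
        then show ?thesis using f(3)[of u v] that \<open>u \<noteq> z\<close> by simp
      qed
    qed
    show "?f u \<in> Ls u - X" if "u \<in> insert z Z" for u using that f(4) w by auto
  qed
qed

section \<open>Host graphs with and without a copy of \<open>F\<close>\<close>

locale turan_forbidden =
  fixes F :: "'b ugraph" and r s :: nat
  assumes F: "wf_graph F" and r2: "2 \<le> r" and s1: "1 \<le> s"
    and bad_card: "card {C \<in> comps F. chi (induced F C) = r + 1} = s"
    and critical: "\<And>C. C \<in> comps F \<Longrightarrow> chi (induced F C) = r + 1 \<Longrightarrow>
      \<exists>e. color_critical_edge (induced F C) e"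
    and chi_le: "\<And>C. C \<in> comps F \<Longrightarrow> chi (induced F C) \<le> r + 1"
begin

definition "Bad = {C \<in> comps F. chi (induced F C) = r + 1}"

abbreviation "Co \<equiv> comp_of F"
abbreviation "k \<equiv> card (fst F)"

lemma Co: "v \<in> fst F \<Longrightarrow> Co v \<in> comps F" "v \<in> fst F \<Longrightarrow> v \<in> Co v"
  by (simp_all add: comp_of_in_comps)

lemma wf_comp: "C \<in> comps F \<Longrightarrow> wf_graph (induced F C)"
  using wf_induced[OF F comps_subset] by blast

lemma finite_F: "finite (fst F)"
  using F by (rule wf_graph_finite)

lemma card_Bad: "card Bad = s"
  unfolding Bad_def by (rule bad_card)

lemma finite_Bad: "finite Bad"
  using card_Bad s1 by (metis card.infinite not_one_le_zero)

text \<open>Proper colorings of the components combine, and a bad component needs r + 1 colors. This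
  identifies the number of parts in weak stability as \<open>r\<close>.\<close>

lemma chi_F: "chi F = r + 1"
proof (rule antisym)
  have "\<exists>c :: 'b \<Rightarrow> nat. (\<forall>v\<in>C. c v < r + 1) \<and> (\<forall>u v. {u, v} \<in> snd (induced F C) \<longrightarrow> c u \<noteq> c v)"
    if "C \<in> comps F" for C
  proof -
    have "colorable (induced F C) (r + 1)" using chi_le wf_comp that colorable_iff_chi by blast
    then show ?thesis unfolding colorable_def induced_def by simp
  qed
  then obtain c :: "'b set \<Rightarrow> 'b \<Rightarrow> nat" where c: "\<And>C v. C \<in> comps F \<Longrightarrow> v \<in> C \<Longrightarrow> c C v < r + 1"
    "\<And>C u v. C \<in> comps F \<Longrightarrow> {u, v} \<in> snd (induced F C) \<Longrightarrow> c C u \<noteq> c C v"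
    by metis
  have "colorable F (r + 1)"
    unfolding colorable_def
  proof (intro exI[of _ "\<lambda>v. c (Co v) v"] conjI ballI allI impI)
    show "c (Co v) v < r + 1" if "v \<in> fst F" for v using c(1) Co that by blast
    show "c (Co u) u \<noteq> c (Co v) v" if "{u, v} \<in> snd F" for u v
      using c(2)[OF _ induced_edge[OF F that]] Co(1) wf_graph_edge[OF F that] comp_of_edge[OF F that] by metis
  qed
  then show "chi F \<le> r + 1" using colorable_iff_chi[OF F] by blast
next
  have "Bad \<noteq> {}" using card_Bad s1 by auto
  then obtain C where C: "C \<in> comps F" "chi (induced F C) = r + 1" unfolding Bad_def by blast
  have "colorable F (chi F)" using colorable_iff_chi[OF F] by simp
  then have "colorable (induced F C) (chi F)"
    using comps_subset[OF C(1)] by (rule colorable_induced)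
  then show "r + 1 \<le> chi F" using C(2) colorable_iff_chi[OF wf_comp[OF C(1)]] by simp
qed

text \<open>A bad component whose image avoided \<open>B\<close> would be \<open>r\<close>-colored
  by \<open>p\<close>. So every bad component uses a vertex of \<open>B\<close>, and distinct
  components use distinct ones.\<close>

lemma free_join:
  assumes E: "E \<subseteq> join_mp n B p" and B: "B \<subseteq> {..<n}" "card B < s" and p: "\<And>v. v < n \<Longrightarrow> p v < r"
  shows "F_free F ({0..<n}, E)"
  unfolding F_free_iff[OF F]
proof
  assume "embeds F ({0..<n}, E)"
  then obtain g where g0: "inj_on g (fst F)" "\<forall>v\<in>fst F. g v \<in> fst ({0..<n}, E)"
    "\<forall>u\<in>fst F. \<forall>v\<in>fst F. {u, v} \<in> snd F \<longrightarrow> {g u, g v} \<in> snd ({0..<n}, E)"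
    by (rule embedsE)
  then have g: "inj_on g (fst F)" "\<forall>v\<in>fst F. g v < n"
    "\<forall>u\<in>fst F. \<forall>v\<in>fst F. {u, v} \<in> snd F \<longrightarrow> {g u, g v} \<in> E"
    by simp_all
  have "\<exists>v. v \<in> C \<and> g v \<in> B" if C: "C \<in> Bad" for C
  proof (rule ccontr)
    assume none: "\<not> ?thesis"
    have Cc: "C \<in> comps F" "chi (induced F C) = r + 1" using C unfolding Bad_def by auto
    note CF = comps_subset[OF Cc(1)]
    have "colorable (induced F C) r"
      unfolding colorable_def
    proof (intro exI[of _ "p \<circ> g"] conjI ballI allI impI)
      show "(p \<circ> g) v < r" if "v \<in> fst (induced F C)" for v
        using that CF g(2) p unfolding induced_def by auto
      show "(p \<circ> g) u \<noteq> (p \<circ> g) v" if "{u, v} \<in> snd (induced F C)" for u v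
      proof -
        have uv: "u \<in> C" "v \<in> C" "{u, v} \<in> snd F" using that unfolding induced_def by auto
        then have "{g u, g v} \<in> join_mp n B p" using g(3) CF E by blast
        then show ?thesis using none uv by auto
      qed
    qed
    then show False using Cc colorable_iff_chi[OF wf_comp[OF Cc(1)]] by simp
  qed
  then obtain h where h: "\<And>C. C \<in> Bad \<Longrightarrow> h C \<in> C \<and> g (h C) \<in> B" by metis
  have hF: "h C \<in> fst F" "Co (h C) = C" if "C \<in> Bad" for C
  proof -
    have C: "C \<in> comps F" "h C \<in> C" using h[OF that] that unfolding Bad_def by blast+
    show "h C \<in> fst F" using comps_subset[OF C(1)] C(2) by blast
    show "Co (h C) = C" by (rule comp_of_eq[OF C])
  qed
  have "inj_on (g \<circ> h) Bad"
  proof (rule inj_onI)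
    fix C C' assume CC: "C \<in> Bad" "C' \<in> Bad" "(g \<circ> h) C = (g \<circ> h) C'"
    then have "h C = h C'" using g(1) hF by (simp add: inj_on_eq_iff)
    then show "C = C'" using hF CC by metis
  qed
  moreover have "(g \<circ> h) ` Bad \<subseteq> B" using h by auto
  moreover have "finite B" using B(1) finite_subset by blast
  ultimately have "card Bad \<le> card B" by (rule card_inj_on_le)
  then show False using B(2) card_Bad by simp
qed

text \<open>At most \<open>k\<close> vertices of \<open>W\<close> occur in a copy. They have more
  than \<open>k\<close> common neighbours in \<open>E\<close>, one of which lies outside the copy
  and can take over the role of \<open>v\<close>.\<close>

lemma free_replace:
  assumes free: "F_free F ({0..<n}, E)" and v: "v < n" and W: "W \<subseteq> {..<n} - {v}"
    and common: "\<And>Q. Q \<subseteq> W \<Longrightarrow> card Q \<le> k \<Longrightarrow> k < card {u. u < n \<and> (\<forall>w\<in>Q. {u, w} \<in> E)}"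
  shows "F_free F ({0..<n}, {e \<in> E. v \<notin> e} \<union> star v W)"
  unfolding F_free_iff[OF F]
proof
  let ?E = "{e \<in> E. v \<notin> e} \<union> star v W"
  assume "embeds F ({0..<n}, ?E)"
  then obtain g where g0: "inj_on g (fst F)" "\<forall>x\<in>fst F. g x \<in> fst ({0..<n}, ?E)"
    "\<forall>x\<in>fst F. \<forall>y\<in>fst F. {x, y} \<in> snd F \<longrightarrow> {g x, g y} \<in> snd ({0..<n}, ?E)"
    by (rule embedsE)
  then have g: "inj_on g (fst F)" "\<forall>x\<in>fst F. g x < n"
    "\<forall>x\<in>fst F. \<forall>y\<in>fst F. {x, y} \<in> snd F \<longrightarrow> {g x, g y} \<in> ?E"
    by simp_all
  define Q where "Q = g ` fst F \<inter> W"
  have cQ: "card (g ` fst F) \<le> k" using finite_F by (rule card_image_le)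
  have "card Q \<le> card (g ` fst F)" unfolding Q_def using finite_F by (intro card_mono) auto
  then have "k < card {u. u < n \<and> (\<forall>w\<in>Q. {u, w} \<in> E)}" using cQ by (intro common) (auto simp: Q_def)
  then have "card (g ` fst F) < card {u. u < n \<and> (\<forall>w\<in>Q. {u, w} \<in> E)}" using cQ by linarith
  then have "\<not> {u. u < n \<and> (\<forall>w\<in>Q. {u, w} \<in> E)} \<subseteq> g ` fst F"
    using card_mono[of "g ` fst F" "{u. u < n \<and> (\<forall>w\<in>Q. {u, w} \<in> E)}"] finite_F by auto
  then obtain u where u: "u < n" "\<And>w. w \<in> Q \<Longrightarrow> {u, w} \<in> E" "u \<notin> g ` fst F" by blast
  let ?g = "\<lambda>x. if g x = v then u else g x"
  have "{?g x, ?g y} \<in> E" if xy: "x \<in> fst F" "y \<in> fst F" "{x, y} \<in> snd F" for x y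
  proof -
    have E: "{g x, g y} \<in> ?E" using g(3) xy by blast
    have ne: "g x \<noteq> g y" using wf_graph_edge[OF F xy(3)] g(1) by (simp add: inj_on_eq_iff)
    consider "g x = v" | "g y = v" | "g x \<noteq> v" "g y \<noteq> v" by blast
    then show ?thesis
    proof cases
      case 1
      then have "g y \<in> W" using E ne W by (auto simp: doubleton_eq_iff)
      then show ?thesis using u(2)[of "g y"] 1 ne xy unfolding Q_def by auto
    next
      case 2
      then have "g x \<in> W" using E ne W by (auto simp: doubleton_eq_iff)
      then show ?thesis using u(2)[of "g x"] 2 ne xy unfolding Q_def by (auto simp: insert_commute)
    next
      case 3
      then show ?thesis using E by (auto simp: doubleton_eq_iff)
    qed
  qed
  moreover have "inj_on ?g (fst F)"
  proof (rule inj_onI)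
    fix x y assume "x \<in> fst F" "y \<in> fst F" "?g x = ?g y"
    then show "x = y" using g(1) u(3) by (auto simp: inj_on_def split: if_splits)
  qed
  moreover have "?g ` fst F \<subseteq> {0..<n}" using g(2) u(1) by auto
  ultimately have "embeds F ({0..<n}, E)" unfolding embeds_def fst_conv snd_conv by blast
  then show False using free F_free_iff[OF F] by blast
qed

end

context turan_forbidden
begin

text \<open>\<open>x\<close>, \<open>y\<close> are the ends of a critical edge of the component
  \<open>C\<close>, \<open>a\<close>, \<open>b\<close> the ends of the host edge \<open>e\<close>,
  and \<open>c\<close> is an \<open>r\<close>-coloring that is proper except on the critical
  edge.\<close>

definition "critical_data C e E x y a b i c \<longleftrightarrow>
  e = {a, b} \<and> a \<noteq> b \<and> {a, b} \<in> E \<and> x \<noteq> y \<and> x \<in> C \<and> y \<in> C \<and> (\<forall>v\<in>C. c v < r) \<and>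
  c x = i \<and> c y = i \<and>
  (\<forall>u v. {u, v} \<in> snd (induced F C) \<longrightarrow> {u, v} \<noteq> {x, y} \<longrightarrow> c u \<noteq> (c v :: nat))"

text \<open>Each bad component sends its critical edge to its own rich edge; the remaining vertices are
  then placed greedily.\<close>

lemma not_free_rich:
  assumes E: "E \<subseteq> all_pairs n" and X: "X \<subseteq> {..<n}" "card X \<le> t"
    and typical: "\<And>v. v < n \<Longrightarrow> v \<notin> X \<Longrightarrow> card {w. w < n \<and> p w \<noteq> p v \<and> {v, w} \<notin> E} \<le> t"
    and large: "\<And>j. j < r \<Longrightarrow> (k + 1) * (t + 1) \<le> card (cls n p j)"
    and L: "L \<subseteq> E" "card L = s" "\<And>e e'. e \<in> L \<Longrightarrow> e' \<in> L \<Longrightarrow> e \<noteq> e' \<Longrightarrow> e \<inter> e' = {}"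
    and rich: "\<And>e. e \<in> L \<Longrightarrow> rich n p r E ((k + 1) * (t + 1)) e"
  shows "\<not> F_free F ({0..<n}, E)"
proof -
  let ?m = "(k + 1) * (t + 1)"
  have "finite L" using L(1) E finite_all_pairs by (meson finite_subset)
  then obtain \<mu> where \<mu>: "bij_betw \<mu> Bad L"
    using finite_same_card_bij[OF finite_Bad] card_Bad L(2) by metis
  have \<mu>L: "\<mu> C \<in> L" if "C \<in> Bad" for C using \<mu> that by (auto simp: bij_betw_def)
  have "\<forall>e\<in>L. \<exists>i<r. \<forall>j<r. j \<noteq> i \<longrightarrow> ?m \<le> card {w \<in> cls n p j. \<forall>u\<in>e. {u, w} \<in> E}"
    using rich unfolding rich_def by blast
  then obtain \<iota> where \<iota>: "\<forall>e\<in>L. \<iota> e < r \<and> (\<forall>j<r. j \<noteq> \<iota> e \<longrightarrow> ?m \<le> card {w \<in> cls n p j. \<forall>u\<in>e. {u, w} \<in> E})"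
    by (auto dest!: bchoice)
  let ?i = "\<lambda>C. \<iota> (\<mu> C)"
  have "\<exists>x y a b c. critical_data C (\<mu> C) E x y a b (?i C) c" if C: "C \<in> Bad" for C
  proof -
    have Cc: "C \<in> comps F" "chi (induced F C) = r + 1" using C unfolding Bad_def by auto
    obtain e where "color_critical_edge (induced F C) e" using critical Cc by blast
    moreover have "?i C < r" using \<iota> \<mu>L[OF C] by blast
    ultimately obtain x y c where xyc: "x \<noteq> y" "x \<in> fst (induced F C)" "y \<in> fst (induced F C)"
      "\<forall>v\<in>fst (induced F C). c v < r" "c x = ?i C" "c y = ?i C"
      "\<forall>u v. {u, v} \<in> snd (induced F C) \<longrightarrow> {u, v} \<noteq> {x, y} \<longrightarrow> c u \<noteq> (c v :: nat)"
      using critical_coloring[OF wf_comp[OF Cc(1)] Cc(2)] by metis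
    have \<mu>E: "\<mu> C \<in> E" using \<mu>L[OF C] L(1) by blast
    then have "\<mu> C \<in> all_pairs n" using E by blast
    then obtain a b where "\<mu> C = {a, b}" "a \<noteq> b" by (metis all_pairsE)
    then have "critical_data C (\<mu> C) E x y a b (?i C) c"
      unfolding critical_data_def using xyc \<mu>E by (simp add: induced_def)
    then show ?thesis by blast
  qed
  then obtain x y a b cb where
    data: "\<And>C. C \<in> Bad \<Longrightarrow> critical_data C (\<mu> C) E (x C) (y C) (a C) (b C) (?i C) (cb C)"
    by metis
  have "\<exists>c. (\<forall>v\<in>C. c v < r) \<and> (\<forall>u v. {u, v} \<in> snd (induced F C) \<longrightarrow> c u \<noteq> (c v :: nat))"
    if C: "C \<in> comps F" "C \<notin> Bad" for C
  proof -
    have "chi (induced F C) \<le> r" using chi_le[OF C(1)] C unfolding Bad_def by fastforce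
    then have "colorable (induced F C) r" using colorable_iff_chi[OF wf_comp[OF C(1)]] by blast
    then show ?thesis unfolding colorable_def induced_def by simp
  qed
  then obtain cg where cg: "\<And>C. C \<in> comps F \<Longrightarrow> C \<notin> Bad \<Longrightarrow> (\<forall>v\<in>C. cg C v < r) \<and>
      (\<forall>u v. {u, v} \<in> snd (induced F C) \<longrightarrow> cg C u \<noteq> (cg C v :: nat))"
    by metis
  define col where "col v = (if Co v \<in> Bad then cb (Co v) v else cg (Co v) v)" for v
  define S where "S = x ` Bad \<union> y ` Bad"
  define Z where "Z = fst F - S"
  define f0 where "f0 v = (if v = x (Co v) then a (Co v) else b (Co v))" for v
  \<comment> \<open>A vertex adjacent to an end of the critical edge, other than its ends, has a
    color different from that edge. So common neighbours of the host edge are required only for the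
    other colors; for the color of the edge the whole class serves.\<close>
  define Ls where "Ls v = (if Co v \<in> Bad \<and> col v \<noteq> ?i (Co v)
      then {w \<in> cls n p (col v). \<forall>u\<in>\<mu> (Co v). {u, w} \<in> E} else cls n p (col v))" for v
  have ab: "\<mu> C = {a C, b C}" "a C \<noteq> b C" "{a C, b C} \<in> E" "x C \<noteq> y C"
    and cbx: "cb C (x C) = ?i C" "cb C (y C) = ?i C" if "C \<in> Bad" for C
    using data[OF that] unfolding critical_data_def by blast+
  have Cxy: "x C \<in> fst F" "y C \<in> fst F" "Co (x C) = C" "Co (y C) = C" if C: "C \<in> Bad" for C
  proof -
    have Cc: "C \<in> comps F" using C unfolding Bad_def by blast
    have xy: "x C \<in> C" "y C \<in> C" using data[OF C] unfolding critical_data_def by blast+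
    show "x C \<in> fst F" "y C \<in> fst F" using xy comps_subset[OF Cc] by blast+
    show "Co (x C) = C" "Co (y C) = C" using xy comp_of_eq[OF Cc] by blast+
  qed
  have S_cases: "\<exists>C\<in>Bad. Co v = C \<and> (v = x C \<or> v = y C)" if "v \<in> S" for v
  proof -
    from that obtain C where "C \<in> Bad" "v = x C \<or> v = y C" unfolding S_def by blast
    then show ?thesis using Cxy(3,4)[of C] by (intro bexI[of _ C]) auto
  qed
  have S_sub: "S \<subseteq> fst F" using Cxy(1,2) unfolding S_def by auto
  have f0x: "f0 (x C) = a C" "f0 (y C) = b C" if "C \<in> Bad" for C
    using Cxy[OF that] ab[OF that] unfolding f0_def by auto
  \<comment> \<open>The only improper edges join the two ends of a chosen critical edge, and both of
    these lie in \<open>S\<close>.\<close>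
  have proper: "col u \<noteq> col v" if uv: "{u, v} \<in> snd F" "\<not> (u \<in> S \<and> v \<in> S)" for u v
  proof (cases "Co u \<in> Bad")
    case True
    have "{u, v} \<noteq> {x (Co u), y (Co u)}"
    proof
      assume "{u, v} = {x (Co u), y (Co u)}"
      then have "u \<in> S" "v \<in> S" using True unfolding S_def by (auto simp: doubleton_eq_iff)
      then show False using uv(2) by blast
    qed
    then have "cb (Co u) u \<noteq> cb (Co u) v"
      using data[OF True] induced_edge[OF F uv(1)] unfolding critical_data_def by blast
    then show ?thesis using True comp_of_edge[OF F uv(1)] unfolding col_def by simp
  next
    case False
    have "Co u \<in> comps F" using Co(1) wf_graph_edge(1)[OF F uv(1)] by blast
    then have "cg (Co u) u \<noteq> cg (Co u) v" using cg[OF _ False] induced_edge[OF F uv(1)] by blast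
    then show ?thesis using False comp_of_edge[OF F uv(1)] unfolding col_def by simp
  qed
  have col_less: "col v < r" if v: "v \<in> fst F" for v
  proof (cases "Co v \<in> Bad")
    case True
    then show ?thesis using data[OF True] Co(2)[OF v] unfolding critical_data_def col_def by simp
  next
    case False
    then show ?thesis using cg[OF Co(1)[OF v] False] Co(2)[OF v] unfolding col_def by simp
  qed
  have S_col: "Co u \<in> Bad" "col u = ?i (Co u)" "f0 u \<in> \<mu> (Co u)" if "u \<in> S" for u
  proof -
    from S_cases[OF \<open>u \<in> S\<close>] obtain C where C: "C \<in> Bad" "Co u = C" "u = x C \<or> u = y C" by blast
    show "Co u \<in> Bad" using C by simp
    have "cb C u = ?i C" using C(3) cbx[OF C(1)] by auto
    then show "col u = ?i (Co u)" using C(1,2) unfolding col_def by simp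
    have "f0 u \<in> \<mu> C" using C(3) f0x[OF C(1)] ab(1)[OF C(1)] by auto
    then show "f0 u \<in> \<mu> (Co u)" using C(2) by simp
  qed
  have "\<exists>f. (\<forall>u\<in>S. f u = f0 u) \<and> inj_on f (S \<union> Z) \<and>
    (\<forall>u\<in>S \<union> Z. \<forall>v\<in>S \<union> Z. {u, v} \<in> snd F \<longrightarrow> {f u, f v} \<in> E) \<and> (\<forall>z\<in>Z. f z \<in> Ls z - X)"
  proof (rule greedy_embedding[where col = col and t = t and k = k and n = n and p = p])
    show fin: "finite Z" "finite S" using S_sub finite_F finite_subset unfolding Z_def by blast+
    show disj: "Z \<inter> S = {}" unfolding Z_def by blast
    show "{u} \<notin> snd F" for u using wf_graph_edge(3)[OF F, of u u] by auto
    show "inj_on f0 S"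
    proof (rule inj_onI)
      fix u v assume uv: "u \<in> S" "v \<in> S" "f0 u = f0 v"
      have "\<mu> (Co u) \<inter> \<mu> (Co v) \<noteq> {}" using S_col(3)[OF uv(1)] S_col(3)[OF uv(2)] uv(3) by auto
      then have "\<mu> (Co u) = \<mu> (Co v)"
        using L(3)[OF \<mu>L[OF S_col(1)[OF uv(1)]] \<mu>L[OF S_col(1)[OF uv(2)]]] by blast
      then have eq: "Co u = Co v"
        by (rule inj_onD[OF bij_betw_imp_inj_on[OF \<mu>] _ S_col(1)[OF uv(1)] S_col(1)[OF uv(2)]])
      from S_cases[OF uv(1)] obtain C where C: "C \<in> Bad" "Co u = C" "u = x C \<or> u = y C" by blast
      have "v = x C \<or> v = y C" using S_cases[OF uv(2)] eq C(2) by auto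
      then show "u = v" using C(3) uv(3) f0x[OF C(1)] ab(2)[OF C(1)] by auto
    qed
    show "{f0 u, f0 v} \<in> E" if uv: "u \<in> S" "v \<in> S" "{u, v} \<in> snd F" for u v
    proof -
      from S_cases[OF uv(1)] obtain C where C: "C \<in> Bad" "Co u = C" "u = x C \<or> u = y C" by blast
      have "Co v = C" using comp_of_edge[OF F uv(3)] C(2) by simp
      then have "v = x C \<or> v = y C" using S_cases[OF uv(2)] by auto
      moreover have "u \<noteq> v" using wf_graph_edge(3)[OF F uv(3)] .
      ultimately show ?thesis using C(3) f0x[OF C(1)] ab(3)[OF C(1)] by (auto simp: insert_commute)
    qed
    show "finite X" using X(1) finite_subset by blast
    show "card X \<le> t" by fact
    show "card {w. w < n \<and> p w \<noteq> p v \<and> {v, w} \<notin> E} \<le> t" if "v < n" "v \<notin> X" for v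
      using typical that by blast
    show "Ls z \<subseteq> cls n p (col z)" for z unfolding Ls_def by auto
    show "?m \<le> card (Ls z)" if "z \<in> Z" for z
    proof -
      have "col z < r" using col_less that unfolding Z_def by blast
      then show ?thesis using \<iota> \<mu>L large unfolding Ls_def by simp
    qed
    show "{f0 u, w} \<in> E" if h: "z \<in> Z" "u \<in> S" "{u, z} \<in> snd F" "w \<in> Ls z" for z u w
    proof -
      have "Co z = Co u" using comp_of_edge[OF F h(3)] by simp
      moreover have "col u \<noteq> col z" using proper[OF h(3)] h(1) unfolding Z_def by blast
      ultimately have "w \<in> {w \<in> cls n p (col z). \<forall>u\<in>\<mu> (Co u). {u, w} \<in> E}"
        using h(4) S_col[OF h(2)] unfolding Ls_def by simp
      then show ?thesis using S_col(3)[OF h(2)] by blast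
    qed
    show "col z \<noteq> col z'" if "z \<in> Z" "z' \<in> Z" "{z, z'} \<in> snd F" for z z'
      using proper[OF that(3)] that(1) unfolding Z_def by blast
    have "S \<union> Z = fst F" using S_sub unfolding Z_def by blast
    then show "card S + card Z \<le> k" using card_Un_disjoint[OF fin(2,1)] disj by (simp add: Int_commute)
  qed
  then obtain f where f: "\<forall>u\<in>S. f u = f0 u" "inj_on f (S \<union> Z)"
    "\<forall>u\<in>S \<union> Z. \<forall>v\<in>S \<union> Z. {u, v} \<in> snd F \<longrightarrow> {f u, f v} \<in> E" "\<forall>z\<in>Z. f z \<in> Ls z - X"
    by (elim exE conjE)
  have SZ: "S \<union> Z = fst F" using S_sub unfolding Z_def by blast
  have "f u \<in> {0..<n}" if "u \<in> fst F" for u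
  proof (cases "u \<in> S")
    case True
    have "\<mu> (Co u) \<in> all_pairs n" using \<mu>L[OF S_col(1)[OF True]] L(1) E by blast
    then have "\<mu> (Co u) \<subseteq> {..<n}" by (auto elim: all_pairsE)
    then show ?thesis using S_col(3)[OF True] f(1) True by auto
  next
    case False
    then have "f u \<in> Ls u" using f(4) that unfolding Z_def by blast
    then show ?thesis unfolding Ls_def by (auto split: if_splits)
  qed
  then have "embeds F ({0..<n}, E)"
    unfolding embeds_def fst_conv snd_conv using f(2,3) SZ by (intro exI[of _ f]) auto
  then show ?thesis using F_free_iff[OF F] by blast
qed

end

section \<open>Transfer to numbers of copies and to partitions\<close>

text \<open>Multiplication by the number of automorphisms is monotone and so commutes with the
  maximum; the empty graph makes the set of candidates nonempty.\<close>

lemma ex_emb_eq: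
  fixes F :: "'b ugraph" and H :: "'c ugraph"
  assumes H: "wf_graph H" and free: "F_free F ({0..<n}, {})"
  shows "ex_emb (fst H) (snd H) (\<lambda>(n :: nat) E. F_free F ({0..<n}, E)) n = card (automorphisms H) * ex_gen n H F"
proof -
  let ?A = "{E. E \<subseteq> all_pairs n \<and> F_free F ({0..<n}, E)}"
  have fin: "finite ?A" by (rule finite_subset[of _ "Pow (all_pairs n)"]) auto
  have ne: "?A \<noteq> {}" using free by blast
  have "{count_sub H G | G :: nat ugraph. wf_graph G \<and> fst G = {0..<n} \<and> F_free F G}
      = (\<lambda>E. count_sub H ({0..<n}, E)) ` ?A"
  proof (intro equalityI subsetI)
    fix c assume "c \<in> {count_sub H G | G :: nat ugraph. wf_graph G \<and> fst G = {0..<n} \<and> F_free F G}"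
    then obtain G :: "nat ugraph" where G: "c = count_sub H G" "wf_graph G" "fst G = {0..<n}" "F_free F G"
      by blast
    then have eq: "G = ({0..<n}, snd G)" by (metis prod.collapse)
    then have "wf_graph ({0..<n}, snd G)" "F_free F ({0..<n}, snd G)" "c = count_sub H ({0..<n}, snd G)"
      using G by metis+
    then show "c \<in> (\<lambda>E. count_sub H ({0..<n}, E)) ` ?A" by (simp add: wf_graph_interval)
  next
    fix c assume "c \<in> (\<lambda>E. count_sub H ({0..<n}, E)) ` ?A"
    then obtain E where "c = count_sub H ({0..<n}, E)" "E \<subseteq> all_pairs n" "F_free F ({0..<n}, E)" by blast
    then show "c \<in> {count_sub H G | G :: nat ugraph. wf_graph G \<and> fst G = {0..<n} \<and> F_free F G}"
      by (auto simp: wf_graph_interval)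
  qed
  then have "ex_gen n H F = Max ((\<lambda>E. count_sub H ({0..<n}, E)) ` ?A)" unfolding ex_gen_def by simp
  moreover have "card (automorphisms H) * Max ((\<lambda>E. count_sub H ({0..<n}, E)) ` ?A)
      = Max ((\<lambda>c. card (automorphisms H) * c) ` (\<lambda>E. count_sub H ({0..<n}, E)) ` ?A)"
    by (rule mono_Max_commute) (use fin ne in \<open>auto simp: mono_def\<close>)
  moreover have "(\<lambda>c. card (automorphisms H) * c) ` (\<lambda>E. count_sub H ({0..<n}, E)) ` ?A
      = (\<lambda>E. card (emb (fst H) (snd H) n E)) ` ?A"
    unfolding image_image by (rule image_cong) (auto simp: card_emb_eq[OF H])
  ultimately show ?thesis unfolding ex_emb_def by simp
qed

lemma complete_multipartite_mp:
  assumes "complete_multipartite q T" "fst T = {0..<n}"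
  obtains p where "\<forall>v<n. p v < q" "snd T = mp n p"
proof -
  obtain P where P: "\<forall>i<q. \<forall>j<q. i \<noteq> j \<longrightarrow> P i \<inter> P j = {}" "(\<Union>i<q. P i) = {0..<n}"
    "snd T = {{u, v} | u v. \<exists>i<q. \<exists>j<q. i \<noteq> j \<and> u \<in> P i \<and> v \<in> P j}"
    using assms unfolding complete_multipartite_def complete_multipartite_parts_def by auto
  have "\<exists>i. i < q \<and> v \<in> P i" if "v < n" for v
  proof -
    have "v \<in> (\<Union>i<q. P i)" using P(2) that by simp
    then show ?thesis by blast
  qed
  then obtain p where p: "\<And>v. v < n \<Longrightarrow> p v < q \<and> v \<in> P (p v)" by metis
  have P_iff: "v \<in> P i \<longleftrightarrow> v < n \<and> p v = i" if "i < q" for v i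
  proof
    assume v: "v \<in> P i"
    then have "v \<in> (\<Union>i<q. P i)" using that by blast
    then have "v < n" using P(2) by simp
    moreover from this have "p v = i" using p[of v] P(1) that v by blast
    ultimately show "v < n \<and> p v = i" by simp
  next
    assume "v < n \<and> p v = i"
    then show "v \<in> P i" using p by blast
  qed
  have "snd T = mp n p"
  proof (intro equalityI subsetI)
    fix e assume "e \<in> snd T"
    then obtain u v i j where "e = {u, v}" "i < q" "j < q" "i \<noteq> j" "u \<in> P i" "v \<in> P j"
      unfolding P(3) by blast
    then show "e \<in> mp n p" using P_iff by auto
  next
    fix e assume "e \<in> mp n p"
    then obtain u v where uv: "e = {u, v}" "u < n" "v < n" "p u \<noteq> p v" unfolding join_mp_def by blast
    then have "p u < q" "p v < q" "u \<in> P (p u)" "v \<in> P (p v)" using p by blast+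
    then show "e \<in> snd T" unfolding P(3) using uv by blast
  qed
  then show ?thesis using that p by blast
qed

text \<open>Indices below \<open>q\<close> enumerate \<open>B\<close>, and a vertex outside
  \<open>B\<close> gets index \<open>q + p v\<close>, so the parts of order 1 come first.\<close>

lemma join_mp_complete_multipartite:
  assumes B: "B \<subseteq> {..<n}" "card B = q" and p: "\<forall>v<n. p v < r" and ne: "\<forall>i<r. \<exists>v<n. v \<notin> B \<and> p v = i"
  shows "\<exists>P. complete_multipartite_parts (q + r) P ({0..<n}, join_mp n B p) \<and> (\<forall>i<q. card (P i) = 1)"
proof -
  have "finite B" using B(1) finite_subset by blast
  then obtain h where h: "bij_betw h {0..<q} B" using ex_bij_betw_nat_finite B(2) by blast
  define idx where "idx v = (if v \<in> B then inv_into {0..<q} h v else q + p v)" for v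
  have idxB: "idx v < q \<and> h (idx v) = v" if "v \<in> B" for v
    using h that bij_betw_inv_into_right[OF h that] inv_into_into[of v h "{0..<q}"]
    unfolding idx_def bij_betw_def by auto
  have idx_h: "idx (h i) = i" "h i \<in> B" if "i < q" for i
    using h that bij_betw_inv_into_left[OF h] unfolding idx_def bij_betw_def by auto
  have idx_less: "idx v < q + r" if "v < n" for v
    using idxB[of v] p that unfolding idx_def by auto
  define P where "P i = {v. v < n \<and> idx v = i}" for i
  have diff: "idx u \<noteq> idx v \<longleftrightarrow> u \<in> B \<or> v \<in> B \<or> p u \<noteq> p v" if "u \<noteq> v" for u v
  proof (cases "u \<in> B \<or> v \<in> B")
    case True
    have "idx u \<noteq> idx v"
    proof
      assume eq: "idx u = idx v"
      have "idx w < q \<longleftrightarrow> w \<in> B" for w using idxB[of w] by (cases "w \<in> B") (simp_all add: idx_def)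
      then have "u \<in> B" "v \<in> B" using True eq by metis+
      then have "h (idx u) = u" "h (idx v) = v" using idxB by blast+
      then show False using eq that by simp
    qed
    then show ?thesis using True by blast
  next
    case False
    then show ?thesis unfolding idx_def by simp
  qed
  have "P i \<noteq> {}" if "i < q + r" for i
  proof (cases "i < q")
    case True
    then have "h i \<in> P i" using idx_h[OF True] B(1) unfolding P_def by auto
    then show ?thesis by blast
  next
    case False
    then have "i - q < r" using that by simp
    then obtain v where "v < n" "v \<notin> B" "p v = i - q" using ne by blast
    then have "v \<in> P i" using False unfolding P_def idx_def by simp
    then show ?thesis by blast
  qed
  moreover have "(\<Union>i<q + r. P i) = {0..<n}" using idx_less unfolding P_def by auto
  moreover have "join_mp n B p = {{u, v} | u v. \<exists>i<q + r. \<exists>j<q + r. i \<noteq> j \<and> u \<in> P i \<and> v \<in> P j}"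
  proof (intro equalityI subsetI)
    fix e assume "e \<in> join_mp n B p"
    then obtain u v where uv: "e = {u, v}" "u < n" "v < n" "u \<noteq> v" "u \<in> B \<or> v \<in> B \<or> p u \<noteq> p v"
      unfolding join_mp_def by blast
    then have "idx u \<noteq> idx v" "u \<in> P (idx u)" "v \<in> P (idx v)" using diff unfolding P_def by auto
    then show "e \<in> {{u, v} | u v. \<exists>i<q + r. \<exists>j<q + r. i \<noteq> j \<and> u \<in> P i \<and> v \<in> P j}"
      using uv(1) idx_less[OF uv(2)] idx_less[OF uv(3)] by blast
  next
    fix e assume "e \<in> {{u, v} | u v. \<exists>i<q + r. \<exists>j<q + r. i \<noteq> j \<and> u \<in> P i \<and> v \<in> P j}"
    then obtain u v where "e = {u, v}" "u < n" "v < n" "idx u \<noteq> idx v" unfolding P_def by blast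
    then show "e \<in> join_mp n B p" using diff[of u v] by (cases "u = v") auto
  qed
  moreover have "\<forall>i<q + r. \<forall>j<q + r. i \<noteq> j \<longrightarrow> P i \<inter> P j = {}" unfolding P_def by auto
  ultimately have "complete_multipartite_parts (q + r) P ({0..<n}, join_mp n B p)"
    unfolding complete_multipartite_parts_def by simp
  moreover have "card (P i) = 1" if "i < q" for i
  proof -
    have "P i = {h i}"
    proof (intro equalityI subsetI)
      fix v assume v: "v \<in> P i"
      then have "v \<in> B" using that unfolding P_def idx_def by (auto split: if_splits)
      then show "v \<in> {h i}" using idxB[of v] v unfolding P_def by auto
    qed (use idx_h[OF that] B(1) in \<open>auto simp: P_def\<close>)
    then show ?thesis by simp
  qed
  ultimately show ?thesis by blast
qed

theorem theorem1p4:
  fixes r s :: nat and F :: "'b ugraph" and H :: "'c ugraph"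
  assumes "r \<ge> 2" and "s > 1"
    and "wf_graph F" and "wf_graph H"
    and "card {C \<in> comps F. chi (induced F C) = r + 1} = s"
    and "\<forall>C \<in> comps F. chi (induced F C) = r + 1 \<longrightarrow>
           (\<exists>e. color_critical_edge (induced F C) e)"
    and "\<forall>C \<in> comps F. chi (induced F C) \<le> r + 1"
    and "weakly_turan_stable H F"
  shows "\<exists>n0. \<forall>n\<ge>n0. \<exists>T :: nat ugraph. \<exists>P.
           wf_graph T \<and> fst T = {0..<n} \<and>
           complete_multipartite_parts (s + r - 1) P T \<and>
           (\<forall>i < s - 1. card (P i) = 1) \<and>
           ex_gen n H F = count_sub H T"
proof -
  interpret turan_forbidden F r s
    by unfold_locales (use assms in auto)
  let ?a = "card (automorphisms H)"
  let ?Free = "\<lambda>(n :: nat) E. F_free F ({0..<n}, E)"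
  have a: "0 < ?a" using card_automorphisms_pos wf_graph_finite[OF assms(4)] by blast
  have empty: "F_free F ({0..<n}, {})" for n :: nat
    by (rule free_join[of _ n "{}" "\<lambda>_. 0"]) (use s1 r2 in auto)
  note ex = ex_emb_eq[OF assms(4) empty]
  interpret stable_counting "fst H" "snd H" r s "card (fst F)" ?Free
  proof unfold_locales
    show "finite (fst H)" using assms(4) by (rule wf_graph_finite)
    show "2 \<le> r" "1 \<le> s" using assms by auto
  next
    fix n B p E
    assume "E \<subseteq> join_mp n B p" "B \<subseteq> {..<n}" "card B < s" "\<And>v. v < n \<Longrightarrow> p v < r"
    then show "?Free n E" by (rule free_join)
  next
    fix n E v W
    assume *: "?Free n E" "v < n" "W \<subseteq> {..<n} - {v}"
      "\<And>Q. Q \<subseteq> W \<Longrightarrow> card Q \<le> card (fst F) \<Longrightarrow> card (fst F) < card {u. u < n \<and> (\<forall>w\<in>Q. {u, w} \<in> E)}"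
    show "?Free n ({e \<in> E. v \<notin> e} \<union> star v W)" by (rule free_replace[OF *])
  next
    fix n E p X t L
    assume *: "E \<subseteq> all_pairs n" "X \<subseteq> {..<n}" "card X \<le> t"
      "\<And>v. v < n \<Longrightarrow> v \<notin> X \<Longrightarrow> card {w. w < n \<and> p w \<noteq> p v \<and> {v, w} \<notin> E} \<le> t"
      "\<And>j. j < r \<Longrightarrow> (card (fst F) + 1) * (t + 1) \<le> card (cls n p j)"
      "L \<subseteq> E" "card L = s" "\<And>e e'. e \<in> L \<Longrightarrow> e' \<in> L \<Longrightarrow> e \<noteq> e' \<Longrightarrow> e \<inter> e' = {}"
      "\<And>e. e \<in> L \<Longrightarrow> rich n p r E ((card (fst F) + 1) * (t + 1)) e"
    show "\<not> ?Free n E" by (rule not_free_rich[OF *])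
  next
    fix \<epsilon> :: real assume \<epsilon>: "0 < \<epsilon>"
    then obtain \<delta> n0 where \<delta>: "\<delta> > 0" and stab: "\<And>n (G :: nat ugraph). n \<ge> n0 \<Longrightarrow>
        wf_graph G \<and> fst G = {0..<n} \<and> F_free F G \<and>
        real (count_sub H G) \<ge> real (ex_gen n H F) - \<delta> * real n ^ card (fst H) \<Longrightarrow>
        \<exists>T. wf_graph T \<and> fst T = fst G \<and> complete_multipartite (chi F - 1) T \<and>
             real (edit_dist G T) \<le> \<epsilon> * real n ^ 2"
      using assms(8) unfolding weakly_turan_stable_def by metis
    \<comment> \<open>There are \<open>?a\<close> injective maps for each copy, so the tolerance
      \<delta> for copies becomes \<open>real ?a * \<delta>\<close> for maps.\<close>
    have "\<exists>p. (\<forall>v<n. p v < r) \<and> real (card ((E - mp n p) \<union> (mp n p - E))) \<le> \<epsilon> * real n ^ 2"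
      if n: "n \<ge> n0" and E: "E \<subseteq> all_pairs n" "?Free n E"
        "real (ex_emb (fst H) (snd H) ?Free n) - real ?a * \<delta> * real n ^ card (fst H) \<le> real (card (emb (fst H) (snd H) n E))"
      for n E
    proof -
      have "real ?a * (real (ex_gen n H F) - \<delta> * real n ^ card (fst H)) \<le> real ?a * real (count_sub H ({0..<n}, E))"
        using E(3) unfolding ex card_emb_eq[OF assms(4) E(1)] by (simp add: algebra_simps)
      then have "real (ex_gen n H F) - \<delta> * real n ^ card (fst H) \<le> real (count_sub H ({0..<n}, E))"
        using a by simp
      then obtain T where T: "fst T = {0..<n}" "complete_multipartite r T" "real (edit_dist ({0..<n}, E) T) \<le> \<epsilon> * real n ^ 2"
        using stab[OF n, of "({0..<n}, E)"] E wf_graph_interval chi_F by auto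
      obtain p where "\<forall>v<n. p v < r" "snd T = mp n p"
        using complete_multipartite_mp[OF T(2,1)] by blast
      then show ?thesis using T(3) unfolding edit_dist_def by auto
    qed
    moreover have "0 < real ?a * \<delta>" using a \<delta> by simp
    ultimately show "\<exists>\<delta>>0. \<forall>\<^sub>F n in sequentially. \<forall>E. E \<subseteq> all_pairs n \<longrightarrow> ?Free n E \<longrightarrow>
      real (ex_emb (fst H) (snd H) ?Free n) - \<delta> * real n ^ card (fst H) \<le> real (card (emb (fst H) (snd H) n E)) \<longrightarrow>
      (\<exists>p. (\<forall>v<n. p v < r) \<and> real (card ((E - mp n p) \<union> (mp n p - E))) \<le> \<epsilon> * real n ^ 2)"
      unfolding eventually_sequentially by blast
  qed
  obtain n0 where n0: "\<And>n. n \<ge> n0 \<Longrightarrow> \<exists>B p. B \<subseteq> {..<n} \<and> card B = s - 1 \<and> (\<forall>v<n. p v < r) \<and>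
     (\<forall>i<r. \<exists>v<n. v \<notin> B \<and> p v = i) \<and>
     card (emb (fst H) (snd H) n (join_mp n B p)) = ex_emb (fst H) (snd H) ?Free n"
    using extremal_structure unfolding eventually_sequentially by blast
  show ?thesis
  proof (intro exI[of _ n0] allI impI)
    fix n assume "n0 \<le> n"
    from n0[OF this] obtain B p where B: "B \<subseteq> {..<n}" "card B = s - 1" "\<forall>v<n. p v < r"
      "\<forall>i<r. \<exists>v<n. v \<notin> B \<and> p v = i"
      "card (emb (fst H) (snd H) n (join_mp n B p)) = ex_emb (fst H) (snd H) ?Free n"
      by (elim exE conjE)
    let ?T = "({0..<n}, join_mp n B p)"
    obtain P where P: "complete_multipartite_parts (s - 1 + r) P ?T" "\<forall>i<s - 1. card (P i) = 1"
      using join_mp_complete_multipartite[OF B(1-4)] by blast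
    have "?a * count_sub H ?T = ?a * ex_gen n H F"
      using B(5) unfolding ex card_emb_eq[OF assms(4) join_mp_subset] .
    then have "ex_gen n H F = count_sub H ?T" using a by simp
    moreover have "s + r - 1 = s - 1 + r" using s1 by simp
    moreover have "wf_graph ?T" using join_mp_subset by (simp add: wf_graph_interval)
    ultimately show "\<exists>T :: nat ugraph. \<exists>P. wf_graph T \<and> fst T = {0..<n} \<and>
           complete_multipartite_parts (s + r - 1) P T \<and> (\<forall>i < s - 1. card (P i) = 1) \<and>
           ex_gen n H F = count_sub H T"
      using P by (intro exI[of _ ?T] exI[of _ P]) simp
  qed
qed

end
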